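(* Let $G$ be a non-abelian limit group. Then $$\Sigma^1(\mathfrak{X}(G)) = \{[\chi] \in S(\mathfrak{X}(G)) \mid \chi_1 \neq 0,\ \chi_2 \neq 0,\ \chi_1 \neq \chi_2\},$$ where for a character $\chi : \mathfrak{X}(G) \to \mathbb{R}$ the homomorphisms $\chi_1, \chi_2 : G \to \mathbb{R}$ are given by $\chi_1(g) = \chi(g)$ and $\chi_2(g) = \chi(\overline{g})$.
   Context: A limit group is a finitely generated fully residually free group, i.e. for every finite subset $X$ of $G$ there is a free group $F$ and a homomorphism $G \to F$ whose restriction to $X$ is injective. For a group $G$ let $\overline{G}$ be an isomorphic copy of $G$, with $\overline{g}$ the image of $g \in G$, and let $\mathfrak{X}(G) = \langle G, \overline{G} \mid [g, \overline{g}] = 1 \text{ for } g \in G\rangle$. A character of a group $H$ is a non-zero homomorphism $\chi : H \to \mathbb{R}$. Two characters are equivalent if one is a positive real multiple of the other; $[\chi]$ is the equivalence class and $S(H)$ is the set of equivalence classes (the character sphere). Put $H_\chi = \{h \in H \mid \chi(h) \geq 0\}$. For a finitely generated group $H$ with finite generating set $X$, let $\Gamma$ be the Cayley graph (vertices $H$, edges from $h$ to $hx$, $x \in X$), and let $\Gamma_\chi$ be its subgraph spanned by $H_\chi$. Then $\Sigma^1(H) = \{[\chi] \in S(H) \mid \Gamma_\chi \text{ is connected}\}$ (independent of the choice of $X$). *)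

theory Defs
  imports Complex_Main "HOL-Algebra.Elementary_Groups" "Graph_Theory.Digraph_Component"
begin

hide_const (open) Topological_Spaces.connected

section \<open>Free groups and presentations\<close>

text \<open>The letter \<open>(True, x)\<close> stands for the generator \<open>x\<close>, the letter \<open>(False, x)\<close> for its
  inverse. The free group on \<open>S\<close> consists of the reduced words in these letters.\<close>

type_synonym 'b word = "(bool \<times> 'b) list"

definition flip :: "bool \<times> 'b \<Rightarrow> bool \<times> 'b" where
  "flip a = (\<not> fst a, snd a)"

definition reduced :: "'b word \<Rightarrow> bool" where
  "reduced w \<longleftrightarrow> successively (\<lambda>a b. b \<noteq> flip a) w"

fun reduced_cons :: "bool \<times> 'b \<Rightarrow> 'b word \<Rightarrow> 'b word" where
  "reduced_cons a [] = [a]"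
| "reduced_cons a (b # w) = (if b = flip a then w else a # b # w)"

definition free_group :: "'b set \<Rightarrow> 'b word monoid" where
  "free_group S = \<lparr>carrier = {w. reduced w \<and> snd ` set w \<subseteq> S},
     monoid.mult = (\<lambda>u v. foldr reduced_cons u v), one = []\<rparr>"

lemma flip_flip [simp]: "flip (flip a) = a"
  by (simp add: flip_def)

lemma snd_flip [simp]: "snd (flip a) = snd a"
  by (simp add: flip_def)

lemma reduced_reduced_cons: "reduced w \<Longrightarrow> reduced (reduced_cons a w)"
  by (cases w) (auto simp: reduced_def successively_Cons)

lemma reduced_foldr: "reduced w \<Longrightarrow> reduced (foldr reduced_cons u w)"
  by (induction u) (auto intro: reduced_reduced_cons)

lemma reduced_cons_flip [simp]:
  assumes "reduced w"
  shows "reduced_cons a (reduced_cons (flip a) w) = w"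
proof (cases w)
  case (Cons b v)
  then show ?thesis
    using assms by (cases v) (auto simp: reduced_def)
qed simp

lemma set_reduced_cons: "set (reduced_cons a w) \<subseteq> insert a (set w)"
  by (cases w) auto

lemma set_foldr_reduced_cons: "set (foldr reduced_cons u w) \<subseteq> set u \<union> set w"
proof (induction u)
  case (Cons a u)
  then show ?case
    using set_reduced_cons[of a "foldr reduced_cons u w"] by auto
qed simp

lemma foldr_reduced_cons_assoc:
  assumes "reduced w"
  shows "foldr reduced_cons (foldr reduced_cons u v) w =
    foldr reduced_cons u (foldr reduced_cons v w)"
proof (induction u)
  case (Cons a u)
  have "foldr reduced_cons (reduced_cons a x) w = reduced_cons a (foldr reduced_cons x w)" for x
    using reduced_cons_flip[OF reduced_foldr[OF assms], of a "tl x"] by (cases x) auto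
  with Cons show ?case by simp
qed simp

lemma foldr_reduced_cons_Nil: "reduced w \<Longrightarrow> foldr reduced_cons w [] = w"
proof (induction w)
  case (Cons a w)
  then show ?case by (cases w) (auto simp: reduced_def)
qed simp

lemma foldr_reduced_cons_inverse:
  "reduced w \<Longrightarrow> foldr reduced_cons (map flip (rev u)) (foldr reduced_cons u w) = w"
proof (induction u arbitrary: w)
  case (Cons a u)
  have "reduced_cons (flip a) (reduced_cons (flip (flip a)) (foldr reduced_cons u w)) =
      foldr reduced_cons u w"
    by (rule reduced_cons_flip[OF reduced_foldr[OF Cons.prems]])
  with Cons show ?case by simp
qed simp

lemma reduced_inverse: "reduced w \<Longrightarrow> reduced (map flip (rev w))"
  unfolding reduced_def successively_map successively_rev
  by (erule successively_mono) (metis flip_flip)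

lemma group_free_group: "group (free_group S)"
proof (rule groupI)
  fix x y
  assume "x \<in> carrier (free_group S)" "y \<in> carrier (free_group S)"
  then show "x \<otimes>\<^bsub>free_group S\<^esub> y \<in> carrier (free_group S)"
    using set_foldr_reduced_cons[of x y]
    by (fastforce simp: free_group_def intro: reduced_foldr)
next
  fix x
  assume "x \<in> carrier (free_group S)"
  then have x: "reduced x" "snd ` set x \<subseteq> S"
    by (auto simp: free_group_def)
  have "map flip (rev x) \<otimes>\<^bsub>free_group S\<^esub> x = \<one>\<^bsub>free_group S\<^esub>"
    using foldr_reduced_cons_inverse[of "[]" x] foldr_reduced_cons_Nil[OF x(1)]
    by (simp add: free_group_def reduced_def)
  moreover have "map flip (rev x) \<in> carrier (free_group S)"
    using x by (auto simp: free_group_def reduced_inverse)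
  ultimately show "\<exists>y\<in>carrier (free_group S). y \<otimes>\<^bsub>free_group S\<^esub> x = \<one>\<^bsub>free_group S\<^esub>"
    by blast
qed (auto simp: free_group_def foldr_reduced_cons_assoc, simp add: reduced_def)

definition gen :: "'b \<Rightarrow> 'b word" where
  "gen x = [(True, x)]"

lemma gen_in_free_group: "x \<in> S \<Longrightarrow> gen x \<in> carrier (free_group S)"
  by (simp add: free_group_def gen_def reduced_def)

lemma hom_free_group_in_subgroup:
  assumes "group K" "w \<in> carrier (free_group S)" "f \<in> hom (free_group S) K" "subgroup U K"
    "\<And>x. x \<in> S \<Longrightarrow> f (gen x) \<in> U"
  shows "f w \<in> U"
  using assms(2)
proof (induction w)
  interpret K: group K by fact
  interpret F: group "free_group S" by (rule group_free_group)
  interpret h: group_hom "free_group S" K f using assms(3) by unfold_locales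
  { case Nil
    have "f [] = \<one>\<^bsub>K\<^esub>" using h.hom_one by (simp add: free_group_def)
    then show ?case using subgroup.one_closed[OF assms(4)] by simp
  next
    case (Cons a w)
    obtain b x where a: "a = (b, x)" by (cases a)
    have w: "w \<in> carrier (free_group S)" and x: "x \<in> S"
      using Cons.prems a by (auto simp: free_group_def reduced_def successively_Cons)
    have ic: "[(False, x)] \<in> carrier (free_group S)" using x by (simp add: free_group_def reduced_def)
    have "inv\<^bsub>free_group S\<^esub> gen x = [(False, x)]"
      using x ic by (intro F.inv_equality) (auto simp: gen_in_free_group, simp add: free_group_def gen_def flip_def)
    then have i: "f [a] \<in> U"
      using a assms(5)[OF x] h.hom_inv[OF gen_in_free_group[OF x]] subgroup.m_inv_closed[OF assms(4)]
      by (cases b) (auto simp: gen_def)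
    have ac: "[a] \<in> carrier (free_group S)" using ic x a by (cases b) (auto simp: free_group_def reduced_def)
    have "a # w = [a] \<otimes>\<^bsub>free_group S\<^esub> w"
      using Cons.prems by (cases w) (auto simp: free_group_def reduced_def)
    then have "f (a # w) = f [a] \<otimes>\<^bsub>K\<^esub> f w" using h.hom_mult[OF ac w] by simp
    then show ?case using i Cons.IH[OF w] subgroup.m_closed[OF assms(4)] by simp }
qed

definition normal_closure :: "('a, 'm) monoid_scheme \<Rightarrow> 'a set \<Rightarrow> 'a set" where
  "normal_closure G R = \<Inter>{N. N \<lhd> G \<and> R \<subseteq> N}"

definition presented_group :: "'b set \<Rightarrow> 'b word set \<Rightarrow> 'b word set monoid" where
  "presented_group S R = free_group S Mod normal_closure (free_group S) R"

lemma normal_closure_normal: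
  assumes "group G" "R \<subseteq> carrier G"
  shows "normal_closure G R \<lhd> G"
proof -
  interpret group G by fact
  have carr: "carrier G \<lhd> G"
    by (simp add: normal_inv_iff subgroup_self)
  show ?thesis
    unfolding normal_inv_iff
  proof (intro conjI ballI)
    have "subgroup (\<Inter>{N. N \<lhd> G \<and> R \<subseteq> N}) G"
      by (rule subgroups_Inter) (use carr assms(2) in \<open>auto simp: normal_imp_subgroup\<close>)
    then show "subgroup (normal_closure G R) G"
      by (simp add: normal_closure_def)
  next
    fix x h
    assume "x \<in> carrier G" "h \<in> normal_closure G R"
    then show "x \<otimes>\<^bsub>G\<^esub> h \<otimes>\<^bsub>G\<^esub> inv\<^bsub>G\<^esub> x \<in> normal_closure G R"
      by (auto simp: normal_closure_def normal_inv_iff)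
  qed
qed

lemma group_presented_group:
  "R \<subseteq> carrier (free_group S) \<Longrightarrow> group (presented_group S R)"
  unfolding presented_group_def
  by (intro normal.factorgroup_is_group normal_closure_normal group_free_group)

definition presented_gen :: "'b set \<Rightarrow> 'b word set \<Rightarrow> 'b \<Rightarrow> 'b word set" where
  "presented_gen S R x = normal_closure (free_group S) R #>\<^bsub>free_group S\<^esub> gen x"

section \<open>Limit groups\<close>

definition finite_generating_set :: "('a, 'm) monoid_scheme \<Rightarrow> 'a set \<Rightarrow> bool" where
  "finite_generating_set G X \<longleftrightarrow> finite X \<and> X \<subseteq> carrier G \<and> generate G X = carrier G"

text \<open>The first argument only fixes the type from which the bases of the free groups are drawn,
  since a formula cannot quantify over types. A statement assuming \<open>limit_group TYPE('b) G\<close> with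
  a type variable \<open>'b\<close> that occurs nowhere else covers bases of every type.\<close>

definition fully_residually_free :: "'b itself \<Rightarrow> ('a, 'm) monoid_scheme \<Rightarrow> bool" where
  "fully_residually_free _ G \<longleftrightarrow>
     (\<forall>X. finite X \<and> X \<subseteq> carrier G \<longrightarrow>
        (\<exists>(S :: 'b set) f. f \<in> hom G (free_group S) \<and> inj_on f X))"

definition limit_group :: "'b itself \<Rightarrow> ('a, 'm) monoid_scheme \<Rightarrow> bool" where
  "limit_group T G \<longleftrightarrow>
     group G \<and> (\<exists>X. finite_generating_set G X) \<and> fully_residually_free T G"

section \<open>The weak commutativity construction\<close>

text \<open>The generators \<open>Inl g\<close> and \<open>Inr g\<close> stand for \<open>g\<close> and its copy \<open>\<bar>g\<close>. Writing the groups
  \<open>G\<close> and \<open>\<bar>G\<close> in a presentation includes their multiplication tables among the relators.\<close>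

definition wc_gens :: "('a, 'm) monoid_scheme \<Rightarrow> ('a + 'a) set" where
  "wc_gens G = carrier G <+> carrier G"

definition table_relators ::
  "('a, 'm) monoid_scheme \<Rightarrow> ('a \<Rightarrow> 'b) \<Rightarrow> ('b word, 'k) monoid_scheme \<Rightarrow> 'b word set" where
  "table_relators G \<iota> F =
     {gen (\<iota> g) \<otimes>\<^bsub>F\<^esub> gen (\<iota> h) \<otimes>\<^bsub>F\<^esub> inv\<^bsub>F\<^esub> gen (\<iota> (g \<otimes>\<^bsub>G\<^esub> h)) | g h.
        g \<in> carrier G \<and> h \<in> carrier G}"

definition wc_relators :: "('a, 'm) monoid_scheme \<Rightarrow> ('a + 'a) word set" where
  "wc_relators G = (let F = free_group (wc_gens G) in
     table_relators G Inl F \<union> table_relators G Inr F \<union>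
     {gen (Inl g) \<otimes>\<^bsub>F\<^esub> gen (Inr g) \<otimes>\<^bsub>F\<^esub> inv\<^bsub>F\<^esub> gen (Inl g) \<otimes>\<^bsub>F\<^esub> inv\<^bsub>F\<^esub> gen (Inr g) | g.
        g \<in> carrier G})"

lemma wc_relators_subset:
  assumes "group G"
  shows "wc_relators G \<subseteq> carrier (free_group (wc_gens G))"
proof -
  interpret G: group G by fact
  interpret F: group "free_group (wc_gens G)" by (rule group_free_group)
  have "gen (Inl g) \<in> carrier (free_group (wc_gens G))" "gen (Inr g) \<in> carrier (free_group (wc_gens G))"
    if "g \<in> carrier G" for g
    using that by (auto intro!: gen_in_free_group simp: wc_gens_def)
  then show ?thesis
    by (auto simp: wc_relators_def table_relators_def Let_def)
qed

definition weak_commutativity_group ::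
  "('a, 'm) monoid_scheme \<Rightarrow> ('a + 'a) word set monoid" (\<open>\<XX>\<close>) where
  "\<XX> G = presented_group (wc_gens G) (wc_relators G)"

lemma group_weak_commutativity_group: "group G \<Longrightarrow> group (\<XX> G)"
  by (simp add: weak_commutativity_group_def group_presented_group wc_relators_subset)

definition wc_left :: "('a, 'm) monoid_scheme \<Rightarrow> 'a \<Rightarrow> ('a + 'a) word set" where
  "wc_left G g = presented_gen (wc_gens G) (wc_relators G) (Inl g)"

definition wc_right :: "('a, 'm) monoid_scheme \<Rightarrow> 'a \<Rightarrow> ('a + 'a) word set" where
  "wc_right G g = presented_gen (wc_gens G) (wc_relators G) (Inr g)"

lemma wc_generated:
  assumes G: "group G" and U: "subgroup U (\<XX> G)"
    and g: "\<And>g. g \<in> carrier G \<Longrightarrow> wc_left G g \<in> U \<and> wc_right G g \<in> U"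
  shows "carrier (\<XX> G) \<subseteq> U"
proof
  let ?F = "free_group (wc_gens G)" let ?N = "normal_closure ?F (wc_relators G)"
  have n: "?N \<lhd> ?F" by (intro normal_closure_normal group_free_group wc_relators_subset G)
  have X: "\<XX> G = ?F Mod ?N" by (simp add: weak_commutativity_group_def presented_group_def)
  fix c assume "c \<in> carrier (\<XX> G)"
  then obtain w where w: "w \<in> carrier ?F" "c = ?N #>\<^bsub>?F\<^esub> w"
    by (auto simp: X FactGroup_def RCOSETS_def)
  have "(\<lambda>w. ?N #>\<^bsub>?F\<^esub> w) w \<in> U"
    by (rule hom_free_group_in_subgroup[OF group_weak_commutativity_group[OF G] w(1) _ U])
       (use g n in \<open>auto simp: X wc_gens_def wc_left_def wc_right_def presented_gen_def
         intro: normal.r_coset_hom_Mod\<close>)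
  then show "c \<in> U" using w by simp
qed

lemma wc_left_right:
  assumes G: "group G"
  shows "wc_left G \<in> hom G (\<XX> G)" "wc_right G \<in> hom G (\<XX> G)"
    "g \<in> carrier G \<Longrightarrow> wc_left G g \<otimes>\<^bsub>\<XX> G\<^esub> wc_right G g = wc_right G g \<otimes>\<^bsub>\<XX> G\<^esub> wc_left G g"
proof -
  let ?F = "free_group (wc_gens G)" let ?N = "normal_closure ?F (wc_relators G)"
  interpret G: group G by fact
  interpret F: group ?F by (rule group_free_group)
  interpret K: group "\<XX> G" by (rule group_weak_commutativity_group[OF G])
  have n: "?N \<lhd> ?F" by (intro normal_closure_normal group_free_group wc_relators_subset G)
  interpret N: normal ?N ?F by fact
  have X: "\<XX> G = ?F Mod ?N" by (simp add: weak_commutativity_group_def presented_group_def)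
  let ?q = "\<lambda>w. ?N #>\<^bsub>?F\<^esub> w"
  interpret q: group_hom ?F "\<XX> G" ?q
    by unfold_locales (auto simp: X intro: N.r_coset_hom_Mod)
  have gl: "gen (Inl g) \<in> carrier ?F" "gen (Inr g) \<in> carrier ?F" if "g \<in> carrier G" for g
    using that by (auto intro!: gen_in_free_group simp: wc_gens_def)
  have rel: "?q r = \<one>\<^bsub>\<XX> G\<^esub>" if "r \<in> wc_relators G" for r
  proof -
    have "r \<in> ?N" using that by (auto simp: normal_closure_def)
    then show ?thesis by (simp add: X FactGroup_def N.rcos_const F.coset_join2 N.subset N.subgroup_axioms)
  qed
  have L: "wc_left G g = ?q (gen (Inl g))" "wc_right G g = ?q (gen (Inr g))" for g
    by (auto simp: wc_left_def wc_right_def presented_gen_def)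
  have *: "?q (gen (\<iota> (g \<otimes>\<^bsub>G\<^esub> h))) = ?q (gen (\<iota> g)) \<otimes>\<^bsub>\<XX> G\<^esub> ?q (gen (\<iota> h))"
    if "\<iota> = Inl \<or> \<iota> = Inr" "g \<in> carrier G" "h \<in> carrier G" for \<iota> g h
  proof -
    have c: "gen (\<iota> g) \<in> carrier ?F" if "g \<in> carrier G" for g
      using gl that \<open>\<iota> = Inl \<or> \<iota> = Inr\<close> by auto
    have "?q (gen (\<iota> g) \<otimes>\<^bsub>?F\<^esub> gen (\<iota> h) \<otimes>\<^bsub>?F\<^esub> inv\<^bsub>?F\<^esub> gen (\<iota> (g \<otimes>\<^bsub>G\<^esub> h))) = \<one>\<^bsub>\<XX> G\<^esub>"
      by (rule rel) (use that in \<open>auto simp: wc_relators_def table_relators_def Let_def\<close>)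
    then have "?q (gen (\<iota> g)) \<otimes>\<^bsub>\<XX> G\<^esub> ?q (gen (\<iota> h)) \<otimes>\<^bsub>\<XX> G\<^esub> inv\<^bsub>\<XX> G\<^esub> ?q (gen (\<iota> (g \<otimes>\<^bsub>G\<^esub> h))) = \<one>\<^bsub>\<XX> G\<^esub>"
      using c that by simp
    then show ?thesis using c that
      by (metis G.m_closed K.inv_equality K.inv_inv K.m_closed K.inv_closed q.hom_closed)
  qed
  show "wc_left G \<in> hom G (\<XX> G)" "wc_right G \<in> hom G (\<XX> G)"
    using * gl q.hom_closed by (auto simp: hom_def L)
  assume g: "g \<in> carrier G"
  have "?q (gen (Inl g) \<otimes>\<^bsub>?F\<^esub> gen (Inr g) \<otimes>\<^bsub>?F\<^esub> inv\<^bsub>?F\<^esub> gen (Inl g) \<otimes>\<^bsub>?F\<^esub> inv\<^bsub>?F\<^esub> gen (Inr g)) = \<one>\<^bsub>\<XX> G\<^esub>"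
      by (rule rel) (use g in \<open>auto simp: wc_relators_def Let_def\<close>)
  then have "wc_left G g \<otimes>\<^bsub>\<XX> G\<^esub> wc_right G g \<otimes>\<^bsub>\<XX> G\<^esub> inv\<^bsub>\<XX> G\<^esub> wc_left G g \<otimes>\<^bsub>\<XX> G\<^esub> inv\<^bsub>\<XX> G\<^esub> wc_right G g = \<one>\<^bsub>\<XX> G\<^esub>"
    using gl[OF g] by (simp add: L)
  then show "wc_left G g \<otimes>\<^bsub>\<XX> G\<^esub> wc_right G g = wc_right G g \<otimes>\<^bsub>\<XX> G\<^esub> wc_left G g"
    using gl[OF g] q.hom_closed unfolding L
    by (smt (verit) K.inv_closed K.inv_equality K.inv_inv K.inv_solve_right K.m_closed)
qed

lemma finite_generating_set_wc:
  assumes G: "group G" and X: "finite_generating_set G Y"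
  shows "finite_generating_set (\<XX> G) (wc_left G ` Y \<union> wc_right G ` Y)" (is "finite_generating_set _ ?Z")
proof -
  interpret G: group G by fact
  interpret K: group "\<XX> G" by (rule group_weak_commutativity_group[OF G])
  interpret l: group_hom G "\<XX> G" "wc_left G" by unfold_locales (rule wc_left_right[OF G])
  interpret r: group_hom G "\<XX> G" "wc_right G" by unfold_locales (rule wc_left_right[OF G])
  have Y: "finite Y" "Y \<subseteq> carrier G" "generate G Y = carrier G" using X by (auto simp: finite_generating_set_def)
  have Z: "?Z \<subseteq> carrier (\<XX> G)" using Y l.hom_closed r.hom_closed by auto
  have U: "subgroup (generate (\<XX> G) ?Z) (\<XX> G)" by (rule K.generate_is_subgroup[OF Z])
  have "wc_left G ` carrier G \<subseteq> generate (\<XX> G) ?Z" "wc_right G ` carrier G \<subseteq> generate (\<XX> G) ?Z"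
    using l.generate_img[OF Y(2)] r.generate_img[OF Y(2)] K.mono_generate[of "wc_left G ` Y" ?Z]
      K.mono_generate[of "wc_right G ` Y" ?Z] Y(3) by auto
  then have "carrier (\<XX> G) \<subseteq> generate (\<XX> G) ?Z" by (intro wc_generated[OF G U]) auto
  then show ?thesis using Z Y K.generate_incl[OF Z] by (auto simp: finite_generating_set_def)
qed

section \<open>The character sphere and the invariant \<open>\<Sigma>\<^sup>1\<close>\<close>

definition real_group :: "real monoid" where
  "real_group = \<lparr>carrier = UNIV, monoid.mult = (+), one = 0\<rparr>"

text \<open>Homomorphisms to the reals are taken to be extensional (arbitrary but fixed outside the
  carrier), so that functions equal on the carrier are equal.\<close>

definition real_homs :: "('a, 'm) monoid_scheme \<Rightarrow> ('a \<Rightarrow> real) set" where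
  "real_homs H = hom H real_group \<inter> extensional (carrier H)"

definition zero_hom :: "('a, 'm) monoid_scheme \<Rightarrow> 'a \<Rightarrow> real" where
  "zero_hom H = (\<lambda>h\<in>carrier H. 0)"

definition characters :: "('a, 'm) monoid_scheme \<Rightarrow> ('a \<Rightarrow> real) set" where
  "characters H = real_homs H - {zero_hom H}"

definition char_equiv :: "('a, 'm) monoid_scheme \<Rightarrow> (('a \<Rightarrow> real) \<times> ('a \<Rightarrow> real)) set" where
  "char_equiv H = {(\<chi>, \<psi>). \<chi> \<in> characters H \<and> \<psi> \<in> characters H \<and>
     (\<exists>c>0. \<forall>h\<in>carrier H. \<psi> h = c * \<chi> h)}"

lemma equiv_char_equiv: "equiv (characters H) (char_equiv H)"
proof (rule equivI)
  show "char_equiv H \<subseteq> characters H \<times> characters H"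
    by (auto simp: char_equiv_def)
  show "refl_on (characters H) (char_equiv H)"
    by (auto simp: refl_on_def char_equiv_def intro: exI[of _ 1])
  show "sym (char_equiv H)"
  proof (rule symI)
    fix \<chi> \<psi> assume "(\<chi>, \<psi>) \<in> char_equiv H"
    then obtain c where "c > 0" "\<forall>h\<in>carrier H. \<psi> h = c * \<chi> h" "\<chi> \<in> characters H" "\<psi> \<in> characters H"
      by (auto simp: char_equiv_def)
    then show "(\<psi>, \<chi>) \<in> char_equiv H"
      by (auto simp: char_equiv_def intro!: exI[of _ "1 / c"])
  qed
  show "trans (char_equiv H)"
  proof (rule transI)
    fix \<chi> \<psi> \<phi> assume "(\<chi>, \<psi>) \<in> char_equiv H" "(\<psi>, \<phi>) \<in> char_equiv H"
    then obtain c d where "c > 0" "d > 0" "\<forall>h\<in>carrier H. \<psi> h = c * \<chi> h"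
      "\<forall>h\<in>carrier H. \<phi> h = d * \<psi> h" "\<chi> \<in> characters H" "\<phi> \<in> characters H"
      by (auto simp: char_equiv_def)
    then show "(\<chi>, \<phi>) \<in> char_equiv H"
      by (auto simp: char_equiv_def intro!: exI[of _ "d * c"])
  qed
qed

definition char_class :: "('a, 'm) monoid_scheme \<Rightarrow> ('a \<Rightarrow> real) \<Rightarrow> ('a \<Rightarrow> real) set" where
  "char_class H \<chi> = char_equiv H `` {\<chi>}"

definition character_sphere :: "('a, 'm) monoid_scheme \<Rightarrow> ('a \<Rightarrow> real) set set" where
  "character_sphere H = characters H // char_equiv H"

lemma char_class_in_sphere: "\<chi> \<in> characters H \<Longrightarrow> char_class H \<chi> \<in> character_sphere H"
  by (simp add: char_class_def character_sphere_def quotientI)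

definition cayley_graph ::
  "('a, 'm) monoid_scheme \<Rightarrow> 'a set \<Rightarrow> ('a, 'a \<times> 'a) pre_digraph" where
  "cayley_graph H X = \<lparr>verts = carrier H, arcs = carrier H \<times> X,
     tail = fst, head = (\<lambda>(h, x). h \<otimes>\<^bsub>H\<^esub> x)\<rparr>"

definition nonneg_part :: "('a, 'm) monoid_scheme \<Rightarrow> ('a \<Rightarrow> real) \<Rightarrow> 'a set" where
  "nonneg_part H \<chi> = {h \<in> carrier H. \<chi> h \<ge> 0}"

text \<open>\<open>connected\<close> is connectedness of the underlying undirected graph. For finitely generated \<open>H\<close>
  the set \<open>Sigma1 H X\<close> is the same for every finite generating set \<open>X\<close>; the generating set is kept
  as a parameter, and statements range over all of them.\<close>

definition Sigma1 :: "('a, 'm) monoid_scheme \<Rightarrow> 'a set \<Rightarrow> ('a \<Rightarrow> real) set set" where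
  "Sigma1 H X = {char_class H \<chi> | \<chi>. \<chi> \<in> characters H \<and>
     connected (cayley_graph H X \<restriction> nonneg_part H \<chi>)}"

definition char1 ::
  "('a, 'm) monoid_scheme \<Rightarrow> (('a + 'a) word set \<Rightarrow> real) \<Rightarrow> 'a \<Rightarrow> real" where
  "char1 G \<chi> = (\<lambda>g\<in>carrier G. \<chi> (wc_left G g))"

definition char2 ::
  "('a, 'm) monoid_scheme \<Rightarrow> (('a + 'a) word set \<Rightarrow> real) \<Rightarrow> 'a \<Rightarrow> real" where
  "char2 G \<chi> = (\<lambda>g\<in>carrier G. \<chi> (wc_right G g))"

end

theory Submission
  imports Defs "HOL-Analysis.Function_Topology" "HOL-Analysis.Convex" "HOL-Combinatorics.Permutations"
begin

text \<open>If \<open>\<chi>\<^sub>1 = 0\<close>, \<open>\<chi>\<^sub>2 = 0\<close> or \<open>\<chi>\<^sub>1 = \<chi>\<^sub>2\<close>, then \<open>\<chi>\<close> factors through one of three retractions of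
  \<open>\<XX> G\<close> onto \<open>G\<close>, so it suffices that \<open>\<Sigma>\<^sup>1(G)\<close> is empty for a non-abelian limit group. If
  \<open>[\<psi>] \<in> \<Sigma>\<^sup>1(G)\<close>, paths from \<open>t\<close> to \<open>x t\<close> in the region \<open>\<psi> \<ge> \<psi>(t) > 0\<close> give finitely many
  relations which force every cocycle \<open>d\<close> with \<open>d t = 0\<close> to satisfy \<open>A d = 0\<close>, where \<open>A = 1 - L\<close> is
  a matrix over the group ring with all terms of \<open>L\<close> of positive degree, for a suitable integral
  approximation of \<open>\<psi>\<close>. Map \<open>G\<close> to a free group and on to a finite group \<open>\<Omega>\<close>, injectively on a
  large ball. A non-abelian subgroup of a free group has a space of cocycles in functions on \<open>\<Omega>\<close>
  of dimension at least \<open>2|\<Omega>|\<close> (use two edges outside a spanning tree of its Schreier graph), so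
  \<open>A\<close> has a kernel of dimension at least \<open>|\<Omega>|\<close> there. Traces of powers of \<open>1 - A\<^sup>*A/C\<close> depend only on
  a ball in \<open>G\<close>, up to the factor \<open>|\<Omega>|\<close>, hence on \<open>\<Omega> \<times> \<int>/m\<close> there are about \<open>m|\<Omega>|\<close> almost
  vanishing eigenvalues. But \<open>A\<close> raises levels, so it is bounded below, uniformly in \<open>\<Omega>\<close>, on the
  functions vanishing on a fixed number of the \<open>m\<close> levels.

  Conversely, write \<open>c'\<close> for the copy of \<open>c\<close> and \<open>N\<close> for the kernel of \<open>\<chi>\<close> on the centralizer of all
  elements \<open>c c'\<^sup>-\<^sup>1\<close>. It contains all commutators of \<open>G\<close> with its copy, so modulo \<open>N\<close> one connects
  points as in \<open>G \<times> G\<close>; and an element of \<open>N\<close> is connected to \<open>1\<close> because it commutes with an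
  element \<open>c c'\<^sup>-\<^sup>1\<close> on which \<open>\<chi>\<close> is positive.\<close>

section \<open>Symmetric operators on functions on a finite set\<close>

text \<open>The grading does not factor through the map of \<open>G\<close> to the free group, so on
  \<Omega> \<times> \<int>/m there is no direct supply of cocycles and the kernel of
  \<open>A\<close> cannot be estimated there. This is what the traces are for: the trace of a power
  of 1 - A*A/C is the same multiple of the number of points in both actions, and so carries the
  estimate from \<Omega> to \<Omega> \<times> \<int>/m. No limit is taken, hence the order of
  choices is essential. The table L fixes the largest degree j; j and the number n of generators fix
  m; m fixes the spectral gap, the gap the exponent k, and k the finite set of group elements
  occurring in the k-th power. Only then is \<Omega> chosen, to be free on that set. This is
  consistent because every constant is read off from L and never from \<Omega>. The pattern is that
  of approximating an L2-Betti number by finite quotients, with finite-dimensional real linear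
  algebra throughout.\<close>

lemma homogeneous_system:
  fixes a :: "'e \<Rightarrow> 'v \<Rightarrow> real"
  assumes "finite E" "finite V" "card E < card V"
  shows "\<exists>x. (\<exists>v\<in>V. x v \<noteq> 0) \<and> (\<forall>e\<in>E. (\<Sum>v\<in>V. a e v * x v) = 0)"
  using assms
proof (induction E arbitrary: V a)
  case empty
  then have "V \<noteq> {}" by auto
  then show ?case by (intro exI[of _ "\<lambda>_. 1"]) auto
next
  case (insert e0 E)
  show ?case
  proof (cases "\<forall>v\<in>V. a e0 v = 0")
    case True
    obtain x where x: "\<exists>v\<in>V. x v \<noteq> 0" "\<forall>e\<in>E. (\<Sum>v\<in>V. a e v * x v) = 0"
      using insert.IH[of V a] insert.hyps insert.prems by auto
    have "(\<Sum>v\<in>V. a e0 v * x v) = 0" using True by simp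
    with x show ?thesis by (intro exI[of _ x]) auto
  next
    case False
    then obtain v0 where v0: "v0 \<in> V" "a e0 v0 \<noteq> 0" by auto
    define W where "W = V - {v0}"
    \<comment> \<open>Gaussian elimination with pivot \<open>v0\<close> in equation
      \<open>e0\<close>: \<open>b\<close> is the system left after eliminating \<open>v0\<close>,
      and \<open>y\<close> below recovers the value at \<open>v0\<close> from
      \<open>e0\<close>.\<close>
    define b where "b = (\<lambda>e v. a e v - a e v0 * a e0 v / a e0 v0)"
    have W: "finite W" "card E < card W" "v0 \<notin> W" "V = insert v0 W"
      using insert.hyps insert.prems v0 by (auto simp: W_def)
    obtain x where x: "\<exists>v\<in>W. x v \<noteq> 0" "\<forall>e\<in>E. (\<Sum>v\<in>W. b e v * x v) = 0"
      using insert.IH[of W b] W by auto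
    define y where "y = x(v0 := - (\<Sum>v\<in>W. a e0 v * x v) / a e0 v0)"
    have eq: "(\<Sum>v\<in>V. a e v * y v) = (\<Sum>v\<in>W. a e v * x v) - a e v0 * (\<Sum>v\<in>W. a e0 v * x v) / a e0 v0" for e
    proof -
      have "(\<Sum>v\<in>W. a e v * y v) = (\<Sum>v\<in>W. a e v * x v)"
        by (rule sum.cong) (use W in \<open>auto simp: y_def\<close>)
      then show ?thesis using W by (simp add: y_def)
    qed
    have "(\<Sum>v\<in>W. b e v * x v) = (\<Sum>v\<in>W. a e v * x v) - a e v0 * (\<Sum>v\<in>W. a e0 v * x v) / a e0 v0" for e
      by (simp add: b_def left_diff_distrib sum_subtractf sum_distrib_left sum_divide_distrib mult.assoc)
    with x(2) eq have "\<forall>e\<in>E. (\<Sum>v\<in>V. a e v * y v) = 0" by simp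
    moreover have "(\<Sum>v\<in>V. a e0 v * y v) = 0" using eq v0 by simp
    moreover have "\<exists>v\<in>V. y v \<noteq> 0"
    proof -
      obtain v where v: "v \<in> W" "x v \<noteq> 0" using x by auto
      then have "y v = x v" using W by (auto simp: y_def)
      with v W(4) show ?thesis by (intro bexI[of _ v]) simp_all
    qed
    ultimately show ?thesis by (intro exI[of _ y]) auto
  qed
qed

text \<open>Vectors are functions on the whole type that vanish off a finite set, so that equality
  of vectors is equality of functions and different \<open>I\<close> need no change of type.\<close>

definition supported :: "'p set \<Rightarrow> ('p \<Rightarrow> real) \<Rightarrow> bool" where
  "supported I u \<longleftrightarrow> (\<forall>p. p \<notin> I \<longrightarrow> u p = 0)"

definition delta :: "'p \<Rightarrow> 'p \<Rightarrow> real" where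
  "delta p = (\<lambda>q. if q = p then 1 else 0)"

definition ip :: "'p set \<Rightarrow> ('p \<Rightarrow> real) \<Rightarrow> ('p \<Rightarrow> real) \<Rightarrow> real" where
  "ip I u v = (\<Sum>p\<in>I. u p * v p)"

definition linear_functional :: "(('p \<Rightarrow> real) \<Rightarrow> real) \<Rightarrow> bool" where
  "linear_functional f \<longleftrightarrow> (\<forall>u v. f (\<lambda>p. u p + v p) = f u + f v) \<and> (\<forall>c u. f (\<lambda>p. c * u p) = c * f u)"

lemma linear_functional_sum:
  assumes "linear_functional f" "finite J"
  shows "f (\<lambda>p. \<Sum>j\<in>J. c j * u j p) = (\<Sum>j\<in>J. c j * f (u j))"
  using assms(2)
proof induction
  case empty
  have "f (\<lambda>p. 0 * undefined p) = 0 * f undefined"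
    using assms(1) unfolding linear_functional_def by blast
  then show ?case by simp
next
  case (insert j J)
  have "f (\<lambda>p. c j * u j p + (\<Sum>j\<in>J. c j * u j p)) = c j * f (u j) + f (\<lambda>p. \<Sum>j\<in>J. c j * u j p)"
    using assms(1) unfolding linear_functional_def by simp
  with insert show ?case by simp
qed

lemma supported_expand:
  assumes "finite I" "supported I u"
  shows "u = (\<lambda>p. \<Sum>r\<in>I. u r * delta r p)"
proof
  fix p
  show "u p = (\<Sum>r\<in>I. u r * delta r p)"
    using assms by (cases "p \<in> I") (auto simp: delta_def supported_def if_distrib cong: if_cong)
qed

lemma linear_functional_expand:
  assumes "linear_functional f" "finite I" "supported I u"
  shows "f u = (\<Sum>r\<in>I. u r * f (delta r))"
  using linear_functional_sum[OF assms(1,2), of u delta] supported_expand[OF assms(2,3)] by simp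

lemma homogeneous_functionals:
  fixes L :: "'e \<Rightarrow> ('v \<Rightarrow> real) \<Rightarrow> real"
  assumes "finite E" "finite V" "card E < card V" "\<And>e. e \<in> E \<Longrightarrow> linear_functional (L e)"
  obtains x where "supported V x" "\<exists>v\<in>V. x v \<noteq> 0" "\<And>e. e \<in> E \<Longrightarrow> L e x = 0"
proof -
  obtain x where x: "\<exists>v\<in>V. x v \<noteq> 0" "\<forall>e\<in>E. (\<Sum>v\<in>V. L e (delta v) * x v) = 0"
    using homogeneous_system[OF assms(1-3), of "\<lambda>e v. L e (delta v)"] by auto
  define y where "y = (\<lambda>v. if v \<in> V then x v else 0)"
  have y: "supported V y" by (simp add: y_def supported_def)
  have "L e y = (\<Sum>v\<in>V. L e (delta v) * x v)" if "e \<in> E" for e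
    using linear_functional_expand[OF assms(4)[OF that] assms(2) y] by (simp add: y_def mult.commute)
  with x show ?thesis by (intro that[of y] y) (auto simp: y_def)
qed

lemma ip_linear:
  "linear_functional (\<lambda>u. ip I u v)" "linear_functional (ip I u)"
  by (auto simp: linear_functional_def ip_def algebra_simps sum.distrib sum_distrib_left)

lemma ip_commute: "ip I u v = ip I v u"
  by (simp add: ip_def mult.commute)

lemma ip_nonneg: "0 \<le> ip I u u"
  by (auto simp: ip_def intro: sum_nonneg)

lemma ip_eq_0:
  assumes "finite I" "supported I u" "ip I u u = 0"
  shows "u = (\<lambda>_. 0)"
proof
  fix p
  show "u p = 0"
    using assms sum_nonneg_eq_0_iff[of I "\<lambda>p. u p * u p"] by (cases "p \<in> I") (auto simp: ip_def supported_def)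
qed

definition orthonormal :: "'p set \<Rightarrow> nat \<Rightarrow> (nat \<Rightarrow> 'p \<Rightarrow> real) \<Rightarrow> bool" where
  "orthonormal I n e \<longleftrightarrow> (\<forall>i<n. supported I (e i)) \<and> (\<forall>i<n. \<forall>j<n. ip I (e i) (e j) = (if i = j then 1 else 0))"

text \<open>The remainder \<open>w\<close> is orthogonal to all \<open>e i\<close>. Together these
  are \<open>card I + 1\<close> vectors with \<open>card I\<close> coordinates, hence dependent;
  pairing a dependency with the \<open>e j\<close> leaves only the coefficient of \<open>w\<close>,
  so \<open>w\<close> has norm zero.\<close>

lemma orthonormal_expand:
  assumes I: "finite I" and e: "orthonormal I (card I) e" and u: "supported I u"
  shows "u = (\<lambda>p. \<Sum>i<card I. ip I u (e i) * e i p)"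
proof -
  let ?n = "card I"
  define w where "w = (\<lambda>p. u p - (\<Sum>i<?n. ip I u (e i) * e i p))"
  define f where "f = (\<lambda>i. if i < ?n then e i else w)"
  have se: "supported I (e i)" if "i < ?n" for i using e that by (auto simp: orthonormal_def)
  have ws: "supported I w" using u se by (auto simp: w_def supported_def intro: sum.neutral)
  have wo: "ip I w (e j) = 0" if "j < ?n" for j
  proof -
    have "ip I w (e j) = ip I u (e j) - ip I (\<lambda>p. \<Sum>i<?n. ip I u (e i) * e i p) (e j)"
      by (simp add: ip_def w_def left_diff_distrib sum_subtractf)
    also have "ip I (\<lambda>p. \<Sum>i<?n. ip I u (e i) * e i p) (e j) = (\<Sum>i<?n. ip I u (e i) * ip I (e i) (e j))"
      by (rule linear_functional_sum[OF ip_linear(1)]) simp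
    also have "\<dots> = (\<Sum>i<?n. ip I u (e i) * (if i = j then 1 else 0))"
      using e that by (intro sum.cong) (auto simp: orthonormal_def)
    also have "\<dots> = ip I u (e j)" using that by (simp add: if_distrib cong: if_cong)
    finally show ?thesis by simp
  qed
  obtain x where x: "\<exists>i\<in>{..?n}. x i \<noteq> 0" "\<forall>p\<in>I. (\<Sum>i\<in>{..?n}. f i p * x i) = 0"
    using homogeneous_system[OF I, of "{..?n}" "\<lambda>p i. f i p"] by auto
  have *: "(\<Sum>i\<in>{..?n}. x i * ip I (f i) g) = 0" for g
  proof -
    have "(\<Sum>i\<in>{..?n}. x i * ip I (f i) g) = ip I (\<lambda>p. \<Sum>i\<in>{..?n}. x i * f i p) g"
      by (rule linear_functional_sum[OF ip_linear(1), symmetric]) simp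
    also have "\<dots> = 0" using x(2) by (simp add: ip_def mult.commute)
    finally show ?thesis .
  qed
  have x0: "x j = 0" if "j < ?n" for j
  proof -
    have "(\<Sum>i\<in>{..?n}. x i * ip I (f i) (e j)) = (\<Sum>i\<in>{..?n}. x i * (if i = j then 1 else 0))"
      using e that wo by (intro sum.cong) (auto simp: f_def orthonormal_def)
    with *[of "e j"] that show ?thesis by (simp add: if_distrib cong: if_cong)
  qed
  then have "x ?n \<noteq> 0" using x(1) by (metis atMost_iff le_neq_implies_less)
  moreover have "(\<Sum>i\<in>{..?n}. x i * ip I (f i) w) = x ?n * ip I w w"
    using x0 by (subst sum.remove[of _ ?n]) (auto simp: f_def intro!: sum.neutral)
  ultimately have "ip I w w = 0" using * by simp
  then have "w = (\<lambda>_. 0)" using ip_eq_0 I ws by blast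
  then show ?thesis by (auto simp: w_def fun_eq_iff)
qed

section \<open>Spectral theorem for symmetric operators on functions on a finite set\<close>

locale symmetric_op =
  fixes I :: "'p set" and T :: "('p \<Rightarrow> real) \<Rightarrow> 'p \<Rightarrow> real"
  assumes finite_I: "finite I"
    and lin: "linear_functional (\<lambda>u. T u p)"
    and supp: "supported I (T u)"
    and sym: "supported I u \<Longrightarrow> supported I v \<Longrightarrow> ip I (T u) v = ip I u (T v)"
begin

lemma T_add: "T (\<lambda>p. u p + v p) = (\<lambda>p. T u p + T v p)"
  and T_scale: "T (\<lambda>p. c * u p) = (\<lambda>p. c * T u p)"
  using lin by (auto simp: linear_functional_def fun_eq_iff)

text \<open>The type of points may be infinite; pinning the coordinates off \<open>I\<close> to 0
  gives a product of compact sets in the product topology.\<close>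

lemma compact_unit_ball: "compact {u. \<forall>p. u p \<in> (if p \<in> I then {-1..1} else {0::real})}"
proof -
  have "compactin (product_topology (\<lambda>_. euclidean) UNIV) (PiE UNIV (\<lambda>p. if p \<in> I then {-1..1} else {0::real}))"
    by (subst compactin_PiE) auto
  moreover have "PiE UNIV (\<lambda>p. if p \<in> I then {-1..1} else {0::real}) = {u. \<forall>p. u p \<in> (if p \<in> I then {-1..1} else {0})}"
    by (auto simp: PiE_def Pi_def)
  ultimately show ?thesis by (simp add: euclidean_product_topology)
qed

lemma continuous_on_ip_T:
  "continuous_on {u. supported I u} (\<lambda>u. ip I (T u) u)"
proof -
  have "continuous_on {u. supported I u} (\<lambda>u. \<Sum>p\<in>I. (\<Sum>r\<in>I. u r * T (delta r) p) * u p)"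
    by (intro continuous_intros continuous_on_subset[OF continuous_on_product_coordinates]) auto
  then show ?thesis
    by (rule continuous_on_eq) (simp add: ip_def linear_functional_expand[OF lin finite_I])
qed

text \<open>Maximize the quadratic form of \<open>T\<close> on the unit sphere of the orthogonal
  complement \<open>U\<close> of the eigenvectors found so far. \<open>U\<close> is invariant
  because \<open>T\<close> is symmetric, and a maximizer is an eigenvector by first
  variation.\<close>

lemma next_eigenvector:
  assumes e: "orthonormal I n e" "\<And>i. i < n \<Longrightarrow> T (e i) = (\<lambda>p. l i * e i p)" and n: "n < card I"
  obtains u \<mu> where "supported I u" "ip I u u = 1" "\<And>i. i < n \<Longrightarrow> ip I u (e i) = 0" "T u = (\<lambda>p. \<mu> * u p)"
proof -
  define U where "U = {u. supported I u \<and> (\<forall>i<n. ip I u (e i) = 0)}"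
  have U_scale: "(\<lambda>p. c * u p) \<in> U" if "u \<in> U" for c u
    using that ip_linear(1)[of I] by (auto simp: U_def supported_def linear_functional_def)
  have U_add: "(\<lambda>p. u p + v p) \<in> U" if "u \<in> U" "v \<in> U" for u v
    using that ip_linear(1)[of I] by (auto simp: U_def supported_def linear_functional_def)
  have U_T: "T u \<in> U" if "u \<in> U" for u
  proof -
    have "ip I (T u) (e i) = 0" if "i < n" for i
    proof -
      have "ip I (T u) (e i) = ip I u (T (e i))" using \<open>u \<in> U\<close> that e by (intro sym) (auto simp: U_def orthonormal_def)
      also have "\<dots> = l i * ip I u (e i)" using e(2)[OF that] ip_linear(2)[of I u] by (simp add: linear_functional_def)
      finally show ?thesis using \<open>u \<in> U\<close> that by (simp add: U_def)
    qed
    then show ?thesis using supp by (simp add: U_def)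
  qed
  define K where "K = {u \<in> U. ip I u u = 1}"
  obtain x where x: "supported I x" "\<exists>v\<in>I. x v \<noteq> 0" "\<And>i. i \<in> {..<n} \<Longrightarrow> ip I x (e i) = 0"
    using homogeneous_functionals[of "{..<n}" I "\<lambda>i u. ip I u (e i)"] n finite_I ip_linear by (metis card_lessThan finite_lessThan)
  have normalize: "(\<lambda>p. (1 / sqrt (ip I u u)) * u p) \<in> K" if "u \<in> U" "ip I u u \<noteq> 0" for u
  proof -
    have "ip I (\<lambda>p. c * u p) (\<lambda>p. c * u p) = c\<^sup>2 * ip I u u" for c
      by (simp add: ip_def sum_distrib_left power2_eq_square algebra_simps)
    moreover have "ip I u u > 0" using ip_nonneg[of I u] that(2) by simp
    ultimately have "ip I (\<lambda>p. (1 / sqrt (ip I u u)) * u p) (\<lambda>p. (1 / sqrt (ip I u u)) * u p) = 1"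
      by (simp only: power_divide) simp
    then show ?thesis using U_scale[OF that(1)] unfolding K_def by blast
  qed
  have "x \<in> U" using x by (auto simp: U_def)
  moreover have "ip I x x \<noteq> 0" using x ip_eq_0[OF finite_I x(1)] by auto
  ultimately have Kne: "K \<noteq> {}" using normalize by blast
  have Kc: "compact K"
  proof -
    have le: "\<bar>u p\<bar> \<le> 1" if "ip I u u = 1" "p \<in> I" for u p
    proof -
      have "u p * u p \<le> ip I u u" unfolding ip_def
        using member_le_sum[of p I "\<lambda>p. u p * u p"] that finite_I by simp
      then show ?thesis using that by (metis abs_le_square_iff abs_one power2_eq_square power_one mult_1)
    qed
    have "K = {u. \<forall>p. u p \<in> (if p \<in> I then {-1..1} else {0::real})} \<inter>
        ((\<Inter>i<n. {u. ip I u (e i) = 0}) \<inter> {u. ip I u u = 1})"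
      using le by (auto simp: K_def U_def supported_def abs_le_iff minus_le_iff)
    moreover have "closed ((\<Inter>i<n. {u. ip I u (e i) = 0}) \<inter> {u. ip I u u = 1})"
      unfolding ip_def
      by (intro closed_Int closed_INT ballI closed_Collect_eq continuous_intros continuous_on_product_coordinates)
    ultimately show ?thesis using compact_unit_ball by (simp add: compact_Int_closed)
  qed
  have "continuous_on K (\<lambda>u. ip I (T u) u)"
    by (rule continuous_on_subset[OF continuous_on_ip_T]) (auto simp: K_def U_def)
  then obtain u where u: "u \<in> K" "\<And>v. v \<in> K \<Longrightarrow> ip I (T v) v \<le> ip I (T u) u"
    using continuous_attains_sup[OF Kc Kne] by blast
  define \<mu> where "\<mu> = ip I (T u) u"
  have uU: "u \<in> U" and u1: "ip I u u = 1" using u by (auto simp: K_def)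
  have us: "supported I u" using uU by (simp add: U_def)
  have le: "ip I (T v) v \<le> \<mu> * ip I v v" if "v \<in> U" for v
  proof (cases "ip I v v = 0")
    case True
    then have "v = (\<lambda>_. 0)" using ip_eq_0 finite_I that by (auto simp: U_def)
    then show ?thesis by (simp add: ip_def)
  next
    case False
    let ?c = "1 / sqrt (ip I v v)"
    have "ip I (T (\<lambda>p. ?c * v p)) (\<lambda>p. ?c * v p) \<le> \<mu>"
      using u(2)[OF normalize[OF that False]] by (simp add: \<mu>_def)
    also have "ip I (T (\<lambda>p. ?c * v p)) (\<lambda>p. ?c * v p) = ?c\<^sup>2 * ip I (T v) v"
      unfolding T_scale by (simp add: ip_def sum_distrib_left sum_divide_distrib power2_eq_square algebra_simps)
    finally show ?thesis using False ip_nonneg[of I v] by (simp add: power_divide field_simps)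
  qed
  define w where "w = (\<lambda>p. \<mu> * u p + (-1) * T u p)"
  have wU: "w \<in> U" unfolding w_def by (intro U_add U_scale U_T uU)
  define a where "a = \<mu> * ip I w w - ip I (T w) w"
  \<comment> \<open>\<open>w\<close> is the residue \<mu> u - T u. When maximality is tested at u +
    s w, the terms of order zero cancel and the term of order one is 2 s |w|^2; a nonzero
    \<open>w\<close> would make the whole negative for small negative s.\<close>
  have quad: "0 \<le> 2 * s * ip I w w + s\<^sup>2 * a" for s
  proof -
    let ?v = "\<lambda>p. u p + s * w p"
    have ws: "supported I w" using wU by (simp add: U_def)
    have vv: "ip I ?v ?v = 1 + 2 * s * ip I u w + s\<^sup>2 * ip I w w"
      unfolding u1[symmetric] by (simp add: ip_def algebra_simps sum.distrib sum_distrib_left power2_eq_square)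
    have Tvv: "ip I (T ?v) ?v = \<mu> + s * ip I (T u) w + s * ip I (T w) u + s\<^sup>2 * ip I (T w) w"
      unfolding T_add T_scale \<mu>_def
      by (simp add: ip_def algebra_simps sum.distrib sum_distrib_left power2_eq_square)
    have Twu: "ip I (T w) u = ip I (T u) w"
      using sym[OF ws us] by (simp add: ip_commute)
    have ww: "ip I w w = \<mu> * ip I u w - ip I (T u) w"
    proof -
      have "ip I w w = ip I (\<lambda>p. \<mu> * u p + (-1) * T u p) w" by (simp add: w_def)
      also have "\<dots> = \<mu> * ip I u w - ip I (T u) w"
        by (simp add: ip_def left_diff_distrib sum_subtractf sum_distrib_left mult.assoc)
      finally show ?thesis .
    qed
    have "2 * s * ip I w w + s\<^sup>2 * a = 2 * s * (\<mu> * ip I u w - ip I (T u) w) + s\<^sup>2 * a" by (simp only: ww)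
    also have "\<dots> = \<mu> * ip I ?v ?v - ip I (T ?v) ?v"
      unfolding vv Tvv Twu a_def by (simp add: algebra_simps)
    also have "\<dots> \<ge> 0" using le[OF U_add[OF uU U_scale[OF wU]], of s] by simp
    finally show ?thesis .
  qed
  have "ip I w w = 0"
  proof (rule ccontr)
    assume "ip I w w \<noteq> 0"
    then have pos: "ip I w w > 0" using ip_nonneg[of I w] by simp
    define b where "b = \<bar>a\<bar> + 1"
    have b: "b > 0" "a \<le> b" by (auto simp: b_def)
    let ?s = "- ip I w w / b"
    have "2 * ?s * ip I w w + ?s\<^sup>2 * a \<le> 2 * ?s * ip I w w + ?s\<^sup>2 * b"
      using b by (intro add_left_mono mult_left_mono) auto
    also have "\<dots> = - (ip I w w)\<^sup>2 / b" using b by (simp add: power2_eq_square field_simps)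
    also have "\<dots> < 0" using pos b by (simp add: divide_neg_pos)
    finally show False using quad[of ?s] by simp
  qed
  then have "w = (\<lambda>_. 0)" using ip_eq_0 finite_I wU by (auto simp: U_def)
  then have "T u = (\<lambda>p. \<mu> * u p)" by (auto simp: w_def fun_eq_iff)
  with us u1 uU show ?thesis by (intro that) (auto simp: U_def)
qed

lemma eigenbasis:
  obtains e l where "orthonormal I (card I) e" "\<And>i. i < card I \<Longrightarrow> T (e i) = (\<lambda>p. l i * e i p)"
proof -
  have "\<exists>e l. orthonormal I n e \<and> (\<forall>i<n. T (e i) = (\<lambda>p. l i * e i p))" if "n \<le> card I" for n
    using that
  proof (induction n)
    case 0
    then show ?case by (auto simp: orthonormal_def)
  next
    case (Suc n)
    then obtain e l where e: "orthonormal I n e" "\<forall>i<n. T (e i) = (\<lambda>p. l i * e i p)" by auto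
    obtain u c where u: "supported I u" "ip I u u = 1" "\<And>i. i < n \<Longrightarrow> ip I u (e i) = 0" "T u = (\<lambda>p. c * u p)"
    proof -
      have "T (e i) = (\<lambda>p. l i * e i p)" if "i < n" for i using e(2) that by blast
      moreover have "n < card I" using Suc.prems by simp
      ultimately show ?thesis using next_eigenvector[OF e(1)] that by blast
    qed
    have "ip I (e i) u = 0" if "i < n" for i using u(3)[OF that] by (simp add: ip_commute)
    then have "orthonormal I (Suc n) (e(n := u))"
      using e(1) u(1-3) by (auto simp: orthonormal_def less_Suc_eq)
    moreover have "\<forall>i<Suc n. T ((e(n := u)) i) = (\<lambda>p. (l(n := c)) i * (e(n := u)) i p)"
      using e(2) u(4) by (auto simp: less_Suc_eq)
    ultimately show ?case by blast
  qed
  then show ?thesis using that by blast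
qed

lemma trace_power:
  assumes e: "orthonormal I (card I) e" "\<And>i. i < card I \<Longrightarrow> T (e i) = (\<lambda>p. l i * e i p)"
  shows "(\<Sum>p\<in>I. (T ^^ k) (delta p) p) = (\<Sum>i<card I. l i ^ k)"
proof -
  have pw: "(T ^^ k) u = (\<lambda>p. \<Sum>i<card I. (l i ^ k * ip I u (e i)) * e i p)" if "supported I u" for u
  proof (induction k)
    case 0
    then show ?case using orthonormal_expand[OF finite_I e(1) that] by simp
  next
    case (Suc k)
    have "T (\<lambda>p. \<Sum>i<card I. (l i ^ k * ip I u (e i)) * e i p) q = (\<Sum>i<card I. (l i ^ k * ip I u (e i)) * T (e i) q)" for q
      by (rule linear_functional_sum[OF lin]) simp
    also have "\<dots> q = (\<Sum>i<card I. (l i ^ Suc k * ip I u (e i)) * e i q)" for q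
      using e(2) by (intro sum.cong) (auto simp: algebra_simps)
    finally show ?case using Suc by auto
  qed
  have ipd: "ip I (delta p) (e i) = e i p" if "p \<in> I" for p i
    using that finite_I by (simp add: ip_def delta_def if_distrib[of "\<lambda>x. x * _"] cong: if_cong)
  have "(T ^^ k) (delta p) p = (\<Sum>i<card I. l i ^ k * (e i p * e i p))" if "p \<in> I" for p
    using pw[of "delta p"] that ipd[OF that] by (simp add: supported_def delta_def mult.assoc)
  then have "(\<Sum>p\<in>I. (T ^^ k) (delta p) p) = (\<Sum>p\<in>I. \<Sum>i<card I. l i ^ k * (e i p * e i p))" by simp
  also have "\<dots> = (\<Sum>i<card I. l i ^ k * ip I (e i) (e i))"
    by (subst sum.swap) (simp add: ip_def sum_distrib_left)
  also have "\<dots> = (\<Sum>i<card I. l i ^ k)"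
    using e(1) by (intro sum.cong) (auto simp: orthonormal_def)
  finally show ?thesis .
qed

end

section \<open>Counting eigenvalues of a contraction through traces of powers\<close>

locale contraction_op = symmetric_op I T for I :: "'p set" and T +
  assumes nonneg: "supported I u \<Longrightarrow> 0 \<le> ip I (T u) u"
    and le_1: "supported I u \<Longrightarrow> ip I (T u) u \<le> ip I u u"
begin

lemma eigenvalue_bounds:
  assumes "orthonormal I (card I) e" "\<And>i. i < card I \<Longrightarrow> T (e i) = (\<lambda>p. l i * e i p)" "i < card I"
  shows "0 \<le> l i" "l i \<le> 1"
proof -
  have "ip I (T (e i)) (e i) = l i"
    using assms ip_linear(1)[of I "e i"] by (auto simp: orthonormal_def linear_functional_def)
  moreover have "supported I (e i)" "ip I (e i) (e i) = 1" using assms by (auto simp: orthonormal_def)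
  ultimately show "0 \<le> l i" "l i \<le> 1" using nonneg[of "e i"] le_1[of "e i"] by auto
qed

text \<open>The eigenspace for 1 receives, through the map \<Phi>, the solutions in the variables
  \<open>V\<close> of the equations \<open>E\<close>. If fewer than \<open>d\<close> of the
  \<open>e i\<close> had eigenvalue 1, orthogonality to them would add few enough equations for a
  nonzero solution \<open>x\<close> to remain; \<open>\<Phi> x\<close> is fixed by \<open>T\<close>,
  hence orthogonal to the other \<open>e i\<close> as well, and vanishes, against
  injectivity.\<close>

lemma trace_power_ge:
  fixes \<Phi> :: "('v \<Rightarrow> real) \<Rightarrow> 'p \<Rightarrow> real" and R :: "'e \<Rightarrow> ('v \<Rightarrow> real) \<Rightarrow> real"
  assumes "finite V" "finite E" "card E + d \<le> card V"
    and \<Phi>: "\<And>p. linear_functional (\<lambda>x. \<Phi> x p)" "\<And>x. supported I (\<Phi> x)"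
    and R: "\<And>e. e \<in> E \<Longrightarrow> linear_functional (R e)"
    and fixed: "\<And>x. supported V x \<Longrightarrow> (\<And>e. e \<in> E \<Longrightarrow> R e x = 0) \<Longrightarrow> T (\<Phi> x) = \<Phi> x"
    and inj: "\<And>x. supported V x \<Longrightarrow> (\<And>e. e \<in> E \<Longrightarrow> R e x = 0) \<Longrightarrow> \<Phi> x = (\<lambda>_. 0) \<Longrightarrow> x = (\<lambda>_. 0)"
  shows "real d \<le> (\<Sum>p\<in>I. (T ^^ k) (delta p) p)"
proof -
  obtain e l where e: "orthonormal I (card I) e" "\<And>i. i < card I \<Longrightarrow> T (e i) = (\<lambda>p. l i * e i p)"
    using eigenbasis by blast
  define N where "N = {i. i < card I \<and> l i = 1}"
  have N: "finite N" by (simp add: N_def)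
  have "d \<le> card N"
  proof (rule ccontr)
    assume "\<not> d \<le> card N"
    then have c: "card (E <+> N) < card V" using assms(1-3) N by (simp add: card_Plus)
    define L where "L = case_sum R (\<lambda>i x. ip I (\<Phi> x) (e i))"
    have lin2: "linear_functional (\<lambda>x. ip I (\<Phi> x) v)" for v
      using \<Phi>(1) by (auto simp: linear_functional_def ip_def algebra_simps sum.distrib sum_distrib_left)
    have "linear_functional (L a)" if "a \<in> E <+> N" for a
      using that R lin2 by (auto simp: L_def)
    then obtain x where x: "supported V x" "\<exists>v\<in>V. x v \<noteq> 0" "\<And>a. a \<in> E <+> N \<Longrightarrow> L a x = 0"
      using homogeneous_functionals[OF _ assms(1) c] assms(2) N by (metis finite_Plus)
    have Rx: "R a x = 0" if "a \<in> E" for a using x(3)[of "Inl a"] that by (auto simp: L_def)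
    have Nx: "ip I (\<Phi> x) (e i) = 0" if "i \<in> N" for i using x(3)[of "Inr i"] that by (auto simp: L_def)
    have "ip I (\<Phi> x) (e i) = 0" if "i < card I" for i
    proof (cases "l i = 1")
      case True
      then show ?thesis using Nx that by (simp add: N_def)
    next
      case False
      have "ip I (\<Phi> x) (e i) = ip I (T (\<Phi> x)) (e i)" using fixed[OF x(1) Rx] by simp
      also have "\<dots> = ip I (\<Phi> x) (T (e i))" using \<Phi>(2) e(1) that by (intro sym) (auto simp: orthonormal_def)
      also have "\<dots> = l i * ip I (\<Phi> x) (e i)" using e(2)[OF that] ip_linear(2)[of I "\<Phi> x"] by (simp add: linear_functional_def)
      finally show ?thesis using False by simp
    qed
    then have "\<Phi> x = (\<lambda>_. 0)" using orthonormal_expand[OF finite_I e(1) \<Phi>(2)[of x]] by simp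
    then have "x = (\<lambda>_. 0)" using inj x(1) Rx by blast
    then show False using x(2) by simp
  qed
  then have "real d \<le> (\<Sum>i\<in>N. l i ^ k)" by (simp add: N_def)
  also have "\<dots> \<le> (\<Sum>i<card I. l i ^ k)"
    by (rule sum_mono2) (auto simp: N_def eigenvalue_bounds(1)[OF e])
  finally show ?thesis by (simp add: trace_power[OF e])
qed

text \<open>Min-max principle: more than \<open>card J\<close> eigenvectors with eigenvalue above
  \<rho> would have a nonzero combination vanishing on \<open>J\<close>, and its quadratic form
  would violate \<open>W\<close>. So at most \<open>card J\<close> eigenvalues exceed \<rho>; these
  contribute at most 1 each, the others at most \<rho>^k.\<close>

lemma trace_power_le:
  fixes \<rho> :: real
  assumes "J \<subseteq> I" and "0 \<le> \<rho>"
    and W: "\<And>u. supported (I - J) u \<Longrightarrow> ip I (T u) u \<le> \<rho> * ip I u u"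
  shows "(\<Sum>p\<in>I. (T ^^ k) (delta p) p) \<le> card J + card I * \<rho> ^ k"
proof -
  obtain e l where e: "orthonormal I (card I) e" "\<And>i. i < card I \<Longrightarrow> T (e i) = (\<lambda>p. l i * e i p)"
    using eigenbasis by blast
  define N where "N = {i. i < card I \<and> l i > \<rho>}"
  have N: "finite N" by (simp add: N_def)
  have fJ: "finite J" using assms(1) finite_I finite_subset by blast
  have "card N \<le> card J"
  proof (rule ccontr)
    assume "\<not> card N \<le> card J"
    then obtain x where x: "\<exists>i\<in>N. x i \<noteq> 0" "\<forall>p\<in>J. (\<Sum>i\<in>N. e i p * x i) = 0"
      using homogeneous_system[OF fJ N, of "\<lambda>p i. e i p"] by auto
    define u where "u = (\<lambda>p. \<Sum>i\<in>N. x i * e i p)"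
    have "supported I u" using e(1) by (auto simp: u_def supported_def orthonormal_def N_def intro: sum.neutral)
    moreover have "u p = 0" if "p \<in> J" for p using x(2) that by (simp add: u_def mult.commute)
    ultimately have us: "supported (I - J) u" by (auto simp: supported_def)
    have ue: "ip I u (e j) = x j" if "j \<in> N" for j
    proof -
      have "ip I u (e j) = (\<Sum>i\<in>N. x i * ip I (e i) (e j))"
        unfolding u_def by (rule linear_functional_sum[OF ip_linear(1) N])
      also have "\<dots> = (\<Sum>i\<in>N. x i * (if i = j then 1 else 0))"
        using e(1) that by (intro sum.cong) (auto simp: orthonormal_def N_def)
      finally show ?thesis using that N by (simp add: if_distrib cong: if_cong)
    qed
    have uu: "ip I u u = (\<Sum>i\<in>N. x i * x i)"
    proof -
      have "ip I u (\<lambda>p. \<Sum>i\<in>N. x i * e i p) = (\<Sum>i\<in>N. x i * ip I u (e i))"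
        by (rule linear_functional_sum[OF ip_linear(2) N])
      then show ?thesis using ue by (simp add: u_def[symmetric])
    qed
    have Tu: "T u = (\<lambda>p. \<Sum>i\<in>N. (x i * l i) * e i p)"
    proof
      fix p
      have "T u p = (\<Sum>i\<in>N. x i * T (e i) p)" unfolding u_def by (rule linear_functional_sum[OF lin N])
      also have "\<dots> = (\<Sum>i\<in>N. (x i * l i) * e i p)" using e(2) by (intro sum.cong) (auto simp: N_def)
      finally show "T u p = (\<Sum>i\<in>N. (x i * l i) * e i p)" .
    qed
    have "ip I (T u) u = (\<Sum>i\<in>N. (x i * l i) * ip I (e i) u)"
      unfolding Tu by (rule linear_functional_sum[OF ip_linear(1) N])
    then have Tuu: "ip I (T u) u = (\<Sum>i\<in>N. l i * (x i * x i))"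
      using ue by (simp add: ip_commute[of I _ u] algebra_simps)
    obtain j where j: "j \<in> N" "x j \<noteq> 0" using x(1) by auto
    have "\<rho> * ip I u u < ip I (T u) u" unfolding uu Tuu sum_distrib_left
    proof (rule sum_strict_mono_ex1[OF N])
      show "\<forall>i\<in>N. \<rho> * (x i * x i) \<le> l i * (x i * x i)" by (auto simp: N_def intro: mult_right_mono)
      show "\<exists>i\<in>N. \<rho> * (x i * x i) < l i * (x i * x i)"
        using j by (intro bexI[of _ j] mult_strict_right_mono) (auto simp: N_def zero_less_mult_iff linorder_neq_iff)
    qed
    with W[OF us] show False by simp
  qed
  moreover have "(\<Sum>i<card I. l i ^ k) \<le> (\<Sum>i<card I. (if i \<in> N then 1 else (0::real)) + \<rho> ^ k)"
  proof (rule sum_mono)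
    fix i assume i: "i \<in> {..<card I}"
    then have b: "0 \<le> l i" "l i \<le> 1" using eigenvalue_bounds[OF e] by auto
    show "l i ^ k \<le> (if i \<in> N then 1 else (0::real)) + \<rho> ^ k"
    proof (cases "i \<in> N")
      case True
      have "l i ^ k \<le> 1" using b by (simp add: power_le_one)
      moreover have "0 \<le> \<rho> ^ k" using assms(2) by simp
      ultimately have "l i ^ k \<le> 1 + \<rho> ^ k" by linarith
      then show ?thesis using True by simp
    next
      case False
      then have "l i \<le> \<rho>" using i by (auto simp: N_def)
      then show ?thesis using b False by (simp add: power_mono)
    qed
  qed
  moreover have "(\<Sum>i<card I. (if i \<in> N then 1 else (0::real)) + \<rho> ^ k) = card N + card I * \<rho> ^ k"
  proof -
    have "{..<card I} \<inter> N = N" by (auto simp: N_def)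
    moreover have "(\<Sum>i<card I. if i \<in> N then 1 else (0::real)) = card ({..<card I} \<inter> N)"
      by (subst sum.inter_restrict[symmetric]) auto
    ultimately show ?thesis by (simp add: sum.distrib)
  qed
  ultimately have "(\<Sum>i<card I. l i ^ k) \<le> card J + card I * \<rho> ^ k" by linarith
  then show ?thesis by (simp add: trace_power[OF e])
qed

end

section \<open>Group ring operators on finite actions\<close>

locale right_action = group G for G (structure) +
  fixes \<Omega> :: "'w set" and act :: "'w \<Rightarrow> 'a \<Rightarrow> 'w"
  assumes finite_points: "finite \<Omega>"
    and act_closed: "q \<in> \<Omega> \<Longrightarrow> g \<in> carrier G \<Longrightarrow> act q g \<in> \<Omega>"
    and act_one: "q \<in> \<Omega> \<Longrightarrow> act q \<one> = q"
    and act_mult: "q \<in> \<Omega> \<Longrightarrow> g \<in> carrier G \<Longrightarrow> h \<in> carrier G \<Longrightarrow> act q (g \<otimes> h) = act (act q g) h"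
begin

lemma act_inv: "q \<in> \<Omega> \<Longrightarrow> g \<in> carrier G \<Longrightarrow> act (act q g) (inv g) = q"
  "q \<in> \<Omega> \<Longrightarrow> g \<in> carrier G \<Longrightarrow> act (act q (inv g)) g = q"
  by (simp_all add: act_mult[symmetric] act_one)

lemma sum_act: "g \<in> carrier G \<Longrightarrow> (\<Sum>q\<in>\<Omega>. f (act q g)) = (\<Sum>q\<in>\<Omega>. f q)"
  by (rule sum.reindex_bij_witness[of _ "\<lambda>q. act q (inv g)" "\<lambda>q. act q g"]) (auto simp: act_inv act_closed)

end

text \<open>A matrix over the real group ring of \<open>G\<close> is stored as a table \<open>M\<close> whose row \<open>x\<close> lists its
  terms: \<open>(c, g, z)\<close> is the term \<open>c g\<close> of the entry in column \<open>z\<close>.\<close>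

type_synonym ('i, 'a) moves = "'i \<Rightarrow> (real \<times> 'a \<times> 'i) list"

definition moves_ok :: "('a, 'm) monoid_scheme \<Rightarrow> 'i list \<Rightarrow> ('i, 'a) moves \<Rightarrow> bool" where
  "moves_ok G ys M \<longleftrightarrow> (\<forall>x\<in>set ys. \<forall>(c, g, z)\<in>set (M x). g \<in> carrier G \<and> z \<in> set ys)"

definition id_moves :: "('a, 'm) monoid_scheme \<Rightarrow> ('i, 'a) moves" where
  "id_moves G x = [(1, \<one>\<^bsub>G\<^esub>, x)]"

definition lin_moves :: "real \<Rightarrow> ('i, 'a) moves \<Rightarrow> ('i, 'a) moves \<Rightarrow> ('i, 'a) moves" where
  "lin_moves a M N x = M x @ map (\<lambda>(c, g, z). (a * c, g, z)) (N x)"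

definition comp_moves :: "('a, 'm) monoid_scheme \<Rightarrow> ('i, 'a) moves \<Rightarrow> ('i, 'a) moves \<Rightarrow> ('i, 'a) moves" where
  "comp_moves G M N x =
     concat (map (\<lambda>(c, g, z). map (\<lambda>(d, h, y). (c * d, g \<otimes>\<^bsub>G\<^esub> h, y)) (N z)) (M x))"

definition adj_moves :: "('a, 'm) monoid_scheme \<Rightarrow> 'i list \<Rightarrow> ('i, 'a) moves \<Rightarrow> ('i, 'a) moves" where
  "adj_moves G ys M z =
     concat (map (\<lambda>x. concat (map (\<lambda>(c, g, y). if y = z then [(c, inv\<^bsub>G\<^esub> g, x)] else []) (M x))) ys)"

fun pow_moves :: "('a, 'm) monoid_scheme \<Rightarrow> ('i, 'a) moves \<Rightarrow> nat \<Rightarrow> ('i, 'a) moves" where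
  "pow_moves G M 0 = id_moves G"
| "pow_moves G M (Suc k) = comp_moves G M (pow_moves G M k)"

text \<open>The von Neumann trace of a matrix over the group ring. It does not refer to any
  action.\<close>

definition moves_trace :: "('a, 'm) monoid_scheme \<Rightarrow> 'i list \<Rightarrow> ('i, 'a) moves \<Rightarrow> real" where
  "moves_trace G ys M = (\<Sum>x\<in>set ys. \<Sum>(c, g, z)\<leftarrow>M x. if z = x \<and> g = \<one>\<^bsub>G\<^esub> then c else 0)"

text \<open>A bound for the squared operator norm, from Cauchy-Schwarz in each row: crude, but valid
  in all actions at once (\<open>op_bound\<close>).\<close>

definition moves_bound :: "'i list \<Rightarrow> ('i, 'a) moves \<Rightarrow> real" where
  "moves_bound ys M = (\<Sum>x\<in>set ys. real (length (M x)) * (\<Sum>(c, g, z)\<leftarrow>M x. c\<^sup>2))"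

lemma moves_okI:
  "(\<And>x c g z. x \<in> set ys \<Longrightarrow> (c, g, z) \<in> set (M x) \<Longrightarrow> g \<in> carrier G \<and> z \<in> set ys) \<Longrightarrow> moves_ok G ys M"
  by (auto simp: moves_ok_def)

lemma moves_okD:
  "moves_ok G ys M \<Longrightarrow> x \<in> set ys \<Longrightarrow> (c, g, z) \<in> set (M x) \<Longrightarrow> g \<in> carrier G"
  "moves_ok G ys M \<Longrightarrow> x \<in> set ys \<Longrightarrow> (c, g, z) \<in> set (M x) \<Longrightarrow> z \<in> set ys"
  by (auto simp: moves_ok_def)

lemma moves_ok_lin: "moves_ok G ys M \<Longrightarrow> moves_ok G ys N \<Longrightarrow> moves_ok G ys (lin_moves a M N)"
  by (rule moves_okI) (auto simp: lin_moves_def dest: moves_okD)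

lemma (in group) moves_ok_id: "moves_ok G ys (id_moves G)"
  by (rule moves_okI) (simp add: id_moves_def)

lemma (in group) moves_ok_comp: "moves_ok G ys M \<Longrightarrow> moves_ok G ys N \<Longrightarrow> moves_ok G ys (comp_moves G M N)"
  by (rule moves_okI) (auto simp: comp_moves_def dest: moves_okD)

lemma (in group) moves_ok_adj: "moves_ok G ys M \<Longrightarrow> moves_ok G ys (adj_moves G ys M)"
  by (rule moves_okI) (auto simp: adj_moves_def dest: moves_okD split: if_splits)

lemma (in group) moves_ok_pow: "moves_ok G ys M \<Longrightarrow> moves_ok G ys (pow_moves G M k)"
  by (induction k) (auto simp: moves_ok_id moves_ok_comp)

lemma moves_bound_nonneg: "0 \<le> moves_bound ys M"
  unfolding moves_bound_def
  by (intro sum_nonneg mult_nonneg_nonneg sum_list_nonneg) auto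

lemma sum_list_cauchy_schwarz: "(\<Sum>m\<leftarrow>ms. f m)\<^sup>2 \<le> real (length ms) * (\<Sum>m\<leftarrow>ms. (f m)\<^sup>2)"
proof -
  have "(\<Sum>m\<leftarrow>ms. f m) = (\<Sum>i<length ms. 1 * f (ms ! i))"
    by (simp add: sum_list_sum_nth atLeast0LessThan)
  moreover have "(\<Sum>i<length ms. 1 * f (ms ! i))\<^sup>2 \<le> (\<Sum>i<length ms. 1\<^sup>2) * (\<Sum>i<length ms. (f (ms ! i))\<^sup>2)"
    by (rule Cauchy_Schwarz_ineq_sum)
  moreover have "(\<Sum>m\<leftarrow>ms. (f m)\<^sup>2) = (\<Sum>i<length ms. (f (ms ! i))\<^sup>2)"
    by (simp add: sum_list_sum_nth atLeast0LessThan)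
  ultimately show ?thesis by simp
qed

lemma sum_sum_list_swap: "(\<Sum>a\<in>A. \<Sum>m\<leftarrow>ms. f a m) = (\<Sum>m\<leftarrow>ms. \<Sum>a\<in>A. (f a m :: real))"
  by (induction ms) (auto simp: sum.distrib)

section \<open>Matrices over the group ring as operators on functions\<close>

locale moves_action = right_action G \<Omega> act
  for G (structure) and \<Omega> :: "'w set" and act :: "'w \<Rightarrow> 'a \<Rightarrow> 'w" +
  fixes ys :: "'i list"
  assumes distinct_ys: "distinct ys"
begin

abbreviation pts :: "('i \<times> 'w) set" where "pts \<equiv> set ys \<times> \<Omega>"

definition op :: "('i, 'a) moves \<Rightarrow> ('i \<times> 'w \<Rightarrow> real) \<Rightarrow> 'i \<times> 'w \<Rightarrow> real" where
  "op M u = (\<lambda>(x, q). if (x, q) \<in> pts then \<Sum>(c, g, z)\<leftarrow>M x. c * u (z, act q g) else 0)"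

lemma finite_pts: "finite pts"
  by (simp add: finite_points)

lemma op_supported: "supported pts (op M u)"
  by (auto simp: op_def supported_def)

lemma op_linear: "linear_functional (\<lambda>u. op M u p)"
proof -
  have "(\<Sum>(c, g, z)\<leftarrow>ms. c * (u (z, act q g) + v (z, act q g))) =
      (\<Sum>(c, g, z)\<leftarrow>ms. c * u (z, act q g)) + (\<Sum>(c, g, z)\<leftarrow>ms. c * v (z, act q g))" for u v :: "'i \<times> 'w \<Rightarrow> real" and ms q
    by (induction ms) (auto simp: algebra_simps)
  moreover have "(\<Sum>(c, g, z)\<leftarrow>ms. c * (a * u (z, act q g))) = a * (\<Sum>(c, g, z)\<leftarrow>ms. c * u (z, act q g))" for u :: "'i \<times> 'w \<Rightarrow> real" and a ms q
    by (induction ms) (auto simp: algebra_simps)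
  ultimately show ?thesis by (cases p; cases "p \<in> pts") (auto simp: linear_functional_def op_def)
qed

lemma op_id: "supported pts u \<Longrightarrow> op (id_moves G) u = u"
  by (auto simp: op_def id_moves_def supported_def act_one fun_eq_iff)

lemma op_lin: "op (lin_moves a M N) u = (\<lambda>p. op M u p + a * op N u p)"
proof -
  have "(\<Sum>(c, g, z)\<leftarrow>map (\<lambda>(c, g, z). (a * c, g, z)) ms. c * u (z, act q g)) = a * (\<Sum>(c, g, z)\<leftarrow>ms. c * u (z, act q g))" for ms q
    by (induction ms) (auto simp: algebra_simps)
  then show ?thesis by (auto simp: op_def lin_moves_def fun_eq_iff)
qed

text \<open>Moving by \<open>g\<close> and then by \<open>h\<close> is moving by g h because the
  action is on the right; this is the order of factors in \<open>comp_moves\<close>.\<close>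

lemma op_comp:
  assumes M: "moves_ok G ys M" and N: "moves_ok G ys N"
  shows "op (comp_moves G M N) u = op M (op N u)"
proof
  fix p :: "'i \<times> 'w"
  obtain x q where p: "p = (x, q)" by (cases p)
  show "op (comp_moves G M N) u p = op M (op N u) p"
  proof (cases "p \<in> pts")
    case True
    then have xq: "x \<in> set ys" "q \<in> \<Omega>" using p by auto
    have inner: "(\<Sum>(e, f, y)\<leftarrow>map (\<lambda>(d, h, y). (c * d, g \<otimes> h, y)) ns. e * u (y, act q f)) =
        c * (\<Sum>(d, h, y)\<leftarrow>ns. d * u (y, act (act q g) h))"
      if "g \<in> carrier G" "\<forall>(d, h, y)\<in>set ns. h \<in> carrier G" for c g ns
      using that xq by (induction ns) (auto simp: algebra_simps act_mult)
    have "(\<Sum>(e, f, y)\<leftarrow>concat (map (\<lambda>(c, g, z). map (\<lambda>(d, h, y). (c * d, g \<otimes> h, y)) (N z)) ms). e * u (y, act q f)) =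
        (\<Sum>(c, g, z)\<leftarrow>ms. c * op N u (z, act q g))" if "\<forall>(c, g, z)\<in>set ms. g \<in> carrier G \<and> z \<in> set ys" for ms
      using that
    proof (induction ms)
      case (Cons m ms)
      obtain c g z where m: "m = (c, g, z)" by (cases m)
      then have gz: "g \<in> carrier G" "z \<in> set ys" using Cons.prems by auto
      have "\<forall>(d, h, y)\<in>set (N z). h \<in> carrier G" using N gz by (auto simp: moves_ok_def)
      from inner[OF gz(1) this] Cons m gz xq show ?case by (simp add: op_def act_closed)
    qed simp
    then show ?thesis using M xq by (simp add: op_def comp_moves_def p moves_ok_def)
  qed (auto simp: op_def p)
qed

lemma op_pow:
  assumes "moves_ok G ys M" "supported pts u"
  shows "op (pow_moves G M k) u = (op M ^^ k) u"
  using assms by (induction k) (auto simp: op_id op_comp moves_ok_pow)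

lemma ip_pts: "ip pts u v = (\<Sum>x\<in>set ys. \<Sum>q\<in>\<Omega>. u (x, q) * v (x, q))"
  by (simp add: ip_def sum.cartesian_product)

text \<open>Each group element permutes \<Omega>, so its transpose is its inverse. \<open>P\<close>
  is the contribution of one term after substituting q g^-1 for q; the rest regroups the terms by
  column.\<close>

lemma op_adj:
  assumes M: "moves_ok G ys M"
  shows "ip pts (op M u) v = ip pts u (op (adj_moves G ys M) v)"
proof -
  define P where "P = (\<lambda>x g z. \<Sum>q\<in>\<Omega>. u (z, q) * v (x, act q (inv g)))"
  have "ip pts (op M u) v = (\<Sum>x\<in>set ys. \<Sum>q\<in>\<Omega>. \<Sum>(c, g, z)\<leftarrow>M x. c * (u (z, act q g) * v (x, q)))"
    unfolding ip_pts by (intro sum.cong refl)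
      (auto simp: op_def sum_list_mult_const[symmetric] case_prod_beta' mult.assoc)
  also have "\<dots> = (\<Sum>x\<in>set ys. \<Sum>(c, g, z)\<leftarrow>M x. c * P x g z)"
  proof (rule sum.cong[OF refl])
    fix x assume x: "x \<in> set ys"
    have "(\<Sum>q\<in>\<Omega>. \<Sum>(c, g, z)\<leftarrow>M x. c * (u (z, act q g) * v (x, q))) =
        (\<Sum>(c, g, z)\<leftarrow>M x. \<Sum>q\<in>\<Omega>. c * (u (z, act q g) * v (x, q)))"
      by (simp add: sum_sum_list_swap case_prod_beta')
    also have "\<dots> = (\<Sum>(c, g, z)\<leftarrow>M x. c * P x g z)"
    proof (rule arg_cong[of _ _ sum_list], rule map_cong[OF refl], clarify)
      fix c g z assume "(c, g, z) \<in> set (M x)"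
      then have g: "g \<in> carrier G" using M x by (auto simp: moves_ok_def)
      have "(\<Sum>q\<in>\<Omega>. u (z, act q g) * v (x, q)) = (\<Sum>q\<in>\<Omega>. u (z, act q g) * v (x, act (act q g) (inv g)))"
        by (rule sum.cong) (auto simp: act_inv g)
      also have "\<dots> = P x g z" unfolding P_def by (rule sum_act[OF g])
      finally show "(\<Sum>q\<in>\<Omega>. c * (u (z, act q g) * v (x, q))) = c * P x g z"
        by (simp add: sum_distrib_left[symmetric])
    qed
    finally show "(\<Sum>q\<in>\<Omega>. \<Sum>(c, g, z)\<leftarrow>M x. c * (u (z, act q g) * v (x, q))) =
      (\<Sum>(c, g, z)\<leftarrow>M x. c * P x g z)" .
  qed
  also have "\<dots> = (\<Sum>x\<in>set ys. \<Sum>z\<in>set ys. \<Sum>(c, g, y)\<leftarrow>M x. if y = z then c * P x g z else 0)"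
  proof (rule sum.cong[OF refl])
    fix x assume x: "x \<in> set ys"
    have "(\<Sum>(c, g, z)\<leftarrow>ms. c * P x g z) =
      (\<Sum>z\<in>set ys. \<Sum>(c, g, y)\<leftarrow>ms. if y = z then c * P x g z else 0)"
      if "\<forall>(c, g, z)\<in>set ms. z \<in> set ys" for ms
      using that by (induction ms) (auto simp: sum.distrib)
    moreover have "\<forall>(c, g, z)\<in>set (M x). z \<in> set ys" using M x by (auto simp: moves_ok_def)
    ultimately show "(\<Sum>(c, g, z)\<leftarrow>M x. c * P x g z) =
      (\<Sum>z\<in>set ys. \<Sum>(c, g, y)\<leftarrow>M x. if y = z then c * P x g z else 0)"
      by blast
  qed
  also have "\<dots> = (\<Sum>z\<in>set ys. \<Sum>x\<in>set ys. \<Sum>(c, g, y)\<leftarrow>M x. if y = z then c * P x g z else 0)"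
    by (rule sum.swap)
  also have "\<dots> = ip pts u (op (adj_moves G ys M) v)"
    unfolding ip_pts
  proof (rule sum.cong[OF refl])
    fix z assume z: "z \<in> set ys"
    have inner: "(\<Sum>(d, h, w)\<leftarrow>concat (map (\<lambda>(c, g, y). if y = z then [(c, inv g, x)] else []) ms). d * v (w, act q h)) =
        (\<Sum>(c, g, y)\<leftarrow>ms. if y = z then c * v (x, act q (inv g)) else 0)" for x q ms
      by (induction ms) auto
    have "(\<Sum>(d, h, w)\<leftarrow>adj_moves G ys M z. d * v (w, act q h)) =
        (\<Sum>x\<leftarrow>ys. \<Sum>(c, g, y)\<leftarrow>M x. if y = z then c * v (x, act q (inv g)) else 0)" for q
      unfolding adj_moves_def by (induction ys) (auto simp: inner)
    also have "\<dots> q = (\<Sum>x\<in>set ys. \<Sum>(c, g, y)\<leftarrow>M x. if y = z then c * v (x, act q (inv g)) else 0)" for q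
      using distinct_ys by (simp add: sum_list_distinct_conv_sum_set)
    finally have "(\<Sum>q\<in>\<Omega>. u (z, q) * op (adj_moves G ys M) v (z, q)) =
        (\<Sum>q\<in>\<Omega>. \<Sum>x\<in>set ys. \<Sum>(c, g, y)\<leftarrow>M x. if y = z then c * (u (z, q) * v (x, act q (inv g))) else 0)"
      using z by (intro sum.cong refl) (auto simp: op_def sum_distrib_left sum_list_const_mult[symmetric] case_prod_beta'
          if_distrib algebra_simps intro!: sum.cong arg_cong[of _ _ sum_list] map_cong)
    also have "\<dots> = (\<Sum>x\<in>set ys. \<Sum>(c, g, y)\<leftarrow>M x. \<Sum>q\<in>\<Omega>. if y = z then c * (u (z, q) * v (x, act q (inv g))) else 0)"
      by (subst sum.swap) (simp add: sum_sum_list_swap case_prod_beta')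
    also have "\<dots> = (\<Sum>x\<in>set ys. \<Sum>(c, g, y)\<leftarrow>M x. if y = z then c * P x g z else 0)"
      by (intro sum.cong refl arg_cong[of _ _ sum_list] map_cong) (auto simp: P_def sum_distrib_left)
    finally show "(\<Sum>x\<in>set ys. \<Sum>(c, g, y)\<leftarrow>M x. if y = z then c * P x g z else 0) =
      (\<Sum>q\<in>\<Omega>. u (z, q) * op (adj_moves G ys M) v (z, q))" by simp
  qed
  finally show ?thesis .
qed

lemma op_bound:
  assumes M: "moves_ok G ys M"
  shows "ip pts (op M u) (op M u) \<le> moves_bound ys M * ip pts u u"
proof -
  have row: "(\<Sum>q\<in>\<Omega>. (op M u (x, q))\<^sup>2) \<le> real (length (M x)) * (\<Sum>(c, g, z)\<leftarrow>M x. c\<^sup>2) * ip pts u u"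
    if x: "x \<in> set ys" for x
  proof -
    have "(\<Sum>q\<in>\<Omega>. (op M u (x, q))\<^sup>2) \<le> (\<Sum>q\<in>\<Omega>. real (length (M x)) * (\<Sum>(c, g, z)\<leftarrow>M x. c\<^sup>2 * (u (z, act q g))\<^sup>2))"
    proof (rule sum_mono)
      fix q assume "q \<in> \<Omega>"
      then show "(op M u (x, q))\<^sup>2 \<le> real (length (M x)) * (\<Sum>(c, g, z)\<leftarrow>M x. c\<^sup>2 * (u (z, act q g))\<^sup>2)"
        using x sum_list_cauchy_schwarz[of "\<lambda>(c, g, z). c * u (z, act q g)" "M x"]
        by (simp add: op_def case_prod_beta' power_mult_distrib)
    qed
    also have "\<dots> = real (length (M x)) * (\<Sum>(c, g, z)\<leftarrow>M x. c\<^sup>2 * (\<Sum>q\<in>\<Omega>. (u (z, act q g))\<^sup>2))"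
      by (simp add: sum_distrib_left[symmetric] sum_sum_list_swap case_prod_beta')
    also have "\<dots> \<le> real (length (M x)) * (\<Sum>(c, g, z)\<leftarrow>M x. c\<^sup>2 * ip pts u u)"
    proof (intro mult_left_mono sum_list_mono, clarify)
      fix c g z assume "(c, g, z) \<in> set (M x)"
      then have gz: "g \<in> carrier G" "z \<in> set ys" using M x by (auto simp: moves_ok_def)
      have "(\<Sum>q\<in>\<Omega>. (u (z, act q g))\<^sup>2) = (\<Sum>q\<in>\<Omega>. (u (z, q))\<^sup>2)" by (rule sum_act[OF gz(1)])
      also have "\<dots> \<le> ip pts u u" unfolding ip_pts
        using member_le_sum[of z "set ys" "\<lambda>z. \<Sum>q\<in>\<Omega>. u (z, q) * u (z, q)"] gz(2)
        by (simp add: power2_eq_square sum_nonneg)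
      finally show "c\<^sup>2 * (\<Sum>q\<in>\<Omega>. (u (z, act q g))\<^sup>2) \<le> c\<^sup>2 * ip pts u u" by (rule mult_left_mono) simp
    qed simp
    also have "\<dots> = real (length (M x)) * (\<Sum>(c, g, z)\<leftarrow>M x. c\<^sup>2) * ip pts u u"
      by (simp add: case_prod_beta' sum_list_mult_const mult.assoc)
    finally show ?thesis .
  qed
  have "ip pts (op M u) (op M u) = (\<Sum>x\<in>set ys. \<Sum>q\<in>\<Omega>. (op M u (x, q))\<^sup>2)"
    by (simp add: ip_pts power2_eq_square)
  also have "\<dots> \<le> (\<Sum>x\<in>set ys. real (length (M x)) * (\<Sum>(c, g, z)\<leftarrow>M x. c\<^sup>2) * ip pts u u)"
    by (rule sum_mono) (rule row)
  finally show ?thesis by (simp add: moves_bound_def sum_distrib_right)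
qed

text \<open>A term contributes to the diagonal at \<open>(x, q)\<close> only if it returns to
  \<open>x\<close> and fixes \<open>q\<close>. By \<open>free\<close> the latter forces the
  identity, so all points of \<Omega> contribute the same amount.\<close>

lemma op_trace:
  assumes M: "moves_ok G ys M"
    and free: "\<And>x c g z q. x \<in> set ys \<Longrightarrow> (c, g, z) \<in> set (M x) \<Longrightarrow> q \<in> \<Omega> \<Longrightarrow> act q g = q \<Longrightarrow> g = \<one>"
  shows "(\<Sum>p\<in>pts. op M (delta p) p) = card \<Omega> * moves_trace G ys M"
proof -
  have "op M (delta (x, q)) (x, q) = (\<Sum>(c, g, z)\<leftarrow>M x. if z = x \<and> g = \<one> then c else 0)"
    if "x \<in> set ys" "q \<in> \<Omega>" for x q
  proof -
    have "(\<Sum>(c, g, z)\<leftarrow>M x. c * delta (x, q) (z, act q g)) = (\<Sum>(c, g, z)\<leftarrow>M x. if z = x \<and> g = \<one> then c else 0)"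
    proof (rule arg_cong[of _ _ sum_list], rule map_cong[OF refl], clarify)
      fix c g z assume "(c, g, z) \<in> set (M x)"
      then have "act q g = q \<longleftrightarrow> g = \<one>" using free[OF that(1) _ that(2)] act_one[OF that(2)] by blast
      then show "c * delta (x, q) (z, act q g) = (if z = x \<and> g = \<one> then c else 0)" by (simp add: delta_def)
    qed
    then show ?thesis using that by (simp add: op_def)
  qed
  then have "(\<Sum>x\<in>set ys. \<Sum>q\<in>\<Omega>. op M (delta (x, q)) (x, q)) =
      (\<Sum>x\<in>set ys. card \<Omega> * (\<Sum>(c, g, z)\<leftarrow>M x. if z = x \<and> g = \<one> then c else 0))"
    by (intro sum.cong refl) simp
  also have "\<dots> = card \<Omega> * moves_trace G ys M"
    unfolding moves_trace_def by (rule sum_distrib_left[symmetric])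
  also have "(\<Sum>x\<in>set ys. \<Sum>q\<in>\<Omega>. op M (delta (x, q)) (x, q)) = (\<Sum>(x, q)\<in>pts. op M (delta (x, q)) (x, q))"
    by (rule sum.cartesian_product)
  also have "\<dots> = (\<Sum>p\<in>pts. op M (delta p) p)" by (rule sum.cong) auto
  finally show ?thesis .
qed

end

text \<open>The operator \<open>1 - A\<^sup>* A / C\<close>, whose eigenvalue 1 belongs to the kernel of \<open>A\<close>.\<close>

definition gram_moves :: "('a, 'm) monoid_scheme \<Rightarrow> 'i list \<Rightarrow> real \<Rightarrow> ('i, 'a) moves \<Rightarrow> ('i, 'a) moves" where
  "gram_moves G ys C A = lin_moves (- 1 / C) (id_moves G) (comp_moves G (adj_moves G ys A) A)"

lemma (in group) moves_ok_gram: "moves_ok G ys A \<Longrightarrow> moves_ok G ys (gram_moves G ys C A)"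
  unfolding gram_moves_def by (intro moves_ok_lin moves_ok_id moves_ok_comp moves_ok_adj)

context moves_action
begin

lemma op_gram:
  assumes "moves_ok G ys A" "supported pts u"
  shows "op (gram_moves G ys C A) u = (\<lambda>p. u p - op (adj_moves G ys A) (op A u) p / C)"
  using assms by (simp add: gram_moves_def op_lin op_id op_comp moves_ok_adj)

lemma ip_gram:
  assumes "moves_ok G ys A" "supported pts u"
  shows "ip pts (op (gram_moves G ys C A) u) v = ip pts u v - ip pts (op A u) (op A v) / C"
proof -
  have "ip pts (op (gram_moves G ys C A) u) v = ip pts u v - ip pts (op (adj_moves G ys A) (op A u)) v / C"
    unfolding op_gram[OF assms] by (simp add: ip_def left_diff_distrib sum_subtractf sum_divide_distrib)
  also have "ip pts (op (adj_moves G ys A) (op A u)) v = ip pts (op A u) (op A v)"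
    using op_adj[OF assms(1), of v "op A u"] by (simp add: ip_commute)
  finally show ?thesis .
qed

text \<open>With \<open>C\<close> above the squared norm of \<open>A\<close> the spectrum lies in
  [0, 1], so powers keep the kernel of \<open>A\<close> and damp everything else.\<close>

lemma contraction_gram:
  assumes A: "moves_ok G ys A" and C: "0 < C" "moves_bound ys A \<le> C"
  shows "contraction_op pts (op (gram_moves G ys C A))"
proof
  fix u v :: "'i \<times> 'w \<Rightarrow> real"
  assume u: "supported pts u" 
  show "ip pts (op (gram_moves G ys C A) u) u \<le> ip pts u u"
    using C by (simp add: ip_gram[OF A u] ip_nonneg)
  have "ip pts (op A u) (op A u) \<le> moves_bound ys A * ip pts u u" by (rule op_bound[OF A])
  also have "\<dots> \<le> C * ip pts u u" using C by (intro mult_right_mono ip_nonneg)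
  finally show "0 \<le> ip pts (op (gram_moves G ys C A) u) u"
    using C by (simp add: ip_gram[OF A u] field_simps)
  assume v: "supported pts v"
  show "ip pts (op (gram_moves G ys C A) u) v = ip pts u (op (gram_moves G ys C A) v)"
    using ip_gram[OF A u, of C v] ip_gram[OF A v, of C u] by (simp add: ip_commute)
qed (rule finite_pts op_linear op_supported)+

text \<open>Freeness is asked only of the finitely many group elements occurring in the
  \<open>k\<close>-th power, which play the part of a ball in \<open>G\<close>.\<close>

lemma gram_trace:
  assumes A: "moves_ok G ys A"
    and free: "\<And>x c g z q. x \<in> set ys \<Longrightarrow> (c, g, z) \<in> set (pow_moves G (gram_moves G ys C A) k x) \<Longrightarrow>
      q \<in> \<Omega> \<Longrightarrow> act q g = q \<Longrightarrow> g = \<one>"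
  shows "(\<Sum>p\<in>pts. (op (gram_moves G ys C A) ^^ k) (delta p) p) =
    card \<Omega> * moves_trace G ys (pow_moves G (gram_moves G ys C A) k)"
proof -
  have "(op (gram_moves G ys C A) ^^ k) (delta p) = op (pow_moves G (gram_moves G ys C A) k) (delta p)" if "p \<in> pts" for p
    using that A by (subst op_pow) (auto simp: moves_ok_gram supported_def delta_def)
  then show ?thesis
    using op_trace[OF moves_ok_pow[OF moves_ok_gram[OF A]] free] by simp
qed

end

section \<open>Cocycles and the vanishing argument\<close>

text \<open>Crossed homomorphisms from \<open>G\<close> to the functions on \<Omega>, on which
  \<open>g\<close> acts by precomposition with q \<mapsto> \<open>act q g\<close>.\<close>

definition cocycle :: "('a, 'm) monoid_scheme \<Rightarrow> 'w set \<Rightarrow> ('w \<Rightarrow> 'a \<Rightarrow> 'w) \<Rightarrow> ('a \<Rightarrow> 'w \<Rightarrow> real) \<Rightarrow> bool" where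
  "cocycle G \<Omega> act d \<longleftrightarrow>
     (\<forall>g\<in>carrier G. \<forall>h\<in>carrier G. \<forall>q\<in>\<Omega>. d (g \<otimes>\<^bsub>G\<^esub> h) q = d g q + d h (act q g))"

text \<open>Provides 2 |\<Omega>| dimensions of cocycles through an injective linear
  parametrization; the two values of \<open>bool\<close> will stand for two edges of a Schreier
  graph. The factor 2 matters because the condition d t = 0 costs |\<Omega>| dimensions.\<close>

definition ample :: "('a, 'm) monoid_scheme \<Rightarrow> 'w set \<Rightarrow> ('w \<Rightarrow> 'a \<Rightarrow> 'w) \<Rightarrow> bool" where
  "ample G \<Omega> act \<longleftrightarrow> (\<exists>D :: (bool \<times> 'w \<Rightarrow> real) \<Rightarrow> 'a \<Rightarrow> 'w \<Rightarrow> real.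
     (\<forall>v. cocycle G \<Omega> act (D v)) \<and> (\<forall>g q. linear_functional (\<lambda>v. D v g q)) \<and>
     (\<forall>v. supported (UNIV \<times> \<Omega>) v \<longrightarrow> (\<forall>g\<in>carrier G. \<forall>q\<in>\<Omega>. D v g q = 0) \<longrightarrow> v = (\<lambda>_. 0)))"

lemma (in right_action) cocycle_one:
  assumes "cocycle G \<Omega> act d" "q \<in> \<Omega>"
  shows "d \<one> q = 0"
proof -
  have "d (\<one> \<otimes> \<one>) q = d \<one> q + d \<one> (act q \<one>)" using assms one_closed unfolding cocycle_def by blast
  then show ?thesis using assms by (simp add: act_one)
qed

lemma (in right_action) cocycle_inv:
  assumes "cocycle G \<Omega> act d" "q \<in> \<Omega>" "g \<in> carrier G"
  shows "d (inv g) q = - d g (act q (inv g))"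
proof -
  have "d (inv g \<otimes> g) q = d (inv g) q + d g (act q (inv g))"
    using assms unfolding cocycle_def by blast
  then show ?thesis using cocycle_one[OF assms(1,2)] assms(3) by simp
qed

lemma (in right_action) cocycle_zero:
  assumes d: "cocycle G \<Omega> act d" and Y: "Y \<subseteq> carrier G" "generate G Y = carrier G"
    and 0: "\<And>y q. y \<in> Y \<Longrightarrow> q \<in> \<Omega> \<Longrightarrow> d y q = 0" and g: "g \<in> carrier G" and q: "q \<in> \<Omega>"
  shows "d g q = 0"
proof -
  have "g \<in> generate G Y" using g Y by simp
  then show ?thesis using q
  proof (induction arbitrary: q)
    case one
    then show ?case using cocycle_one[OF d] by simp
  next
    case (incl h)
    then show ?case using 0 by simp
  next
    case (inv h)
    then have "h \<in> carrier G" using Y by auto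
    then show ?case using cocycle_inv[OF d, of q h] 0[of h "act q (inv h)"] inv by (simp add: act_closed)
  next
    case (eng h1 h2)
    then have h: "h1 \<in> carrier G" "h2 \<in> carrier G" using Y by auto
    then show ?case using d eng by (simp add: cocycle_def act_closed)
  qed
qed

text \<open>From 2 |\<Omega>| parameters the |\<Omega>| equations \<open>D v t q = 0\<close> leave
  |\<Omega>| dimensions. Restricted to the generators \<open>ys\<close>, these cocycles lie in the
  kernel of \<open>A\<close> by \<open>ker\<close>; no information is lost, since a cocycle is
  determined by its values on generators.\<close>

lemma (in right_action) gram_trace_ge:
  fixes ys :: "'a list"
  assumes M: "moves_action G \<Omega> act ys" and A: "moves_ok G ys A" and C: "0 < C" "moves_bound ys A \<le> C"
    and ys: "set ys \<subseteq> carrier G" "generate G (set ys) = carrier G" "t \<in> set ys"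
    and am: "ample G \<Omega> act"
    and ker: "\<And>d x q. cocycle G \<Omega> act d \<Longrightarrow> (\<And>q. q \<in> \<Omega> \<Longrightarrow> d t q = 0) \<Longrightarrow> x \<in> set ys \<Longrightarrow> q \<in> \<Omega> \<Longrightarrow>
      (\<Sum>(c, g, z)\<leftarrow>A x. c * d z (act q g)) = 0"
  shows "card \<Omega> \<le> (\<Sum>p\<in>set ys \<times> \<Omega>. (moves_action.op \<Omega> act ys (gram_moves G ys C A) ^^ k) (delta p) p)"
proof -
  interpret moves_action G \<Omega> act ys by (rule M)
  obtain D :: "(bool \<times> 'w \<Rightarrow> real) \<Rightarrow> 'a \<Rightarrow> 'w \<Rightarrow> real" where
    D0: "(\<forall>v. cocycle G \<Omega> act (D v)) \<and> (\<forall>g q. linear_functional (\<lambda>v. D v g q)) \<and>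
     (\<forall>v. supported (UNIV \<times> \<Omega>) v \<longrightarrow> (\<forall>g\<in>carrier G. \<forall>q\<in>\<Omega>. D v g q = 0) \<longrightarrow> v = (\<lambda>_. 0))"
    using am unfolding ample_def by (elim exE) (rule that)
  have D: "cocycle G \<Omega> act (D v)" "linear_functional (\<lambda>v. D v g q)"
    "supported (UNIV \<times> \<Omega>) v \<Longrightarrow> (\<And>g q. g \<in> carrier G \<Longrightarrow> q \<in> \<Omega> \<Longrightarrow> D v g q = 0) \<Longrightarrow> v = (\<lambda>_. 0)" for v g q
    using D0 by simp_all
  interpret contraction_op pts "op (gram_moves G ys C A)" by (rule contraction_gram[OF A C])
  define \<Phi> where "\<Phi> = (\<lambda>v (y, q). if (y, q) \<in> pts then D v y q else 0)"
  have \<Phi>_lin: "linear_functional (\<lambda>v. \<Phi> v p)" for p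
    using D(2) by (cases p; cases "p \<in> pts") (auto simp: \<Phi>_def linear_functional_def)
  have \<Phi>_supp: "supported pts (\<Phi> v)" for v by (auto simp: \<Phi>_def supported_def)
  show ?thesis
  proof (rule trace_power_ge[where V = "(UNIV :: bool set) \<times> \<Omega>" and E = \<Omega> and \<Phi> = \<Phi> and R = "\<lambda>q v. D v t q"])
    fix v :: "bool \<times> 'w \<Rightarrow> real" assume v: "supported (UNIV \<times> \<Omega>) v" "\<And>q. q \<in> \<Omega> \<Longrightarrow> D v t q = 0"
    have "op A (\<Phi> v) p = 0" for p
    proof (cases "p \<in> pts")
      case True
      then obtain x q where p: "p = (x, q)" "x \<in> set ys" "q \<in> \<Omega>" by auto
      have "op A (\<Phi> v) p = (\<Sum>(c, g, z)\<leftarrow>A x. c * \<Phi> v (z, act q g))" using p by (simp add: op_def)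
      also have "\<dots> = (\<Sum>(c, g, z)\<leftarrow>A x. c * D v z (act q g))"
        by (rule arg_cong[of _ _ sum_list], rule map_cong[OF refl])
          (use moves_okD[OF A p(2)] p in \<open>auto simp: \<Phi>_def act_closed\<close>)
      finally show ?thesis using ker[OF D(1) v(2) p(2,3)] by simp
    qed (auto simp: op_def split: prod.splits)
    then have "op A (\<Phi> v) = (\<lambda>p. 0 * \<Phi> v p)" by (simp add: fun_eq_iff)
    then have "op (adj_moves G ys A) (op A (\<Phi> v)) p = 0" for p
      using op_linear[of "adj_moves G ys A" p] unfolding linear_functional_def by (metis mult_zero_left)
    then show "op (gram_moves G ys C A) (\<Phi> v) = \<Phi> v"
      by (simp add: op_gram[OF A \<Phi>_supp])
    assume "\<Phi> v = (\<lambda>_. 0)"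
    then have 0: "\<Phi> v (y, q) = 0" for y q by simp
    have Dv: "D v y q = 0" if "y \<in> set ys" "q \<in> \<Omega>" for y q
      using 0[of y q] that by (simp add: \<Phi>_def)
    show "v = (\<lambda>_. 0)"
    proof (rule D(3)[OF v(1)])
      fix g q assume gq: "g \<in> carrier G" "q \<in> \<Omega>"
      show "D v g q = 0" by (rule cocycle_zero[OF D(1) ys(1,2) _ gq]) (rule Dv)
    qed
  qed (use finite_points D(2) \<Phi>_lin \<Phi>_supp in \<open>auto simp: card_cartesian_product card_UNIV_bool\<close>)
qed

lemma sum_list_le_const:
  assumes "\<And>c g z. (c, g, z) \<in> set ms \<Longrightarrow> f c g z \<le> c\<^sup>2 * (b :: real)"
  shows "(\<Sum>(c, g, z)\<leftarrow>ms. f c g z) \<le> (\<Sum>(c, g, z)\<leftarrow>ms. c\<^sup>2) * b"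
  using assms by (induction ms) (force simp: algebra_simps)+

lemma square_add_le: "(a + b)\<^sup>2 \<le> 2 * a\<^sup>2 + 2 * (b :: real)\<^sup>2"
  using zero_le_power2[of "a - b"] by (simp add: power2_sum power2_diff)

section \<open>A cyclic level coordinate recording the degree\<close>

locale graded_action = right_action G \<Omega> act
  for G (structure) and \<Omega> :: "'w set" and act :: "'w \<Rightarrow> 'a \<Rightarrow> 'w" +
  fixes \<theta> :: "'a \<Rightarrow> int" and m :: int
  assumes grading: "g \<in> carrier G \<Longrightarrow> h \<in> carrier G \<Longrightarrow> \<theta> (g \<otimes> h) = \<theta> g + \<theta> h"
    and modulus: "0 < m"
begin

definition level_act :: "'w \<times> int \<Rightarrow> 'a \<Rightarrow> 'w \<times> int" where
  "level_act = (\<lambda>(q, i) g. (act q g, (i + \<theta> g) mod m))"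

lemma grading_one: "\<theta> \<one> = 0"
  using grading[OF one_closed one_closed] by simp

lemma right_action_level: "right_action G (\<Omega> \<times> {0..<m}) level_act"
proof (unfold_locales, goal_cases)
  case (4 q g h)
  then show ?case
    by (auto simp: level_act_def grading act_mult mod_add_left_eq add.assoc)
qed (use modulus in \<open>auto simp: level_act_def act_closed act_one finite_points grading_one\<close>)

end

text \<open>All terms of \<open>L\<close> climb by 1 to \<open>j\<close> levels. A move past the top
  therefore lands in the first \<open>j\<close> levels, and \<open>j \<le> m\<close> excludes a
  second turn.\<close>

locale graded_moves = graded_action G \<Omega> act \<theta> m
  for G (structure) and \<Omega> :: "'w set" and act :: "'w \<Rightarrow> 'a \<Rightarrow> 'w" and \<theta> m +
  fixes ys :: "'i list" and L and j :: int
  assumes distinct_ys: "distinct ys" and L: "moves_ok G ys L"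
    and shift: "x \<in> set ys \<Longrightarrow> (c, g, z) \<in> set (L x) \<Longrightarrow> 0 < \<theta> g \<and> \<theta> g \<le> j"
    and j_nonneg: "0 \<le> j" and j_le: "j \<le> m"
begin

sublocale level: moves_action G "\<Omega> \<times> {0..<m}" level_act ys
  by (intro moves_action.intro right_action_level moves_action_axioms.intro distinct_ys)

lemma moves_ok_A: "moves_ok G ys (lin_moves (- 1) (id_moves G) L)"
  by (intro moves_ok_lin moves_ok_id L)

text \<open>If \<open>v\<close> vanishes on \<open>j\<close> consecutive levels, the equation \<open>v - L v = w\<close> determines \<open>v\<close> from \<open>w\<close>
  by descending recursion on the levels; the constant does not depend on the action.\<close>

lemma bounded_below:
  assumes v: "supported (set ys \<times> (\<Omega> \<times> {j..<m})) v"
  shows "ip level.pts v v \<le> 2 * (2 + 2 * moves_bound ys L) ^ nat m *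
    ip level.pts (level.op (lin_moves (- 1) (id_moves G) L) v) (level.op (lin_moves (- 1) (id_moves G) L) v)"
proof -
  let ?A = "lin_moves (- 1) (id_moves G) L"
  define w where "w = level.op ?A v"
  define N where "N = ip level.pts w w"
  define B where "B = moves_bound ys L"
  \<comment> \<open>\<open>n i\<close> is the mass of \<open>v\<close> on level \<open>i\<close>,
    and \<open>s i\<close> its mass on the levels from \<open>i\<close> to the top.\<close>
  define n where "n = (\<lambda>i. \<Sum>x\<in>set ys. \<Sum>q\<in>\<Omega>. (v (x, (q, i)))\<^sup>2)"
  define s where "s = (\<lambda>i. sum n {i..<m})"
  have N0: "0 \<le> N" by (simp add: N_def ip_nonneg)
  have B0: "0 \<le> B" by (simp add: B_def moves_bound_nonneg)
  have n0: "0 \<le> n i" for i by (auto simp: n_def intro!: sum_nonneg)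
  have s0: "0 \<le> s i" for i by (auto simp: s_def n0 intro!: sum_nonneg)
  have nz: "n i = 0" if "i < j" for i
    using v that by (auto simp: n_def supported_def intro!: sum.neutral)
  have ipn: "ip level.pts u u = (\<Sum>i\<in>{0..<m}. \<Sum>x\<in>set ys. \<Sum>q\<in>\<Omega>. (u (x, (q, i)))\<^sup>2)" for u :: "'i \<times> 'w \<times> int \<Rightarrow> real"
  proof -
    have "ip level.pts u u = (\<Sum>x\<in>set ys. \<Sum>q\<in>\<Omega>. \<Sum>i\<in>{0..<m}. (u (x, (q, i)))\<^sup>2)"
      by (simp add: level.ip_pts sum.cartesian_product power2_eq_square case_prod_beta')
    also have "\<dots> = (\<Sum>x\<in>set ys. \<Sum>i\<in>{0..<m}. \<Sum>q\<in>\<Omega>. (u (x, (q, i)))\<^sup>2)"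
      by (intro sum.cong refl sum.swap)
    finally show ?thesis by (simp add: sum.swap[of _ "set ys"])
  qed
  have step: "n i \<le> 2 * N + 2 * B * s (i + 1)" if i: "0 \<le> i" "i < m" for i
  proof -
    have "n i \<le> (\<Sum>x\<in>set ys. 2 * (\<Sum>q\<in>\<Omega>. (w (x, (q, i)))\<^sup>2) + 2 * (real (length (L x)) * (\<Sum>(c, g, z)\<leftarrow>L x. c\<^sup>2) * s (i + 1)))"
      unfolding n_def
    proof (rule sum_mono)
      fix x assume x: "x \<in> set ys"
      let ?i = "\<lambda>g. (i + \<theta> g) mod m"
      have "(v (x, (q, i)))\<^sup>2 \<le> 2 * (w (x, (q, i)))\<^sup>2 + 2 * (real (length (L x)) * (\<Sum>(c, g, z)\<leftarrow>L x. c\<^sup>2 * (v (z, (act q g, ?i g)))\<^sup>2))"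
        if q: "q \<in> \<Omega>" for q
      proof -
        have sv: "supported level.pts v" using v j_nonneg by (auto simp: supported_def)
        have "w (x, (q, i)) = v (x, (q, i)) - (\<Sum>(c, g, z)\<leftarrow>L x. c * v (z, (act q g, ?i g)))"
        proof -
          have "level.op L v (x, (q, i)) = (\<Sum>(c, g, z)\<leftarrow>L x. c * v (z, level_act (q, i) g))"
            using x q i by (simp add: level.op_def)
          then show ?thesis unfolding w_def level.op_lin level.op_id[OF sv] by (simp add: level_act_def)
        qed
        then have "(v (x, (q, i)))\<^sup>2 = (w (x, (q, i)) + (\<Sum>(c, g, z)\<leftarrow>L x. c * v (z, (act q g, ?i g))))\<^sup>2" by simp
        also have "\<dots> \<le> 2 * (w (x, (q, i)))\<^sup>2 + 2 * (\<Sum>(c, g, z)\<leftarrow>L x. c * v (z, (act q g, ?i g)))\<^sup>2"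
          by (rule square_add_le)
        also have "(\<Sum>(c, g, z)\<leftarrow>L x. c * v (z, (act q g, ?i g)))\<^sup>2 \<le>
            real (length (L x)) * (\<Sum>(c, g, z)\<leftarrow>L x. c\<^sup>2 * (v (z, (act q g, ?i g)))\<^sup>2)"
          using sum_list_cauchy_schwarz[of "\<lambda>(c, g, z). c * v (z, (act q g, ?i g))" "L x"]
          by (simp add: case_prod_beta' power_mult_distrib)
        finally show ?thesis by simp
      qed
      then have "(\<Sum>q\<in>\<Omega>. (v (x, (q, i)))\<^sup>2) \<le>
          (\<Sum>q\<in>\<Omega>. 2 * (w (x, (q, i)))\<^sup>2 + 2 * (real (length (L x)) * (\<Sum>(c, g, z)\<leftarrow>L x. c\<^sup>2 * (v (z, (act q g, ?i g)))\<^sup>2)))"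
        by (rule sum_mono)
      also have "\<dots> = 2 * (\<Sum>q\<in>\<Omega>. (w (x, (q, i)))\<^sup>2) + 2 * (real (length (L x)) * (\<Sum>(c, g, z)\<leftarrow>L x. c\<^sup>2 * (\<Sum>q\<in>\<Omega>. (v (z, (act q g, ?i g)))\<^sup>2)))"
        by (simp add: sum.distrib sum_distrib_left[symmetric] sum_sum_list_swap case_prod_beta')
      also have "\<dots> \<le> 2 * (\<Sum>q\<in>\<Omega>. (w (x, (q, i)))\<^sup>2) + 2 * (real (length (L x)) * ((\<Sum>(c, g, z)\<leftarrow>L x. c\<^sup>2) * s (i + 1)))"
      proof (rule add_left_mono, rule mult_left_mono, rule mult_left_mono, rule sum_list_le_const)
        fix c g z assume cgz: "(c, g, z) \<in> set (L x)"
        have g: "g \<in> carrier G" and z: "z \<in> set ys" using moves_okD[OF L x cgz] .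
        have th: "0 < \<theta> g" "\<theta> g \<le> j" using shift[OF x cgz] by auto
        have "(\<Sum>q\<in>\<Omega>. (v (z, (act q g, ?i g)))\<^sup>2) = (\<Sum>q\<in>\<Omega>. (v (z, (q, ?i g)))\<^sup>2)" by (rule sum_act[OF g])
        also have "\<dots> \<le> n (?i g)" unfolding n_def
          using member_le_sum[of z "set ys" "\<lambda>z. \<Sum>q\<in>\<Omega>. (v (z, (q, ?i g)))\<^sup>2"] z by (simp add: sum_nonneg)
        \<comment> \<open>Either the move stays below the top and ends on a level above
          \<open>i\<close>, or it wraps around to a level below \<open>j\<close>, where
          \<open>v\<close> vanishes.\<close>
        also have "\<dots> \<le> s (i + 1)"
        proof (cases "i + \<theta> g < m")
          case True
          then have "?i g = i + \<theta> g" using i th by simp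
          then show ?thesis unfolding s_def using member_le_sum[of "i + \<theta> g" "{i+1..<m}" n] n0 True th by simp
        next
          case False
          have "?i g = (i + \<theta> g - m) mod m" by simp
          also have "\<dots> = i + \<theta> g - m" by (rule mod_pos_pos_trivial) (use False i th j_le in auto)
          finally have "?i g = i + \<theta> g - m" .
          then have "?i g < j" using i th by simp
          then show ?thesis using nz s0 by simp
        qed
        finally show "c\<^sup>2 * (\<Sum>q\<in>\<Omega>. (v (z, (act q g, ?i g)))\<^sup>2) \<le> c\<^sup>2 * s (i + 1)" by (rule mult_left_mono) simp
      qed auto
      finally show "(\<Sum>q\<in>\<Omega>. (v (x, (q, i)))\<^sup>2) \<le> 2 * (\<Sum>q\<in>\<Omega>. (w (x, (q, i)))\<^sup>2) +
          2 * (real (length (L x)) * (\<Sum>(c, g, z)\<leftarrow>L x. c\<^sup>2) * s (i + 1))" by (simp add: mult.assoc)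
    qed
    also have "\<dots> = 2 * (\<Sum>x\<in>set ys. \<Sum>q\<in>\<Omega>. (w (x, (q, i)))\<^sup>2) + 2 * B * s (i + 1)"
      by (simp add: sum.distrib sum_distrib_left[symmetric] B_def moves_bound_def mult.assoc)
        (simp add: sum_distrib_right mult.assoc)
    also have "(\<Sum>x\<in>set ys. \<Sum>q\<in>\<Omega>. (w (x, (q, i)))\<^sup>2) \<le> N"
      unfolding N_def ipn using i
        member_le_sum[of i "{0..<m}" "\<lambda>i. \<Sum>x\<in>set ys. \<Sum>q\<in>\<Omega>. (w (x, (q, i)))\<^sup>2"]
      by (simp add: sum_nonneg)
    finally show ?thesis by simp
  qed
  \<comment> \<open>Adding \<open>2 * N\<close> turns the affine recursion s(i) \<le> 4 N + (1 + 2
    B) s(i+1) - 2 N into a geometric one with ratio 2 + 2 B.\<close>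
  have bound: "s (m - int k) + 2 * N \<le> 2 * N * (2 + 2 * B) ^ k" if "int k \<le> m" for k
    using that
  proof (induction k)
    case 0
    then show ?case by (simp add: s_def)
  next
    case (Suc k)
    let ?i = "m - int (Suc k)"
    have i: "0 \<le> ?i" "?i < m" using Suc.prems by auto
    have "{?i..<m} = insert ?i {?i + 1..<m}" using i by auto
    then have "s ?i = n ?i + s (?i + 1)" by (simp add: s_def)
    also have "\<dots> \<le> 2 * N + (2 * B + 1) * s (?i + 1)" using step[OF i] by (simp add: algebra_simps)
    finally have "s ?i + 2 * N \<le> (2 + 2 * B) * (s (?i + 1) + 2 * N)"
      using N0 s0[of "?i + 1"] mult_nonneg_nonneg[OF B0 N0] by (simp add: algebra_simps)
    also have "\<dots> \<le> (2 + 2 * B) * (2 * N * (2 + 2 * B) ^ k)"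
      using Suc B0 by (intro mult_left_mono) (auto simp: algebra_simps)
    finally show ?case by (simp add: algebra_simps)
  qed
  have "ip level.pts v v = s 0" unfolding ipn s_def n_def ..
  also have "\<dots> \<le> 2 * N * (2 + 2 * B) ^ nat m"
    using bound[of "nat m"] modulus N0 by simp
  finally show ?thesis by (simp add: N_def w_def B_def mult.assoc mult.commute)
qed

text \<open>The exceptional set consists of the first \<open>j\<close> levels. For u vanishing
  there, \<open>bounded_below\<close> gives |u|^2 \<le> \<kappa> |A u|^2, so the form of 1 - A*A/C
  is at most 1 - 1/(\<kappa> C) times |u|^2.\<close>

lemma gram_trace_le:
  fixes C :: real
  defines "\<kappa> \<equiv> 2 * (2 + 2 * moves_bound ys L) ^ nat m" and "A \<equiv> lin_moves (- 1) (id_moves G) L"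
  assumes C: "1 \<le> C" "moves_bound ys A \<le> C"
  shows "(\<Sum>p\<in>level.pts. (level.op (gram_moves G ys C A) ^^ k) (delta p) p) \<le>
    card \<Omega> * (length ys * j + length ys * m * (1 - 1 / (\<kappa> * C)) ^ k)"
proof -
  have A: "moves_ok G ys A" unfolding A_def by (rule moves_ok_A)
  interpret contraction_op level.pts "level.op (gram_moves G ys C A)"
    by (rule level.contraction_gram[OF A]) (use C in auto)
  have "1 \<le> (2 + 2 * moves_bound ys L) ^ nat m"
    by (rule one_le_power) (use moves_bound_nonneg[of ys L] in simp)
  then have \<kappa>: "1 \<le> \<kappa>" by (simp add: \<kappa>_def)
  have k1: "1 \<le> \<kappa> * C" using mult_mono[OF \<kappa> C(1)] \<kappa> by simp
  have "(\<Sum>p\<in>level.pts. (level.op (gram_moves G ys C A) ^^ k) (delta p) p) \<le>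
      card (set ys \<times> (\<Omega> \<times> {0..<j})) + card level.pts * (1 - 1 / (\<kappa> * C)) ^ k"
  proof (rule trace_power_le)
    show "set ys \<times> (\<Omega> \<times> {0..<j}) \<subseteq> level.pts" using j_le by auto
    show "0 \<le> 1 - 1 / (\<kappa> * C)" using k1 by simp
    fix u :: "'i \<times> 'w \<times> int \<Rightarrow> real" assume u: "supported (level.pts - set ys \<times> (\<Omega> \<times> {0..<j})) u"
    have u1: "supported level.pts u" using u by (auto simp: supported_def)
    have u2: "supported (set ys \<times> (\<Omega> \<times> {j..<m})) u" using u by (auto simp: supported_def)
    have "ip level.pts u u \<le> \<kappa> * ip level.pts (level.op A u) (level.op A u)"
      using bounded_below[OF u2] by (simp add: \<kappa>_def A_def)
    then have "ip level.pts u u / (\<kappa> * C) \<le> ip level.pts (level.op A u) (level.op A u) / C"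
      using \<kappa> C by (simp add: field_simps)
    then show "ip level.pts (level.op (gram_moves G ys C A) u) u \<le> (1 - 1 / (\<kappa> * C)) * ip level.pts u u"
      by (simp add: level.ip_gram[OF A u1] algebra_simps)
  qed
  also have "card (set ys \<times> (\<Omega> \<times> {0..<j})) = length ys * (card \<Omega> * nat j)"
    by (simp add: card_cartesian_product distinct_card distinct_ys)
  also have "card level.pts = length ys * (card \<Omega> * nat m)"
    by (simp add: card_cartesian_product distinct_card distinct_ys)
  finally show ?thesis using j_nonneg modulus by (simp add: algebra_simps)
qed

end

theorem no_ample_actions:
  fixes G (structure) and L :: "('a, 'a) moves"
  assumes G: "group G" and ys: "distinct ys" "set ys \<subseteq> carrier G" "generate G (set ys) = carrier G" "t \<in> set ys"
    and L: "moves_ok G ys L"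
    and \<theta>: "\<And>g h. g \<in> carrier G \<Longrightarrow> h \<in> carrier G \<Longrightarrow> \<theta> (g \<otimes> h) = \<theta> g + (\<theta> h :: int)"
    and pos: "\<And>x c g z. x \<in> set ys \<Longrightarrow> (c, g, z) \<in> set (L x) \<Longrightarrow> 0 < \<theta> g"
    and rel: "\<And>(\<Omega> :: 'w set) act d x q. right_action G \<Omega> act \<Longrightarrow> cocycle G \<Omega> act d \<Longrightarrow> (\<And>q. q \<in> \<Omega> \<Longrightarrow> d t q = 0) \<Longrightarrow>
      x \<in> set ys \<Longrightarrow> q \<in> \<Omega> \<Longrightarrow> d x q = (\<Sum>(c, g, z)\<leftarrow>L x. c * d z (act q g))"
    and actions: "\<And>B. finite B \<Longrightarrow> B \<subseteq> carrier G \<Longrightarrow> \<exists>(\<Omega> :: 'w set) act. right_action G \<Omega> act \<and> \<Omega> \<noteq> {} \<and>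
      (\<forall>g\<in>B. \<forall>q\<in>\<Omega>. act q g = q \<longrightarrow> g = \<one>) \<and> ample G \<Omega> act"
  shows False
proof -
  interpret group G by (rule G)
  define T where "T = \<theta> ` (\<Union>x\<in>set ys. (\<lambda>(c, g, z). g) ` set (L x))"
  have T: "finite T" by (simp add: T_def)
  define j where "j = Max (insert 0 T)"
  have j0: "0 \<le> j" using T by (simp add: j_def)
  have shift: "0 < \<theta> g \<and> \<theta> g \<le> j" if "x \<in> set ys" "(c, g, z) \<in> set (L x)" for x c g z
  proof -
    have "\<theta> g \<in> T" unfolding T_def using that by (force intro!: imageI)
    then show ?thesis using T pos[OF that] by (simp add: j_def)
  qed
  define n where "n = int (length ys)"
  have n1: "1 \<le> n" using ys(4) by (cases ys) (auto simp: n_def)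
  \<comment> \<open>The trace on all levels will be at least m |\<Omega>|, and at most n j
    |\<Omega>| plus an error below |\<Omega>|; \<open>m\<close> is taken beyond n j + 1.\<close>
  define m where "m = n * j + 2"
  have "j \<le> n * j" using mult_right_mono[OF n1 j0] by simp
  then have m: "0 < m" "j \<le> m" using j0 by (auto simp: m_def)
  define A where "A = lin_moves (- 1) (id_moves G) L"
  have A: "moves_ok G ys A" unfolding A_def by (intro moves_ok_lin moves_ok_id L)
  define C where "C = 1 + moves_bound ys A"
  have C: "1 \<le> C" "moves_bound ys A \<le> C" using moves_bound_nonneg[of ys A] by (auto simp: C_def)
  define \<kappa> where "\<kappa> = 2 * (2 + 2 * moves_bound ys L) ^ nat m"
  have "1 \<le> (2 + 2 * moves_bound ys L) ^ nat m"
    by (rule one_le_power) (use moves_bound_nonneg[of ys L] in simp)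
  then have \<kappa>: "1 \<le> \<kappa>" by (simp add: \<kappa>_def)
  have k1: "1 \<le> \<kappa> * C" using mult_mono[OF \<kappa> C(1)] \<kappa> by simp
  have nm: "0 < real_of_int n * real_of_int m" using n1 m by simp
  \<comment> \<open>This pushes below 1 the error per point of \<Omega>, which comes from the at
    most n m |\<Omega>| eigenvalues not exceeding 1 - 1/(\<kappa> C).\<close>
  obtain k where k: "(1 - 1 / (\<kappa> * C)) ^ k < 1 / (real_of_int n * real_of_int m)"
    using real_arch_pow_inv[of "1 / (real_of_int n * real_of_int m)" "1 - 1 / (\<kappa> * C)"] nm k1 by auto
  define B where "B = (\<Union>x\<in>set ys. (\<lambda>(c, g, z). g) ` set (pow_moves G (gram_moves G ys C A) k x))"
  have "finite B" by (simp add: B_def)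
  moreover have "B \<subseteq> carrier G"
    using moves_okD(1)[OF moves_ok_pow[OF moves_ok_gram[OF A]]] by (fastforce simp: B_def)
  ultimately have "\<exists>(\<Omega> :: 'w set) act. right_action G \<Omega> act \<and> \<Omega> \<noteq> {} \<and>
      (\<forall>g\<in>B. \<forall>q\<in>\<Omega>. act q g = q \<longrightarrow> g = \<one>) \<and> ample G \<Omega> act"
    by (rule actions)
  then obtain \<Omega> :: "'w set" and act where
    act: "right_action G \<Omega> act" "\<Omega> \<noteq> {}" and free: "\<forall>g\<in>B. \<forall>q\<in>\<Omega>. act q g = q \<longrightarrow> g = \<one>"
    and am: "ample G \<Omega> act"
    by (elim exE conjE) (rule that; assumption)
  interpret right_action G \<Omega> act by (rule act(1))
  interpret moves_action G \<Omega> act ys by unfold_locales (rule ys(1))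
  interpret graded_moves G \<Omega> act \<theta> m ys L j
    by unfold_locales (use \<theta> m ys(1) L shift j0 in auto)
  have c0: "0 < card \<Omega>" using act(2) finite_points by (simp add: card_gt_0_iff)
  have inB: "g \<in> B" if "x \<in> set ys" "(c, g, z) \<in> set (pow_moves G (gram_moves G ys C A) k x)" for x c g z
    unfolding B_def using that by force
  define \<tau> where "\<tau> = moves_trace G ys (pow_moves G (gram_moves G ys C A) k)"
  have "card \<Omega> \<le> (\<Sum>p\<in>pts. (op (gram_moves G ys C A) ^^ k) (delta p) p)"
  proof (rule gram_trace_ge[OF moves_action_axioms A _ C(2) ys(2,3,4) am])
    fix d x q
    assume d: "cocycle G \<Omega> act d" "\<And>q. q \<in> \<Omega> \<Longrightarrow> d t q = 0" "x \<in> set ys" "q \<in> \<Omega>"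
    have "(\<Sum>(c, g, z)\<leftarrow>map (\<lambda>(c, g, z). (- 1 * c, g, z)) ms. c * d z (act q g)) = - (\<Sum>(c, g, z)\<leftarrow>ms. c * d z (act q g))" for ms
      by (induction ms) auto
    then show "(\<Sum>(c, g, z)\<leftarrow>A x. c * d z (act q g)) = 0"
      using rel[OF act(1) d] d by (simp add: A_def lin_moves_def id_moves_def act_one)
  qed (use C in simp)
  also have "\<dots> = card \<Omega> * \<tau>" unfolding \<tau>_def
    by (rule gram_trace[OF A]) (use free inB in blast)
  finally have "1 \<le> \<tau>" using c0 by simp
  have "m * card \<Omega> \<le> card (\<Omega> \<times> {0..<m}) * \<tau>"
    using \<open>1 \<le> \<tau>\<close> m c0 by (simp add: card_cartesian_product algebra_simps)
  \<comment> \<open>An element fixing a point \<open>(q, i)\<close> fixes \<open>q\<close>, so the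
    level action is free on \<open>B\<close> as well and has the same trace \<open>\<tau>\<close>
    per point.\<close>
  also have "\<dots> = (\<Sum>p\<in>level.pts. (level.op (gram_moves G ys C A) ^^ k) (delta p) p)" unfolding \<tau>_def
    by (rule level.gram_trace[OF A, symmetric]) (use free inB in \<open>auto simp: level_act_def\<close>)
  also have "\<dots> \<le> card \<Omega> * (length ys * j + length ys * m * (1 - 1 / (\<kappa> * C)) ^ k)"
    unfolding A_def \<kappa>_def by (rule gram_trace_le) (use C in \<open>auto simp: A_def\<close>)
  finally have "real_of_int m \<le> length ys * j + length ys * m * (1 - 1 / (\<kappa> * C)) ^ k"
    using c0 by (simp add: mult.commute)
  also have "\<dots> < n * j + 1" using k nm by (simp only: pos_less_divide_eq) (simp add: n_def algebra_simps)
  finally show False by (simp add: m_def)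
qed

section \<open>Subgroups of free groups\<close>

lemma free_group_simps [simp]:
  "\<one>\<^bsub>free_group S\<^esub> = []"
  "u \<otimes>\<^bsub>free_group S\<^esub> v = foldr reduced_cons u v"
  by (simp_all add: free_group_def)

lemma free_group_carrier: "w \<in> carrier (free_group S) \<longleftrightarrow> reduced w \<and> snd ` set w \<subseteq> S"
  by (simp add: free_group_def)

lemma letter_carrier: "snd a \<in> S \<Longrightarrow> [a] \<in> carrier (free_group S)"
  by (simp add: free_group_carrier reduced_def)

lemma carrier_Cons: "a # w \<in> carrier (free_group S) \<Longrightarrow> snd a \<in> S \<and> w \<in> carrier (free_group S) \<and> reduced_cons a w = a # w"
  by (cases w) (auto simp: free_group_carrier reduced_def)

lemma carrier_snoc: "w @ [a] \<in> carrier (free_group S) \<Longrightarrow> snd a \<in> S \<and> w \<in> carrier (free_group S)"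
  by (auto simp: free_group_carrier reduced_def successively_append_iff)

lemma foldr_snoc: "reduced (w @ [a]) \<Longrightarrow> foldr reduced_cons w [a] = w @ [a]"
  using foldr_reduced_cons_Nil[of "w @ [a]"] by simp

lemma foldr_letter_cases:
  assumes "reduced w"
  obtains "foldr reduced_cons w [a] = w @ [a]" | v where "w = v @ [flip a]" "foldr reduced_cons w [a] = v"
proof (cases "reduced (w @ [a])")
  case True
  then show ?thesis using foldr_snoc that by blast
next
  case False
  then have "w \<noteq> []" "a = flip (last w)" using assms by (auto simp: reduced_def successively_append_iff)
  then obtain v where v: "w = v @ [flip a]" by (metis append_butlast_last_id flip_flip)
  then have "reduced v" using assms by (auto simp: reduced_def successively_append_iff)
  then have "foldr reduced_cons w [a] = v" by (simp add: v foldr_reduced_cons_Nil)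
  then show ?thesis using v that by blast
qed

lemma inv_gen:
  assumes "s \<in> S"
  shows "inv\<^bsub>free_group S\<^esub> (gen s) = [(False, s)]"
proof -
  interpret F: group "free_group S" by (rule group_free_group)
  show ?thesis
    by (rule F.inv_equality) (use assms in \<open>auto simp: gen_def flip_def letter_carrier\<close>)
qed

text \<open>Shortlex for a well-order of the letters. Compatibility with appending a letter is what
  makes least coset representatives closed under prefixes.\<close>

lemma word_order_exists:
  "\<exists>r :: ('c list \<times> 'c list) set. wf r \<and> total r \<and> (\<forall>x y. length x < length y \<longrightarrow> (x, y) \<in> r) \<and>
     (\<forall>x y. (x, y) \<in> r \<longrightarrow> length x \<le> length y) \<and> (\<forall>x y a. (x, y) \<in> r \<longrightarrow> (x @ [a], y @ [a]) \<in> r)"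
proof -
  obtain r :: "'c rel" where r: "well_order_on UNIV r" using well_order_on by blast
  then have "wf (r - Id)" "total (r - Id)"
    by (auto simp: well_order_on_def linear_order_on_def)
  then have "wf (lenlex (r - Id))" "total (lenlex (r - Id))"
    by (auto intro: total_lenlex)
  moreover have "(x, y) \<in> lenlex (r - Id)" if "length x < length y" for x y
    using that by (simp add: lenlex_conv)
  ultimately show ?thesis
    by (intro exI[of _ "lenlex (r - Id)"]) (auto dest: lenlex_length intro: lenlex_append1)
qed

section \<open>Schreier transversal and Schreier generators of a subgroup of a free group\<close>

locale free_subgroup =
  fixes S :: "'b set" and H :: "'b word set" and ord :: "('b word \<times> 'b word) set"
  assumes H: "subgroup H (free_group S)"
    and wf_ord: "wf ord" and total_ord: "total ord"
    and shorter: "length x < length y \<Longrightarrow> (x, y) \<in> ord"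
    and ord_length: "(x, y) \<in> ord \<Longrightarrow> length x \<le> length y"
    and ord_snoc: "(x, y) \<in> ord \<Longrightarrow> (x @ [a], y @ [a]) \<in> ord"
begin

abbreviation F where "F \<equiv> free_group S"
abbreviation F_mult (infixl \<open>\<cdot>\<close> 70) where "u \<cdot> v \<equiv> u \<otimes>\<^bsub>F\<^esub> v"

sublocale F: group F by (rule group_free_group)

lemma F_mult_closed: "u \<in> carrier F \<Longrightarrow> v \<in> carrier F \<Longrightarrow> foldr reduced_cons u v \<in> carrier F"
  using F.m_closed by simp

lemma F_assoc: "w \<in> carrier F \<Longrightarrow> foldr reduced_cons (foldr reduced_cons u v) w = foldr reduced_cons u (foldr reduced_cons v w)"
  by (simp add: free_group_carrier foldr_reduced_cons_assoc)

lemma F_right_one: "u \<in> carrier F \<Longrightarrow> foldr reduced_cons u [] = u"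
  by (simp add: free_group_carrier foldr_reduced_cons_Nil)

text \<open>A least element of the coset of \<open>p\<close>; these elements form the Schreier
  transversal. \<open>p\<close> enters only through its coset, whence
  \<open>rep_cong\<close>.\<close>

definition rep :: "'b word \<Rightarrow> 'b word" where
  "rep p = (SOME x. x \<in> H #>\<^bsub>F\<^esub> p \<and> (\<forall>y\<in>H #>\<^bsub>F\<^esub> p. (y, x) \<notin> ord))"

lemma coset_self: "p \<in> carrier F \<Longrightarrow> p \<in> H #>\<^bsub>F\<^esub> p"
  using F.rcos_self H by blast

lemma coset_eq: "h \<in> H \<Longrightarrow> p \<in> carrier F \<Longrightarrow> H #>\<^bsub>F\<^esub> (h \<cdot> p) = H #>\<^bsub>F\<^esub> p"
  using F.coset_mult_assoc[of H h p] F.coset_join2[of h H] H subgroup.subset[OF H] subgroup.mem_carrier[OF H]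
  by simp

lemma rep_props:
  assumes "p \<in> carrier F"
  shows "rep p \<in> H #>\<^bsub>F\<^esub> p" "\<And>y. y \<in> H #>\<^bsub>F\<^esub> p \<Longrightarrow> (y, rep p) \<notin> ord"
proof -
  obtain x where "x \<in> H #>\<^bsub>F\<^esub> p" "\<And>y. (y, x) \<in> ord \<Longrightarrow> y \<notin> H #>\<^bsub>F\<^esub> p"
    using wfE_min[OF wf_ord coset_self[OF assms]] by metis
  then have "\<exists>x. x \<in> H #>\<^bsub>F\<^esub> p \<and> (\<forall>y\<in>H #>\<^bsub>F\<^esub> p. (y, x) \<notin> ord)" by blast
  from someI_ex[OF this] show "rep p \<in> H #>\<^bsub>F\<^esub> p" "\<And>y. y \<in> H #>\<^bsub>F\<^esub> p \<Longrightarrow> (y, rep p) \<notin> ord"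
    unfolding rep_def by blast+
qed

lemma rep_cong: "H #>\<^bsub>F\<^esub> p = H #>\<^bsub>F\<^esub> q \<Longrightarrow> rep p = rep q"
  by (simp add: rep_def)

lemma rep_mult: "h \<in> H \<Longrightarrow> p \<in> carrier F \<Longrightarrow> rep (h \<cdot> p) = rep p"
  by (rule rep_cong) (rule coset_eq)

lemma rep_decomp:
  assumes "p \<in> carrier F"
  obtains h where "h \<in> H" "rep p = h \<cdot> p"
  using rep_props(1)[OF assms] by (auto simp: r_coset_def)

lemma rep_closed: "p \<in> carrier F \<Longrightarrow> rep p \<in> carrier F"
  using rep_decomp[of p] subgroup.mem_carrier[OF H] F.m_closed by metis

lemma rep_rep: "p \<in> carrier F \<Longrightarrow> rep (rep p) = rep p"
  using rep_decomp[of p] rep_mult by metis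

lemma rep_right: "p \<in> carrier F \<Longrightarrow> q \<in> carrier F \<Longrightarrow> rep (rep p \<cdot> q) = rep (p \<cdot> q)"
  using rep_decomp[of p] rep_mult F.m_assoc subgroup.mem_carrier[OF H] F.m_closed by metis

lemma rep_quotient: "p \<in> carrier F \<Longrightarrow> p \<cdot> inv\<^bsub>F\<^esub> rep p \<in> H"
proof -
  assume p: "p \<in> carrier F"
  obtain h where h: "h \<in> H" "rep p = h \<cdot> p" using rep_decomp[OF p] .
  have hc: "h \<in> carrier F" using h subgroup.mem_carrier[OF H] by blast
  have "p \<cdot> inv\<^bsub>F\<^esub> (h \<cdot> p) = inv\<^bsub>F\<^esub> h"
    using p hc by (simp only: F.inv_mult_group F.m_assoc[symmetric] F.inv_closed F.r_inv F.l_one)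
  then show ?thesis using h subgroup.m_inv_closed[OF H] by simp
qed

lemma rep_minimal: "p \<in> carrier F \<Longrightarrow> y \<in> carrier F \<Longrightarrow> rep y = rep p \<Longrightarrow> y = rep p \<or> (rep p, y) \<in> ord"
proof -
  assume p: "p \<in> carrier F" "y \<in> carrier F" "rep y = rep p"
  have "(y, rep p) \<notin> ord" using rep_props(2)[OF p(2) coset_self[OF p(2)]] p(3) by simp
  then show ?thesis using total_ord by (auto simp: total_on_def)
qed

lemma rep_Nil: "rep [] = []"
proof -
  have "[] \<in> carrier F" using F.one_closed by simp
  from rep_minimal[OF this this refl] show ?thesis using ord_length[of "rep []" "[]"] by auto
qed

lemma rep_subgroup: "h \<in> H \<Longrightarrow> rep h = []"
  using rep_mult[of h "[]"] F.one_closed rep_Nil F.r_one[of h] subgroup.mem_carrier[OF H] by simp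

text \<open>If \<open>rep x\<close> preceded \<open>x\<close>, then \<open>rep x\<close> times
  \<open>a\<close> would lie in the coset of \<open>x @ [a]\<close> and precede it: by
  \<open>ord_snoc\<close> if nothing cancels, and by being shorter otherwise.\<close>

lemma rep_prefix:
  assumes x: "x @ [a] \<in> carrier F" "rep (x @ [a]) = x @ [a]"
  shows "rep x = x"
proof (rule ccontr)
  assume "rep x \<noteq> x"
  have xc: "x \<in> carrier F" and ac: "[a] \<in> carrier F" using carrier_snoc[OF x(1)] by (auto simp: letter_carrier)
  have o: "(rep x, x) \<in> ord" using rep_minimal[OF xc xc refl] \<open>rep x \<noteq> x\<close> by auto
  define y where "y = rep x \<cdot> [a]"
  have yc: "y \<in> carrier F" unfolding y_def by (intro F.m_closed rep_closed xc ac)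
  have xa: "x \<cdot> [a] = x @ [a]" using x(1) by (simp add: foldr_snoc free_group_carrier)
  have "rep y = x @ [a]" using rep_right[OF xc ac] x(2) xa by (simp only: y_def)
  then have "(y, x @ [a]) \<notin> ord" using rep_props(2)[OF yc coset_self[OF yc]] by simp
  moreover have "(y, x @ [a]) \<in> ord"
  proof -
    have "reduced (rep x)" using rep_closed[OF xc] by (simp add: free_group_carrier)
    then consider "y = rep x @ [a]" | v where "rep x = v @ [flip a]" "y = v"
      unfolding y_def by (cases rule: foldr_letter_cases[of "rep x" a]) auto
    then show ?thesis
    proof cases
      case 1
      then show ?thesis using ord_snoc[OF o] by simp
    next
      case 2
      then show ?thesis using ord_length[OF o] by (intro shorter) simp
    qed
  qed
  ultimately show False by blast
qed

text \<open>The pairs \<open>(p, s)\<close> are the edges of the Schreier graph of \<open>H\<close>, with \<open>p\<close> representing its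
  coset; the edges with \<open>rep (p s) = p s\<close> form a spanning tree.\<close>

definition outside_tree :: "('b word \<times> 'b) set" where
  "outside_tree = {(p, s). p \<in> carrier F \<and> rep p = p \<and> s \<in> S \<and> rep (p \<cdot> gen s) \<noteq> p \<cdot> gen s}"

text \<open>The Schreier generator of an edge: out to \<open>p\<close>, across the edge, and back
  along the tree.\<close>

definition loop :: "'b word \<times> 'b \<Rightarrow> 'b word" where
  "loop = (\<lambda>(p, s). p \<cdot> gen s \<cdot> inv\<^bsub>F\<^esub> rep (p \<cdot> gen s))"

lemma loop_in_H: "p \<in> carrier F \<Longrightarrow> s \<in> S \<Longrightarrow> loop (p, s) \<in> H"
  unfolding loop_def prod.case by (intro rep_quotient F.m_closed gen_in_free_group)

lemma outside_treeD: "(p, s) \<in> outside_tree \<Longrightarrow> p \<in> carrier F \<and> s \<in> S \<and> rep p = p"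
  by (simp add: outside_tree_def)

lemma loops_carrier: "loop ` outside_tree \<subseteq> carrier F"
  using loop_in_H subgroup.mem_carrier[OF H] outside_treeD by fastforce

lemma loop_generate:
  assumes "p \<in> carrier F" "s \<in> S" "rep p = p"
  shows "loop (p, s) \<in> generate F (loop ` outside_tree)"
proof (cases "(p, s) \<in> outside_tree")
  case True
  then show ?thesis by (intro generate.incl imageI)
next
  case False
  then have "rep (p \<cdot> gen s) = p \<cdot> gen s" using assms by (simp add: outside_tree_def)
  then have "loop (p, s) = \<one>\<^bsub>F\<^esub>" unfolding loop_def prod.case
    using assms by (metis F.m_closed F.r_inv gen_in_free_group)
  then show ?thesis using generate.one by metis
qed

text \<open>Schreier's lemma: each appended letter contributes one loop or its inverse, and the
  representatives in between cancel.\<close>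

lemma word_generate:
  assumes "w \<in> carrier F"
  shows "w \<cdot> inv\<^bsub>F\<^esub> rep w \<in> generate F (loop ` outside_tree)" (is "_ \<in> ?K")
  using assms
proof (induction w rule: rev_induct)
  case Nil
  then show ?case using generate.one[of F] F.inv_one by (simp add: rep_Nil)
next
  case (snoc a u)
  have K: "subgroup ?K F" by (rule F.generate_is_subgroup[OF loops_carrier])
  have uc: "u \<in> carrier F" and ac: "[a] \<in> carrier F" and aS: "snd a \<in> S"
    using carrier_snoc[OF snoc.prems] by (auto simp: letter_carrier)
  have w: "u @ [a] = u \<cdot> [a]" using snoc.prems by (simp add: foldr_snoc free_group_carrier)
  define r where "r = rep u"
  have rc: "r \<in> carrier F" "rep r = r" using rep_closed[OF uc] rep_rep[OF uc] by (auto simp: r_def)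
  define r' where "r' = rep (r \<cdot> [a])"
  have rac: "r \<cdot> [a] \<in> carrier F" by (intro F.m_closed rc ac)
  have r': "rep (u @ [a]) = r'" unfolding w r'_def r_def by (rule rep_right[OF uc ac, symmetric])
  have r'c: "r' \<in> carrier F" "rep r' = r'" using rep_closed[OF rac] rep_rep[OF rac] by (auto simp: r'_def)
  have step: "r \<cdot> [a] \<cdot> inv\<^bsub>F\<^esub> r' \<in> ?K"
  proof (cases "fst a")
    case True
    then have a: "[a] = gen (snd a)" by (cases a) (simp add: gen_def)
    show ?thesis using loop_generate[OF rc(1) aS rc(2)] unfolding loop_def prod.case r'_def a .
  next
    case False
    have gc: "gen (snd a) \<in> carrier F" using aS by (rule gen_in_free_group)
    have a: "[a] = inv\<^bsub>F\<^esub> gen (snd a)" unfolding inv_gen[OF aS] using False by (cases a) simp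
    \<comment> \<open>An inverse letter crosses the edge that starts at \<open>r'\<close> backwards,
      so it yields the inverse of the loop of that edge.\<close>
    have "rep (r' \<cdot> gen (snd a)) = rep (r \<cdot> [a] \<cdot> gen (snd a))"
      unfolding r'_def by (rule rep_right[OF rac gc])
    also have "r \<cdot> [a] \<cdot> gen (snd a) = r"
      unfolding a using rc gc by (simp only: F.m_assoc F.inv_closed F.l_inv F.r_one)
    finally have "loop (r', snd a) = r' \<cdot> gen (snd a) \<cdot> inv\<^bsub>F\<^esub> r"
      unfolding loop_def prod.case by (simp only: rc)
    moreover have "inv\<^bsub>F\<^esub> (r' \<cdot> gen (snd a) \<cdot> inv\<^bsub>F\<^esub> r) = r \<cdot> [a] \<cdot> inv\<^bsub>F\<^esub> r'"
      unfolding a using rc r'c gc by (simp only: F.inv_mult_group F.inv_closed F.m_closed F.inv_inv F.m_assoc)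
    ultimately show ?thesis
      using loop_generate[OF r'c(1) aS r'c(2)] subgroup.m_inv_closed[OF K] by metis
  qed
  have "u \<cdot> inv\<^bsub>F\<^esub> r \<in> ?K" unfolding r_def by (rule snoc.IH[OF uc])
  then have "(u \<cdot> inv\<^bsub>F\<^esub> r) \<cdot> (r \<cdot> [a] \<cdot> inv\<^bsub>F\<^esub> r') \<in> ?K"
    using step subgroup.m_closed[OF K] by blast
  also have "(u \<cdot> inv\<^bsub>F\<^esub> r) \<cdot> (r \<cdot> [a] \<cdot> inv\<^bsub>F\<^esub> r') = u \<cdot> [a] \<cdot> inv\<^bsub>F\<^esub> r'"
    using uc rc r'c ac by (metis F.inv_closed F.inv_solve_left F.m_assoc F.m_closed)
  finally show ?case unfolding w r'[unfolded w] .
qed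

text \<open>The loops of the outside edges generate every element of \<open>H\<close>; if there were
  at most one such edge, \<open>H\<close> would lie in a cyclic group and be commutative.\<close>

lemma two_outside:
  assumes "x \<in> H" "y \<in> H" "x \<cdot> y \<noteq> y \<cdot> x"
  obtains e :: "bool \<Rightarrow> 'b word \<times> 'b" where "range e \<subseteq> outside_tree" "e True \<noteq> e False"
proof -
  have HK: "h \<in> generate F (loop ` outside_tree)" if "h \<in> H" for h
    using word_generate[of h] that subgroup.mem_carrier[OF H that] rep_subgroup[OF that] F.inv_one F.r_one by simp
  have "\<exists>e1\<in>outside_tree. \<exists>e2\<in>outside_tree. e1 \<noteq> e2"
  proof (rule ccontr)
    assume "\<not> ?thesis"
    then obtain e where e: "outside_tree \<subseteq> {e}" by blast
    obtain c where c: "c \<in> carrier F" "loop ` outside_tree \<subseteq> {c}"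
    proof (cases "outside_tree = {}")
      case True
      then show ?thesis using that[of "\<one>\<^bsub>F\<^esub>"] F.one_closed by simp
    next
      case False
      then show ?thesis using that[of "loop e"] e loops_carrier by blast
    qed
    have "H \<subseteq> generate F {c}" using HK F.mono_generate[OF c(2)] by blast
    then obtain m n :: int where "x = c [^]\<^bsub>F\<^esub> m" "y = c [^]\<^bsub>F\<^esub> n"
      using assms(1,2) F.generate_pow[OF c(1)] by blast
    then have "x \<cdot> y = y \<cdot> x" using F.int_pow_mult[OF c(1)] by (metis add.commute)
    then show False using assms(3) by simp
  qed
  then obtain e1 e2 where "e1 \<in> outside_tree" "e2 \<in> outside_tree" "e1 \<noteq> e2" by blast
  then show ?thesis using that[of "\<lambda>b. if b then e1 else e2"] by auto
qed

section \<open>Integrals of edge weights along paths in the Cayley graph of the free group\<close>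

definition step_weight :: "('b word \<Rightarrow> 'b \<Rightarrow> real) \<Rightarrow> 'b word \<Rightarrow> bool \<times> 'b \<Rightarrow> real" where
  "step_weight \<phi> p a = (if fst a then \<phi> p (snd a) else - \<phi> (p \<cdot> [a]) (snd a))"

text \<open>An edge crossed backwards counts negatively, so cancelling letters contribute 0 and
  reducing a word does not change the integral; this is behind the additivity in
  \<open>path_integral_mult\<close>.\<close>

fun path_integral :: "('b word \<Rightarrow> 'b \<Rightarrow> real) \<Rightarrow> 'b word \<Rightarrow> 'b word \<Rightarrow> real" where
  "path_integral \<phi> p [] = 0"
| "path_integral \<phi> p (a # w) = step_weight \<phi> p a + path_integral \<phi> (foldr reduced_cons p [a]) w"

lemma mult_flip: "p \<in> carrier F \<Longrightarrow> snd a \<in> S \<Longrightarrow> foldr reduced_cons (foldr reduced_cons p [a]) [flip a] = p"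
  using F_assoc[of "[flip a]" p "[a]"] by (simp add: letter_carrier F_right_one)

lemma step_weight_flip:
  "p \<in> carrier F \<Longrightarrow> snd a \<in> S \<Longrightarrow> step_weight \<phi> p a + step_weight \<phi> (foldr reduced_cons p [a]) (flip a) = 0"
  using mult_flip[of p a] by (auto simp: step_weight_def flip_def)

lemma path_integral_reduced_cons:
  assumes "p \<in> carrier F" "snd a \<in> S"
  shows "path_integral \<phi> p (reduced_cons a w) = step_weight \<phi> p a + path_integral \<phi> (foldr reduced_cons p [a]) w"
proof (cases "\<exists>v. w = flip a # v")
  case True
  then obtain v where v: "w = flip a # v" by blast
  then show ?thesis using step_weight_flip[OF assms, of \<phi>] mult_flip[OF assms] by simp
next
  case False
  then have "reduced_cons a w = a # w" by (cases w) auto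
  then show ?thesis by simp
qed

lemma path_integral_mult:
  assumes "p \<in> carrier F" "u \<in> carrier F" "w \<in> carrier F"
  shows "path_integral \<phi> p (u \<cdot> w) = path_integral \<phi> p u + path_integral \<phi> (p \<cdot> u) w"
  using assms
proof (induction u arbitrary: p)
  case Nil
  then show ?case by (simp add: F_right_one)
next
  case (Cons a u)
  have a: "snd a \<in> S" "u \<in> carrier F" "reduced_cons a u = a # u" using carrier_Cons[OF Cons.prems(2)] by auto
  have ac: "[a] \<in> carrier F" using a by (simp add: letter_carrier)
  have pa: "foldr reduced_cons p [a] \<in> carrier F" using F_mult_closed Cons.prems(1) ac by blast
  have "foldr reduced_cons (foldr reduced_cons p [a]) u = foldr reduced_cons p (a # u)"
    using F_assoc[OF a(2), of p "[a]"] a(3) by simp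
  then show ?case
    using Cons.IH[OF pa a(2) Cons.prems(3)] path_integral_reduced_cons[OF Cons.prems(1) a(1)] by simp
qed

text \<open>Left translation by \<open>h\<close> carries the path from \<open>p\<close> to the path
  from \<open>h \<cdot> p\<close> spelling the same word, so only the weights need to be
  compared.\<close>

lemma path_integral_cong:
  assumes "\<And>p s. p \<in> carrier F \<Longrightarrow> s \<in> S \<Longrightarrow> \<phi> (h \<cdot> p) s = \<psi> p s" and h: "h \<in> carrier F"
    and "p \<in> carrier F" "w \<in> carrier F"
  shows "path_integral \<phi> (h \<cdot> p) w = path_integral \<psi> p w"
  using assms(3,4)
proof (induction w arbitrary: p)
  case (Cons a w)
  have a: "snd a \<in> S" "w \<in> carrier F" using carrier_Cons[OF Cons.prems(2)] by auto
  have ac: "[a] \<in> carrier F" using a by (simp add: letter_carrier)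
  have pa: "p \<cdot> [a] \<in> carrier F" using F.m_closed Cons.prems(1) ac by blast
  have e: "h \<cdot> p \<cdot> [a] = h \<cdot> (p \<cdot> [a])" by (rule F.m_assoc[OF h Cons.prems(1) ac])
  have "step_weight \<phi> (h \<cdot> p) a = step_weight \<psi> p a"
    unfolding step_weight_def e using assms(1)[OF Cons.prems(1) a(1)] assms(1)[OF pa a(1)] by simp
  moreover have "path_integral \<phi> (h \<cdot> p \<cdot> [a]) w = path_integral \<psi> (p \<cdot> [a]) w"
    unfolding e by (rule Cons.IH[OF pa a(2)])
  ultimately show ?case by simp
qed simp

lemma path_integral_linear:
  assumes "\<And>p s. linear_functional (\<lambda>v. \<phi> v p s)"
  shows "linear_functional (\<lambda>v. path_integral (\<phi> v) p w)"
proof -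
  have "linear_functional (\<lambda>v. step_weight (\<phi> v) p a)" for p a
    using assms by (auto simp: linear_functional_def step_weight_def)
  then show ?thesis
    by (induction w arbitrary: p) (auto simp: linear_functional_def algebra_simps)
qed

end


text \<open>Edges of the Cayley graph lying over the outside edge \<open>e b\<close> get as weight
  the value of \<open>v\<close> at \<open>b\<close> and the translated base point; all others get 0.
  Translating a path by an element \<open>h\<close> of \<open>H\<close> replaces the base point
  \<open>q\<close> by \<open>act q h\<close>, which is the cocycle identity for integrals starting
  at the identity. Tree paths collect nothing, so the loop of \<open>e b\<close> collects a single
  value of \<open>v\<close>, and \<open>v\<close> can be recovered.\<close>

theorem ample_subgroup:
  assumes act: "right_action (free_group S) \<Omega> act" and H: "subgroup H (free_group S)"
    and xy: "x \<in> H" "y \<in> H" "x \<otimes>\<^bsub>free_group S\<^esub> y \<noteq> y \<otimes>\<^bsub>free_group S\<^esub> x"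
  shows "ample ((free_group S)\<lparr>carrier := H\<rparr>) \<Omega> act"
proof -
  obtain ord :: "('a word \<times> 'a word) set" where ord:
    "wf ord \<and> total ord \<and> (\<forall>x y. length x < length y \<longrightarrow> (x, y) \<in> ord) \<and>
     (\<forall>x y. (x, y) \<in> ord \<longrightarrow> length x \<le> length y) \<and> (\<forall>x y a. (x, y) \<in> ord \<longrightarrow> (x @ [a], y @ [a]) \<in> ord)"
    using word_order_exists by (elim exE) (rule that)
  interpret free_subgroup S H ord by (rule free_subgroup.intro[OF H]) (use ord in blast)+
  interpret right_action F \<Omega> act by (rule act)
  obtain e :: "bool \<Rightarrow> 'a word \<times> 'a" where e: "range e \<subseteq> outside_tree" "e True \<noteq> e False"
    using two_outside[OF xy] by blast
  define \<phi> where "\<phi> = (\<lambda>q v p s. if (rep p, s) = e True then v (True, act q p)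
      else if (rep p, s) = e False then v (False, act q p) else (0::real))"
  have e_out: "e b \<in> outside_tree" for b using e(1) by auto
  have Hc: "h \<in> carrier F" if "h \<in> H" for h using subgroup.mem_carrier[OF H that] .
  have Nc: "[] \<in> carrier F" using F.one_closed by simp
  have \<phi>_H: "\<phi> q v (h \<cdot> p) s = \<phi> (act q h) v p s" if "h \<in> H" "p \<in> carrier F" "q \<in> \<Omega>" for q v h p s
    unfolding \<phi>_def rep_mult[OF that(1,2)] act_mult[OF that(3) Hc[OF that(1)] that(2)] ..
  have \<phi>_tree: "\<phi> q v p s = 0" if "p \<in> carrier F" "s \<in> S" "rep p = p" "rep (p \<cdot> gen s) = p \<cdot> gen s" for q v p s
  proof -
    have "(p, s) \<notin> outside_tree" using that(4) by (simp add: outside_tree_def)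
    then have "(p, s) \<noteq> e b" for b using e_out by metis
    then show ?thesis by (simp add: \<phi>_def that(3))
  qed
  have shift: "path_integral (\<phi> q v) (h \<cdot> p) w = path_integral (\<phi> (act q h) v) p w"
    if "h \<in> H" "p \<in> carrier F" "w \<in> carrier F" "q \<in> \<Omega>" for q v h p w
    by (rule path_integral_cong) (use that \<phi>_H Hc in blast)+
  have tree: "path_integral (\<phi> q v) [] u = 0" if "u \<in> carrier F" "rep u = u" for q v u
    using that
  proof (induction u rule: rev_induct)
    case (snoc a u)
    have u: "u \<in> carrier F" "rep u = u" and ac: "[a] \<in> carrier F" and aS: "snd a \<in> S"
      using carrier_snoc[OF snoc.prems(1)] rep_prefix[OF snoc.prems] by (auto simp: letter_carrier)
    have ua: "u @ [a] = u \<cdot> [a]" using snoc.prems by (simp add: foldr_snoc free_group_carrier)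
    have w0: "step_weight (\<phi> q v) u a = 0"
    proof (cases "fst a")
      case True
      then have a: "[a] = gen (snd a)" by (cases a) (simp add: gen_def)
      have "\<phi> q v u (snd a) = 0"
        by (rule \<phi>_tree[OF u(1) aS u(2)]) (rule snoc.prems(2)[unfolded ua, unfolded a])
      then show ?thesis using True by (simp add: step_weight_def)
    next
      case False
      then have a: "gen (snd a) = [flip a]" by (cases a) (simp add: gen_def flip_def)
      have "(u @ [a]) \<cdot> gen (snd a) = u" using mult_flip[OF u(1) aS] ua by (simp add: a)
      then have "\<phi> q v (u @ [a]) (snd a) = 0"
        by (intro \<phi>_tree[OF snoc.prems(1) aS snoc.prems(2)]) (simp only: u(2))
      then show ?thesis using False ua by (simp add: step_weight_def)
    qed
    have "path_integral (\<phi> q v) [] (u \<cdot> [a]) = path_integral (\<phi> q v) [] u + path_integral (\<phi> q v) ([] \<cdot> u) [a]"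
      by (rule path_integral_mult[OF Nc u(1) ac])
    then show ?case using w0 snoc.IH[OF u] ua by simp
  qed simp
  define D where "D = (\<lambda>v h q. path_integral (\<phi> q v) [] h)"
  have "cocycle (F\<lparr>carrier := H\<rparr>) \<Omega> act (D v)" for v
    unfolding cocycle_def
  proof (intro ballI)
    fix g h q assume "g \<in> carrier (F\<lparr>carrier := H\<rparr>)" "h \<in> carrier (F\<lparr>carrier := H\<rparr>)" and q: "q \<in> \<Omega>"
    then have gh: "g \<in> H" "h \<in> H" by auto
    have "path_integral (\<phi> q v) [] (g \<cdot> h) = path_integral (\<phi> q v) [] g + path_integral (\<phi> q v) ([] \<cdot> g) h"
      by (rule path_integral_mult[OF Nc Hc[OF gh(1)] Hc[OF gh(2)]])
    moreover have "path_integral (\<phi> q v) (g \<cdot> []) h = path_integral (\<phi> (act q g) v) [] h"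
      by (rule shift[OF gh(1) Nc Hc[OF gh(2)] q])
    ultimately show "D v (g \<otimes>\<^bsub>F\<lparr>carrier := H\<rparr>\<^esub> h) q = D v g q + D v h (act q g)"
      using F_right_one[OF Hc[OF gh(1)]] by (simp add: D_def)
  qed
  moreover have "linear_functional (\<lambda>v. D v h q)" for h q
    unfolding D_def by (rule path_integral_linear) (auto simp: \<phi>_def linear_functional_def)
  moreover have "v = (\<lambda>_. 0)" if v: "supported (UNIV \<times> \<Omega>) v" "\<And>h q. h \<in> H \<Longrightarrow> q \<in> \<Omega> \<Longrightarrow> D v h q = 0" for v
  proof -
    have "v (b, q') = 0" if q': "q' \<in> \<Omega>" for b q'
    proof -
      obtain p s where ps: "e b = (p, s)" by (cases "e b")
      have p: "p \<in> carrier F" "s \<in> S" "rep p = p" using outside_treeD e_out[of b] ps by auto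
      have gc: "gen s \<in> carrier F" using p(2) by (rule gen_in_free_group)
      define r where "r = rep (p \<cdot> gen s)"
      define h where "h = loop (p, s)"
      have pg: "p \<cdot> gen s \<in> carrier F" by (intro F.m_closed p gc)
      have r: "r \<in> carrier F" "rep r = r" using rep_closed[OF pg] rep_rep[OF pg] by (auto simp: r_def)
      have h: "h \<in> H" unfolding h_def by (rule loop_in_H[OF p(1,2)])
      \<comment> \<open>The base point for which the edge from \<open>p\<close> labelled
        \<open>s\<close> carries the value of \<open>v\<close> at \<open>q'\<close>.\<close>
      define q where "q = act q' (inv\<^bsub>F\<^esub> p)"
      have q: "q \<in> \<Omega>" "act q p = q'" unfolding q_def using q' p by (auto intro: act_closed act_inv)
      have hd: "h = p \<cdot> gen s \<cdot> inv\<^bsub>F\<^esub> r" by (simp only: h_def loop_def prod.case r_def)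
      have hr: "h \<cdot> r = p \<cdot> gen s"
        unfolding hd using pg r by (simp only: F.m_assoc[OF pg] F.inv_closed F.l_inv F.r_one)
      let ?I = "path_integral (\<phi> q v)"
      have "?I h (r \<cdot> inv\<^bsub>F\<^esub> r) = ?I h r + ?I (h \<cdot> r) (inv\<^bsub>F\<^esub> r)"
        by (rule path_integral_mult[OF Hc[OF h] r(1) F.inv_closed[OF r(1)]])
      moreover have "?I h (r \<cdot> inv\<^bsub>F\<^esub> r) = 0" unfolding F.r_inv[OF r(1)] by simp
      moreover have "?I (h \<cdot> []) r = path_integral (\<phi> (act q h) v) [] r" by (rule shift[OF h Nc r(1) q(1)])
      moreover have "h \<cdot> [] = h" using F_right_one[OF Hc[OF h]] by simp
      \<comment> \<open>The way back is the \<open>h\<close>-translate of the tree path to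
        \<open>r\<close>, run backwards. That path and its return cancel, and the path itself
        integrates to 0.\<close>
      ultimately have return: "?I (p \<cdot> gen s) (inv\<^bsub>F\<^esub> r) = 0" using tree[OF r] by (simp only: hr)
      have "?I [] h = ?I [] (p \<cdot> gen s) + ?I ([] \<cdot> (p \<cdot> gen s)) (inv\<^bsub>F\<^esub> r)"
        unfolding hd by (rule path_integral_mult[OF Nc pg F.inv_closed[OF r(1)]])
      also have "\<dots> = ?I [] (p \<cdot> gen s)" using return by simp
      also have "\<dots> = ?I [] p + ?I ([] \<cdot> p) (gen s)" by (rule path_integral_mult[OF Nc p(1) gc])
      also have "\<dots> = \<phi> q v p s" using tree[OF p(1,3)] by (simp add: gen_def step_weight_def)
      also have "\<dots> = v (b, q')"
        using ps p(3) q(2) e(2) by (cases b) (auto simp: \<phi>_def)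
      finally show ?thesis using v(2)[OF h q(1)] by (simp add: D_def)
    qed
    then show ?thesis using v(1) by (auto simp: supported_def fun_eq_iff)
  qed
  ultimately show ?thesis unfolding ample_def by (intro exI[of _ D]) auto
qed

section \<open>Free groups are residually finite\<close>

lemma partial_injection_extends:
  assumes "finite P" "D \<subseteq> P" "inj_on f D" "f ` D \<subseteq> P"
  obtains \<sigma> where "\<sigma> permutes P" "\<And>x. x \<in> D \<Longrightarrow> \<sigma> x = f x"
proof -
  have fD: "finite D" using assms finite_subset by blast
  then have "card (P - D) = card (P - f ` D)"
    using assms by (simp add: card_Diff_subset card_image)
  then obtain g where g: "bij_betw g (P - D) (P - f ` D)"
    using finite_same_card_bij[of "P - D" "P - f ` D"] assms(1) by auto
  define h where "h = (\<lambda>x. if x \<in> D then f x else g x)"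
  have "bij_betw h D (f ` D)" using assms(3) by (auto simp: h_def bij_betw_def inj_on_def)
  moreover have "bij_betw h (P - D) (P - f ` D)"
    using g by (rule bij_betw_cong[THEN iffD1, rotated]) (auto simp: h_def)
  ultimately have "bij_betw h (D \<union> (P - D)) (f ` D \<union> (P - f ` D))"
    by (rule bij_betw_combine) auto
  moreover have "D \<union> (P - D) = P" "f ` D \<union> (P - f ` D) = P" using assms by auto
  ultimately have h: "bij_betw h P P" by simp
  define \<sigma> where "\<sigma> = (\<lambda>x. if x \<in> P then h x else x)"
  have "\<sigma> permutes P"
  proof (rule bij_imp_permutes)
    show "bij_betw \<sigma> P P" using h by (rule bij_betw_cong[THEN iffD1, rotated]) (auto simp: \<sigma>_def)
  qed (auto simp: \<sigma>_def)
  moreover have "\<sigma> x = f x" if "x \<in> D" for x using that assms(2) by (auto simp: \<sigma>_def h_def)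
  ultimately show ?thesis using that by blast
qed

section \<open>Letters and words acting by permutations\<close>

definition letter_perm :: "('b \<Rightarrow> 'p \<Rightarrow> 'p) \<Rightarrow> bool \<times> 'b \<Rightarrow> 'p \<Rightarrow> 'p" where
  "letter_perm \<sigma> a = (if fst a then \<sigma> (snd a) else inv_into UNIV (\<sigma> (snd a)))"

definition word_perm :: "('b \<Rightarrow> 'p \<Rightarrow> 'p) \<Rightarrow> 'b word \<Rightarrow> 'p \<Rightarrow> 'p" where
  "word_perm \<sigma> w = foldr (\<lambda>a f. letter_perm \<sigma> a \<circ> f) w id"

lemma word_perm_simps [simp]: "word_perm \<sigma> [] = id" "word_perm \<sigma> (a # w) = letter_perm \<sigma> a \<circ> word_perm \<sigma> w"
  by (simp_all add: word_perm_def)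

context
  fixes \<sigma> :: "'b \<Rightarrow> 'p \<Rightarrow> 'p" and P
  assumes \<sigma>: "\<And>s. \<sigma> s permutes P"
begin

lemma letter_perm_permutes: "letter_perm \<sigma> a permutes P"
  using \<sigma> permutes_inv by (auto simp: letter_perm_def)

lemma letter_perm_flip: "letter_perm \<sigma> a \<circ> letter_perm \<sigma> (flip a) = id"
  using permutes_inv_o[OF \<sigma>[of "snd a"]] by (auto simp: letter_perm_def flip_def)

lemma word_perm_permutes: "word_perm \<sigma> w permutes P"
proof (induction w)
  case (Cons a w)
  then show ?case unfolding word_perm_simps by (rule permutes_compose[OF _ letter_perm_permutes])
qed (simp add: permutes_def)

lemma word_perm_reduced_cons: "word_perm \<sigma> (reduced_cons a w) = letter_perm \<sigma> a \<circ> word_perm \<sigma> w"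
proof (cases "\<exists>v. w = flip a # v")
  case True
  then obtain v where v: "w = flip a # v" by blast
  then show ?thesis using letter_perm_flip[of a] by (simp add: o_assoc)
next
  case False
  then have "reduced_cons a w = a # w" by (cases w) auto
  then show ?thesis by simp
qed

lemma word_perm_mult: "word_perm \<sigma> (foldr reduced_cons u w) = word_perm \<sigma> u \<circ> word_perm \<sigma> w"
  by (induction u) (simp_all add: word_perm_reduced_cons o_assoc)

lemma right_action_perms:
  assumes "finite P"
  shows "right_action (free_group S) {p. p permutes P} (\<lambda>p w. p \<circ> word_perm \<sigma> w)"
proof (intro right_action.intro group_free_group right_action_axioms.intro)
  show "finite {p. p permutes P}" using assms by (rule finite_permutations)
qed (auto simp: word_perm_mult o_assoc intro: permutes_compose word_perm_permutes)

end

lemma reduced_cons_inj: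
  assumes "reduced u" "reduced v" "reduced_cons a u = reduced_cons a v"
  shows "u = v"
  using reduced_cons_flip[OF assms(1), of "flip a"] reduced_cons_flip[OF assms(2), of "flip a"] assms(3) by simp

text \<open>Each generator becomes a permutation of the finite set \<open>P\<close> of suffixes,
  extending left multiplication wherever the result stays in \<open>P\<close>; a word
  \<open>w\<close> in \<open>W\<close> then carries [] to \<open>w\<close>. The points are the
  permutations of \<open>P\<close> rather than the elements of \<open>P\<close>: a permutation
  composed with \<open>q\<close> on the left gives \<open>q\<close> back only if it is the identity,
  so a single fixed point already forces \<open>w\<close> to be trivial.\<close>

theorem free_action_exists:
  fixes S :: "'b set"
  assumes W: "finite W" "W \<subseteq> carrier (free_group S)"
  shows "\<exists>(\<Omega> :: ('b word \<Rightarrow> 'b word) set) act. right_action (free_group S) \<Omega> act \<and> \<Omega> \<noteq> {} \<and>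
    (\<forall>w\<in>W. \<forall>q\<in>\<Omega>. act q w = q \<longrightarrow> w = [])"
proof -
  define P where "P = (\<Union>w\<in>insert [] W. (\<lambda>n. drop n w) ` {..length w})"
  have P: "finite P" using W by (simp add: P_def)
  have NilP: "[] \<in> P" by (auto simp: P_def)
  have WP: "w \<in> P" if "w \<in> W" for w using that by (auto simp: P_def intro!: bexI[of _ w] image_eqI[of _ _ 0])
  have tailP: "v \<in> P" if avP: "a # v \<in> P" for a v
  proof -
    obtain w n where w: "w \<in> insert [] W" "a # v = drop n w" using avP unfolding P_def by blast
    then have "n < length w" by (metis drop_all linorder_not_less list.discI)
    then have "v = drop (Suc n) w" "Suc n \<le> length w" using w(2) by (metis drop_Suc list.sel(3) tl_drop, simp)
    then show ?thesis using w(1) unfolding P_def by blast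
  qed
  have redP: "reduced v" if vP: "v \<in> P" for v
  proof -
    obtain w n where w: "w \<in> insert [] W" "v = drop n w" using vP unfolding P_def by blast
    have "reduced w" using w(1) W(2) by (auto simp: free_group_carrier reduced_def)
    then have "reduced (take n w @ drop n w)" by simp
    then show ?thesis unfolding reduced_def w(2) successively_append_iff by blast
  qed
  define D where "D = (\<lambda>s. {v \<in> P. reduced_cons (True, s) v \<in> P})"
  have "\<exists>\<tau>. \<tau> permutes P \<and> (\<forall>v\<in>D s. \<tau> v = reduced_cons (True, s) v)" for s
  proof (rule partial_injection_extends[OF P, of "D s" "reduced_cons (True, s)"])
    show "inj_on (reduced_cons (True, s)) (D s)"
      by (rule inj_onI, rule reduced_cons_inj) (use redP in \<open>auto simp: D_def\<close>)
  qed (auto simp: D_def)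
  then obtain \<sigma> where \<sigma>: "\<And>s. \<sigma> s permutes P" "\<And>s v. v \<in> D s \<Longrightarrow> \<sigma> s v = reduced_cons (True, s) v" by metis
  have wp: "word_perm \<sigma> w [] = w" if "w \<in> P" for w
    using that
  proof (induction w)
    case (Cons a w)
    have w: "w \<in> P" by (rule tailP[OF Cons.prems])
    have red: "reduced_cons a w = a # w" using redP[OF Cons.prems] by (cases w) (auto simp: reduced_def)
    have "letter_perm \<sigma> a w = a # w"
    proof (cases "fst a")
      case True
      then have "a = (True, snd a)" by (cases a) simp
      then have "w \<in> D (snd a)" using w red Cons.prems by (simp add: D_def)
      then show ?thesis using \<sigma>(2) red True \<open>a = (True, snd a)\<close> by (simp add: letter_perm_def)
    next
      case False
      then have a: "a = flip (True, snd a)" by (cases a) (simp add: flip_def)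
      then have "reduced_cons (True, snd a) (a # w) = w" by simp
      then have "\<sigma> (snd a) (a # w) = w" using \<sigma>(2) w Cons.prems by (simp add: D_def)
      then have "inv_into UNIV (\<sigma> (snd a)) w = a # w" using permutes_inv_eq[OF \<sigma>(1)] by blast
      then show ?thesis using False by (simp add: letter_perm_def)
    qed
    then show ?case using Cons.IH[OF w] by simp
  qed simp
  show ?thesis
  proof (rule exI[of _ "{p. p permutes P}"], rule exI[of _ "\<lambda>p w. p \<circ> word_perm \<sigma> w"], intro conjI ballI impI)
    show "right_action (free_group S) {p. p permutes P} (\<lambda>p w. p \<circ> word_perm \<sigma> w)"
      by (rule right_action_perms[OF \<sigma>(1) P])
    show "{p. p permutes P} \<noteq> {}" using permutes_id[of P] by blast
    fix w q assume w: "w \<in> W" and q: "q \<in> {p. p permutes P}" and eq: "q \<circ> word_perm \<sigma> w = q"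
    have "q w = q []" using fun_cong[OF eq, of "[]"] wp[OF WP[OF w]] by simp
    then show "w = []" using permutes_inj[of q P] q by (auto dest: injD)
  qed
qed

text \<open>Everything is pulled back along \<open>f\<close>. Its image is non-abelian because
  \<open>f\<close> separates the two products, and freeness on \<open>B\<close> needs that no other
  element of \<open>B\<close> shares the image of \<one>.\<close>

theorem ample_action_exists:
  fixes G (structure) and f :: "'a \<Rightarrow> 'b word"
  assumes G: "group G" and f: "f \<in> hom G (free_group S)" and B: "finite B" "B \<subseteq> carrier G"
    and inj: "inj_on f (insert \<one> B)"
    and xy: "x \<in> carrier G" "y \<in> carrier G" "f (x \<otimes> y) \<noteq> f (y \<otimes> x)"
  shows "\<exists>(\<Omega> :: ('b word \<Rightarrow> 'b word) set) act. right_action G \<Omega> act \<and> \<Omega> \<noteq> {} \<and>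
    (\<forall>g\<in>B. \<forall>q\<in>\<Omega>. act q g = q \<longrightarrow> g = \<one>) \<and> ample G \<Omega> act"
proof -
  interpret group G by (rule G)
  interpret F: group "free_group S" by (rule group_free_group)
  interpret f: group_hom G "free_group S" f by unfold_locales (rule f)
  have "f ` B \<subseteq> carrier (free_group S)" using B f.hom_closed by blast
  then have "\<exists>(\<Omega> :: ('b word \<Rightarrow> 'b word) set) act. right_action (free_group S) \<Omega> act \<and> \<Omega> \<noteq> {} \<and>
      (\<forall>w\<in>f ` B. \<forall>q\<in>\<Omega>. act q w = q \<longrightarrow> w = [])"
    by (intro free_action_exists finite_imageI B(1))
  then obtain \<Omega> :: "('b word \<Rightarrow> 'b word) set" and act where
    act: "right_action (free_group S) \<Omega> act \<and> \<Omega> \<noteq> {} \<and> (\<forall>w\<in>f ` B. \<forall>q\<in>\<Omega>. act q w = q \<longrightarrow> w = [])"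
    by (elim exE) (rule that)
  interpret F: right_action "free_group S" \<Omega> act using act by simp
  have H: "subgroup (f ` carrier G) (free_group S)" by (rule f.img_is_subgroup)
  have "ample ((free_group S)\<lparr>carrier := f ` carrier G\<rparr>) \<Omega> act"
    by (rule ample_subgroup[OF F.right_action_axioms H, of "f x" "f y"])
      (use xy f.hom_mult in \<open>auto simp del: free_group_simps\<close>)
  then obtain D :: "(bool \<times> ('b word \<Rightarrow> 'b word) \<Rightarrow> real) \<Rightarrow> 'b word \<Rightarrow> ('b word \<Rightarrow> 'b word) \<Rightarrow> real" where
    D0: "(\<forall>v. cocycle ((free_group S)\<lparr>carrier := f ` carrier G\<rparr>) \<Omega> act (D v)) \<and> (\<forall>g q. linear_functional (\<lambda>v. D v g q)) \<and>
     (\<forall>v. supported (UNIV \<times> \<Omega>) v \<longrightarrow> (\<forall>g\<in>carrier ((free_group S)\<lparr>carrier := f ` carrier G\<rparr>). \<forall>q\<in>\<Omega>. D v g q = 0) \<longrightarrow> v = (\<lambda>_. 0))"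
    unfolding ample_def by (elim exE) (rule that)
  have "right_action G \<Omega> (\<lambda>q g. act q (f g))"
    by unfold_locales (use F.finite_points F.act_closed F.act_one F.act_mult in \<open>auto simp del: free_group_simps\<close>)
  moreover have "g = \<one>" if "g \<in> B" "q \<in> \<Omega>" "act q (f g) = q" for g q
  proof -
    have "f g = f \<one>" using act that f.hom_one by auto
    from inj_onD[OF inj this] show ?thesis using that(1) by blast
  qed
  moreover have "ample G \<Omega> (\<lambda>q g. act q (f g))"
    unfolding ample_def
  proof (intro exI[of _ "\<lambda>v g q. D v (f g) q"] conjI allI impI)
    fix v
    have c: "cocycle ((free_group S)\<lparr>carrier := f ` carrier G\<rparr>) \<Omega> act (D v)" using D0 by blast
    show "cocycle G \<Omega> (\<lambda>q g. act q (f g)) (\<lambda>g q. D v (f g) q)"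
      using c unfolding cocycle_def by (auto simp del: free_group_simps)
    show "linear_functional (\<lambda>v. D v (f g) q)" for g q using D0 by blast
    assume "supported (UNIV \<times> \<Omega>) v" "\<forall>g\<in>carrier G. \<forall>q\<in>\<Omega>. D v (f g) q = 0"
    then show "v = (\<lambda>_. 0)" using D0 by simp
  qed
  ultimately show ?thesis using act by blast
qed

section \<open>Approximating real characters by integral ones\<close>

lemma common_denominator:
  assumes "finite (Q :: rat set)"
  obtains D :: int where "D > 0" "\<And>r. r \<in> Q \<Longrightarrow> of_rat r * real_of_int D \<in> \<int>"
proof -
  have "\<exists>D::int. D > 0 \<and> (\<forall>r\<in>Q. of_rat r * real_of_int D \<in> \<int>)"
    using assms
  proof induction
    case empty
    then show ?case by (intro exI[of _ 1]) simp
  next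
    case (insert r Q)
    then obtain D :: int where D: "D > 0" "\<forall>r\<in>Q. of_rat r * real_of_int D \<in> \<int>" by blast
    obtain a b where r: "quotient_of r = (a, b)" by (cases "quotient_of r")
    then have b: "b > 0" and rab: "r = of_int a / of_int b"
      using quotient_of_denom_pos quotient_of_div by blast+
    have "of_rat r * real_of_int (D * b) = real_of_int (a * D)"
      using b by (simp add: rab of_rat_divide)
    then have "of_rat r * real_of_int (D * b) \<in> \<int>" by (metis Ints_of_int)
    moreover have "of_rat x * real_of_int (D * b) \<in> \<int>" if "x \<in> Q" for x
      using Ints_mult[of "of_rat x * real_of_int D" "real_of_int b"] D(2) that by (simp add: mult.assoc)
    ultimately show ?case using D(1) b by (intro exI[of _ "D * b"]) auto
  qed
  then show ?thesis using that by blast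
qed

text \<open>\<open>\<theta>'\<close> is the linear map over the rationals that sends each element b
  of a basis of the reals to the floor of n b. At a it differs from n a by at most the sum
  \<open>K a\<close> of the absolute coordinates, so n > K a / a preserves positivity. Its values on
  \<open>A\<close> are rational, and \<open>D\<close> clears their denominators. As
  \<open>\<theta>\<close> is additive on all reals, its composite with a character is again a
  homomorphism.\<close>

lemma integer_grading:
  fixes A :: "real set"
  assumes A: "finite A"
  obtains \<theta> :: "real \<Rightarrow> real" where "\<And>x y. \<theta> (x + y) = \<theta> x + \<theta> y"
    "\<And>a. a \<in> A \<Longrightarrow> \<theta> a \<in> \<int>" "\<And>a. a \<in> A \<Longrightarrow> 0 < a \<Longrightarrow> 0 < \<theta> a"
proof -
  interpret R: vector_space "\<lambda>(q :: rat) (x :: real). of_rat q * x"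
    by unfold_locales (auto simp: algebra_simps of_rat_add of_rat_mult)
  interpret RR: vector_space_pair "\<lambda>(q :: rat) (x :: real). of_rat q * x" "\<lambda>(q :: rat) (x :: real). of_rat q * x" ..
  define B where "B = R.extend_basis {}"
  have B: "R.independent B" "R.span B = UNIV"
    unfolding B_def using R.independent_extend_basis[of "{}"] R.span_extend_basis[of "{}"] R.independent_empty by auto
  define r where "r = R.representation B"
  define T where "T = (\<lambda>a. {b. r a b \<noteq> 0})"
  have T: "finite (T a)" "T a \<subseteq> B" for a
    unfolding T_def r_def using R.finite_representation R.representation_ne_zero by auto
  have exp: "(\<Sum>b\<in>T a. of_rat (r a b) * b) = a" for a
    unfolding T_def r_def using R.sum_nonzero_representation_eq[OF B(1)] B(2) by auto
  define K where "K = (\<lambda>a. \<Sum>b\<in>T a. \<bar>of_rat (r a b) :: real\<bar>)"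
  obtain n :: nat where n: "\<And>a. a \<in> A \<Longrightarrow> 0 < a \<Longrightarrow> K a / a < real n"
  proof -
    obtain n :: nat where "Max (insert 0 ((\<lambda>a. K a / a) ` A)) < real n" using reals_Archimedean2 by blast
    then have "K a / a < real n" if "a \<in> A" for a using A that by (simp add: Max_less_iff)
    then show ?thesis using that by blast
  qed
  define \<beta> where "\<beta> = (\<lambda>b. real_of_int \<lfloor>real n * b\<rfloor>)"
  define \<theta>' where "\<theta>' = RR.construct B \<beta>"
  have lin: "Vector_Spaces.linear (\<lambda>(q :: rat) (x :: real). of_rat q * x) (\<lambda>(q :: rat) (x :: real). of_rat q * x) \<theta>'"
    unfolding \<theta>'_def by (rule RR.linear_construct[OF B(1)])
  interpret L: Vector_Spaces.linear "\<lambda>(q :: rat) (x :: real). of_rat q * x" "\<lambda>(q :: rat) (x :: real). of_rat q * x" \<theta>'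
    by (rule lin)
  have basis: "\<theta>' b = \<beta> b" if "b \<in> B" for b unfolding \<theta>'_def using RR.construct_basis[OF B(1) that] .
  have \<theta>'_exp: "\<theta>' a = (\<Sum>b\<in>T a. of_rat (r a b) * \<beta> b)" for a
  proof -
    have "\<theta>' a = \<theta>' (\<Sum>b\<in>T a. of_rat (r a b) * b)" by (simp only: exp)
    also have "\<dots> = (\<Sum>b\<in>T a. of_rat (r a b) * \<theta>' b)" by (simp only: L.sum L.scale)
    also have "\<dots> = (\<Sum>b\<in>T a. of_rat (r a b) * \<beta> b)" using T(2) basis by (intro sum.cong) auto
    finally show ?thesis .
  qed
  have pos: "0 < \<theta>' a" if a: "a \<in> A" "0 < a" for a
  proof -
    have "\<bar>\<beta> b - real n * b\<bar> \<le> 1" for b unfolding \<beta>_def by linarith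
    then have "\<bar>of_rat (r a b) * (\<beta> b - real n * b)\<bar> \<le> \<bar>of_rat (r a b)\<bar>" for b
      unfolding abs_mult by (metis abs_ge_zero mult.right_neutral mult_left_mono)
    then have "\<bar>\<Sum>b\<in>T a. of_rat (r a b) * (\<beta> b - real n * b)\<bar> \<le> K a"
      unfolding K_def by (intro order_trans[OF sum_abs] sum_mono)
    moreover have "(\<Sum>b\<in>T a. of_rat (r a b) * (\<beta> b - real n * b)) = \<theta>' a - real n * a"
    proof -
      have "(\<Sum>b\<in>T a. of_rat (r a b) * (\<beta> b - real n * b)) =
          (\<Sum>b\<in>T a. of_rat (r a b) * \<beta> b) - real n * (\<Sum>b\<in>T a. of_rat (r a b) * b)"
        by (simp add: right_diff_distrib sum_subtractf sum_distrib_left algebra_simps)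
      then show ?thesis by (simp only: exp \<theta>'_exp)
    qed
    moreover have "K a < real n * a" using n[OF a] a(2) by (simp add: pos_divide_less_eq)
    ultimately show ?thesis by linarith
  qed
  have "finite (\<Union>a\<in>A. r a ` T a)" using A T(1) by auto
  then obtain D :: int where D: "D > 0" "\<And>q. q \<in> (\<Union>a\<in>A. r a ` T a) \<Longrightarrow> of_rat q * real_of_int D \<in> \<int>"
    using common_denominator by blast
  have int: "real_of_int D * \<theta>' a \<in> \<int>" if "a \<in> A" for a
  proof -
    have "real_of_int D * \<theta>' a = (\<Sum>b\<in>T a. (of_rat (r a b) * real_of_int D) * \<beta> b)"
      by (simp add: \<theta>'_exp sum_distrib_left algebra_simps)
    also have "\<dots> \<in> \<int>" 
      by (rule Ints_sum, rule Ints_mult, rule D(2)) (use that in \<open>auto simp: \<beta>_def\<close>)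
    finally show ?thesis .
  qed
  show ?thesis
    by (rule that[of "\<lambda>x. real_of_int D * \<theta>' x"]) (use int pos D(1) in \<open>auto simp: L.add distrib_left\<close>)
qed

section \<open>Connectedness in the nonnegative half of the Cayley graph\<close>

definition nonneg_steps :: "('a, 'm) monoid_scheme \<Rightarrow> 'a set \<Rightarrow> ('a \<Rightarrow> real) \<Rightarrow> ('a \<times> 'a) set" where
  "nonneg_steps H X \<chi> = {(g, h). g \<in> nonneg_part H \<chi> \<and> h \<in> nonneg_part H \<chi> \<and>
     (\<exists>x\<in>X. h = g \<otimes>\<^bsub>H\<^esub> x \<or> g = h \<otimes>\<^bsub>H\<^esub> x)}"

definition nonneg_connected :: "('a, 'm) monoid_scheme \<Rightarrow> 'a set \<Rightarrow> ('a \<Rightarrow> real) \<Rightarrow> bool" where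
  "nonneg_connected H X \<chi> \<longleftrightarrow> (\<forall>h\<in>nonneg_part H \<chi>. (\<one>\<^bsub>H\<^esub>, h) \<in> (nonneg_steps H X \<chi>)\<^sup>*)"

lemma nonneg_steps_sym: "sym (nonneg_steps H X \<chi>)"
  by (auto simp: sym_def nonneg_steps_def)

locale real_character = group G for G (structure) +
  fixes \<chi> :: "'a \<Rightarrow> real"
  assumes char_mult: "g \<in> carrier G \<Longrightarrow> h \<in> carrier G \<Longrightarrow> \<chi> (g \<otimes> h) = \<chi> g + \<chi> h"
begin

lemma char_one [simp]: "\<chi> \<one> = 0"
  using char_mult[OF one_closed one_closed] by simp

lemma char_inv: "g \<in> carrier G \<Longrightarrow> \<chi> (inv g) = - \<chi> g"
  using char_mult[of "inv g" g] by simp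

text \<open>The steps are symmetric, so it is enough to connect every vertex with the
  identity.\<close>

lemma connected_iff:
  assumes X: "X \<subseteq> carrier G"
  shows "Digraph_Component.connected (cayley_graph G X \<restriction> nonneg_part G \<chi>) \<longleftrightarrow> nonneg_connected G X \<chi>"
proof -
  let ?V = "nonneg_part G \<chi>" and ?R = "nonneg_steps G X \<chi>"
  let ?M = "mk_symmetric (cayley_graph G X \<restriction> ?V)"
  have arcs: "arcs_ends (with_proj ?M) = ?R"
    using X by (auto simp: mk_symmetric_def cayley_graph_def induce_subgraph_def nonneg_steps_def nonneg_part_def
        arcs_ends_def arc_to_ends_def)
  have verts: "verts (with_proj ?M) = ?V" by (simp add: cayley_graph_def)
  have reach: "u \<rightarrow>\<^sup>*\<^bsub>with_proj ?M\<^esub> v \<longleftrightarrow> (u, v) \<in> ?R\<^sup>*" if "u \<in> ?V" for u v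
    unfolding reachable_def arcs verts
  proof
    assume "(u, v) \<in> ?R\<^sup>*"
    then show "(u, v) \<in> rtrancl_on ?V ?R"
      using that by (induction rule: rtrancl_induct) (auto intro: rtrancl_on_into_rtrancl_on simp: nonneg_steps_def)
  qed (rule rtrancl_on_rtranclI)
  have one: "\<one> \<in> ?V" by (simp add: nonneg_part_def)
  have "strongly_connected (with_proj ?M) \<longleftrightarrow> (\<forall>u\<in>?V. \<forall>v\<in>?V. (u, v) \<in> ?R\<^sup>*)"
    unfolding strongly_connected_def verts using one reach by blast
  also have "\<dots> \<longleftrightarrow> nonneg_connected G X \<chi>"
    unfolding nonneg_connected_def using one nonneg_steps_sym[of G X \<chi>]
    by (meson rtrancl_trans sym_rtrancl symD)
  finally show ?thesis by (simp add: Digraph_Component.connected_def)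
qed

lemma char_zero_generate:
  assumes X: "X \<subseteq> carrier G" "generate G X = carrier G" and g: "g \<in> carrier G" and 0: "\<And>x. x \<in> X \<Longrightarrow> \<chi> x = 0"
  shows "\<chi> g = 0"
proof -
  have "g \<in> generate G X" using g X by simp
  then show ?thesis
  proof induction
    case (inv h)
    then show ?case using 0 char_inv X(1) by auto
  next
    case (eng h1 h2)
    then show ?case using char_mult X(2) by simp
  qed (use 0 in auto)
qed

lemma positive_letter:
  assumes X: "X \<subseteq> carrier G" "generate G X = carrier G" and nz: "g0 \<in> carrier G" "\<chi> g0 \<noteq> 0"
  obtains t where "t \<in> carrier G" "t \<in> X \<or> inv t \<in> X" "0 < \<chi> t"
proof -
  obtain x where x: "x \<in> X" "\<chi> x \<noteq> 0" using char_zero_generate[OF X nz(1)] nz(2) by blast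
  show ?thesis
  proof (cases "0 < \<chi> x")
    case True
    then show ?thesis using that[of x] x X by auto
  next
    case False
    then show ?thesis using that[of "inv x"] x X char_inv[of x] by auto
  qed
qed

text \<open>Fox calculus along a path: a step from g to g y adds the value of d y at
  \<open>act q g\<close>, and a step back along y subtracts its value at the end point of the step.
  All group elements that occur are vertices of the path, hence nonnegative.\<close>

lemma path_moves:
  assumes Y: "Y \<subseteq> carrier G" and steps: "\<forall>x\<in>X. x \<in> Y \<or> inv x \<in> Y" and X: "X \<subseteq> carrier G"
    and path: "(\<one>, e) \<in> (nonneg_steps G X \<chi>)\<^sup>*"
  shows "\<exists>ms. (\<forall>(c, g, z)\<in>set ms. g \<in> nonneg_part G \<chi> \<and> z \<in> Y) \<and>
    (\<forall>(\<Omega> :: 'w set) act d q. right_action G \<Omega> act \<longrightarrow> cocycle G \<Omega> act d \<longrightarrow> q \<in> \<Omega> \<longrightarrow>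
      d e q = (\<Sum>(c, g, z)\<leftarrow>ms. c * d z (act q g)))"
  using path
proof (induction rule: rtrancl_induct)
  case base
  then show ?case by (intro exI[of _ "[]"]) (auto simp: right_action.cocycle_one)
next
  case (step g h)
  obtain ms where ms: "\<forall>(c, g, z)\<in>set ms. g \<in> nonneg_part G \<chi> \<and> z \<in> Y"
    "\<And>(\<Omega> :: 'w set) act d q. right_action G \<Omega> act \<Longrightarrow> cocycle G \<Omega> act d \<Longrightarrow> q \<in> \<Omega> \<Longrightarrow>
      d g q = (\<Sum>(c, g, z)\<leftarrow>ms. c * d z (act q g))"
    using step.IH by blast
  have gh: "g \<in> nonneg_part G \<chi>" "h \<in> nonneg_part G \<chi>" "g \<in> carrier G" "h \<in> carrier G"
    using step.hyps by (auto simp: nonneg_steps_def nonneg_part_def)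
  obtain x where x: "x \<in> X" "h = g \<otimes> x \<or> g = h \<otimes> x" using step.hyps by (auto simp: nonneg_steps_def)
  have "\<exists>y\<in>Y. h = g \<otimes> y \<or> g = h \<otimes> y"
  proof (cases "x \<in> Y")
    case True
    then show ?thesis using x by blast
  next
    case False
    then have "inv x \<in> Y" using steps x by blast
    moreover have "g = h \<otimes> inv x \<or> h = g \<otimes> inv x" using x X gh by (auto simp: m_assoc)
    ultimately show ?thesis by blast
  qed
  then consider y where "y \<in> Y" "h = g \<otimes> y" | y where "y \<in> Y" "g = h \<otimes> y" by blast
  then show ?case
  proof cases
    case 1
    have "d h q = (\<Sum>(c, g, z)\<leftarrow>ms @ [(1, g, y)]. c * d z (act q g))"
      if "right_action G \<Omega> act" "cocycle G \<Omega> act d" "q \<in> \<Omega>" for \<Omega> :: "'w set" and act d q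
    proof -
      have "d h q = d g q + d y (act q g)" using that 1 gh Y unfolding cocycle_def by blast
      then show ?thesis using ms(2)[OF that] by simp
    qed
    then show ?thesis using ms(1) gh 1 by (intro exI[of _ "ms @ [(1, g, y)]"]) auto
  next
    case 2
    have "d h q = (\<Sum>(c, g, z)\<leftarrow>ms @ [(- 1, h, y)]. c * d z (act q g))"
      if "right_action G \<Omega> act" "cocycle G \<Omega> act d" "q \<in> \<Omega>" for \<Omega> :: "'w set" and act d q
    proof -
      have "d g q = d h q + d y (act q h)" using that 2 gh Y unfolding cocycle_def by blast
      then show ?thesis using ms(2)[OF that] by simp
    qed
    then show ?thesis using ms(1) gh 2 by (intro exI[of _ "ms @ [(- 1, h, y)]"]) auto
  qed
qed

end

theorem limit_group_not_connected:
  fixes G (structure)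
  assumes lim: "limit_group TYPE('b) G" and nc: "\<not> comm_group G"
    and X: "finite_generating_set G X" and \<psi>: "real_character G \<psi>" and nz: "g0 \<in> carrier G" "\<psi> g0 \<noteq> 0"
  shows "\<not> nonneg_connected G X \<psi>"
proof
  assume con: "nonneg_connected G X \<psi>"
  interpret real_character G \<psi> by (rule \<psi>)
  have Xc: "finite X" "X \<subseteq> carrier G" "generate G X = carrier G" using X by (auto simp: finite_generating_set_def)
  \<comment> \<open>Generators are oriented so that \<open>\<psi>\<close> is nonnegative on them;
    then so it is on their conjugates by \<open>t\<close>, which connectedness can reach.\<close>
  define Y where "Y = {x \<in> X \<union> m_inv G ` X. 0 \<le> \<psi> x}"
  have Yf: "finite Y" and Yc: "Y \<subseteq> carrier G" using Xc by (auto simp: Y_def)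
  have XY: "\<forall>x\<in>X. x \<in> Y \<or> inv x \<in> Y"
    using Xc char_inv by (force simp: Y_def)
  obtain ys where ys: "set ys = Y" "distinct ys" using finite_distinct_list[OF Yf] by blast
  have gen: "generate G Y = carrier G"
  proof
    show "generate G Y \<subseteq> carrier G" by (rule generate_incl[OF Yc])
    have "X \<subseteq> generate G Y"
    proof
      fix x assume x: "x \<in> X"
      then have "x \<in> Y \<or> inv (inv x) = x \<and> inv x \<in> Y" using XY Xc by auto
      then show "x \<in> generate G Y" by (metis generate.incl generate.inv)
    qed
    then show "carrier G \<subseteq> generate G Y" using Xc(3) generate_subgroup_incl[OF _ generate_is_subgroup[OF Yc]] by metis
  qed
  obtain t where t: "t \<in> Y" "0 < \<psi> t"
  proof (rule positive_letter[OF Xc(2,3) nz])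
    fix t assume "t \<in> carrier G" "t \<in> X \<or> inv t \<in> X" "0 < \<psi> t"
    moreover from this have "inv t \<in> X \<Longrightarrow> t \<in> m_inv G ` X" by (metis image_eqI inv_inv)
    ultimately show ?thesis using that[of t] by (auto simp: Y_def)
  qed
  have tc: "t \<in> carrier G" using t Yc by blast
  define good where "good = (\<lambda>x ms. (\<forall>(c, g, z)\<in>set ms. g \<in> carrier G \<and> 0 < \<psi> g \<and> z \<in> Y) \<and>
    (\<forall>(\<Omega> :: ('b word \<Rightarrow> 'b word) set) act d q. right_action G \<Omega> act \<longrightarrow> cocycle G \<Omega> act d \<longrightarrow> (\<forall>q\<in>\<Omega>. d t q = 0) \<longrightarrow> q \<in> \<Omega> \<longrightarrow>
      d x q = (\<Sum>(c, g, z)\<leftarrow>ms. c * d z (act q g))))"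
  have "\<exists>ms. good x ms" if x: "x \<in> Y" for x
  proof -
    have xc: "x \<in> carrier G" using x Yc by blast
    \<comment> \<open>The path from \<one> to \<open>e\<close>, translated by \<open>t\<close>,
      leads from \<open>t\<close> to x t. All its vertices have degree at least that of
      \<open>t\<close>, so the terms obtained have positive degree even if
      \<open>\<psi> x = 0\<close>.\<close>
    define e where "e = inv t \<otimes> x \<otimes> t"
    have ec: "e \<in> carrier G" using xc tc by (simp add: e_def)
    have "\<psi> e = \<psi> x" using xc tc by (simp add: e_def char_mult char_inv)
    then have "e \<in> nonneg_part G \<psi>" using ec x by (simp add: nonneg_part_def Y_def)
    then have path: "(\<one>, e) \<in> (nonneg_steps G X \<psi>)\<^sup>*" using con by (simp add: nonneg_connected_def)
    obtain ms where ms1: "\<forall>(c, g, z)\<in>set ms. g \<in> nonneg_part G \<psi> \<and> z \<in> Y"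
      and ms2: "\<forall>(\<Omega> :: ('b word \<Rightarrow> 'b word) set) act d q. right_action G \<Omega> act \<longrightarrow> cocycle G \<Omega> act d \<longrightarrow> q \<in> \<Omega> \<longrightarrow>
        d e q = (\<Sum>(c, g, z)\<leftarrow>ms. c * d z (act q g))"
      using path_moves[OF Yc XY Xc(2) path] by (elim exE conjE) (rule that)
    let ?ms = "map (\<lambda>(c, g, z). (c, t \<otimes> g, z)) ms"
    have "d x q = (\<Sum>(c, g, z)\<leftarrow>?ms. c * d z (act q g))"
      if act: "right_action G \<Omega> act" and d: "cocycle G \<Omega> act d" and dt: "\<forall>q\<in>\<Omega>. d t q = 0" and q: "q \<in> \<Omega>"
      for \<Omega> :: "('b word \<Rightarrow> 'b word) set" and act d q
    proof -
      interpret right_action G \<Omega> act by (rule act)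
      have "x \<otimes> t = t \<otimes> e" using xc tc by (simp add: e_def m_assoc[symmetric])
      then have "d x q + d t (act q x) = d t q + d e (act q t)"
        using d xc tc ec q unfolding cocycle_def by metis
      then have "d x q = d e (act q t)" using dt q xc by (simp add: act_closed)
      also have "\<dots> = (\<Sum>(c, g, z)\<leftarrow>ms. c * d z (act (act q t) g))" using ms2 act d act_closed[OF q tc] by blast
      also have "\<dots> = (\<Sum>(c, g, z)\<leftarrow>ms. c * d z (act q (t \<otimes> g)))"
        by (rule arg_cong[of _ _ sum_list], rule map_cong[OF refl])
          (use ms1 act_mult[OF q tc] in \<open>auto simp: nonneg_part_def\<close>)
      finally show ?thesis by (simp add: comp_def case_prod_beta')
    qed
    moreover have "\<forall>(c, g, z)\<in>set ?ms. g \<in> carrier G \<and> 0 < \<psi> g \<and> z \<in> Y"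
      using ms1 t tc by (auto simp: nonneg_part_def char_mult add_pos_nonneg)
    ultimately have "good x ?ms" unfolding good_def by blast
    then show ?thesis by blast
  qed
  then obtain L where good: "\<And>x. x \<in> Y \<Longrightarrow> good x (L x)" by metis
  have L: "\<forall>(c, g, z)\<in>set (L x). g \<in> carrier G \<and> 0 < \<psi> g \<and> z \<in> Y" if "x \<in> Y" for x
    using good[OF that] by (simp add: good_def)
  define E where "E = (\<Union>x\<in>Y. (\<lambda>(c, g, z). g) ` set (L x))"
  have inE: "g \<in> E" if "x \<in> Y" "(c, g, z) \<in> set (L x)" for x c g z using that unfolding E_def by force
  have Ef: "finite E" using Yf by (simp add: E_def)
  \<comment> \<open>\<open>E\<close> is included for positivity and \<open>X\<close> for
    integrality: integer values on generators give integer values on all of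
    \<open>G\<close>.\<close>
  obtain \<theta>' :: "real \<Rightarrow> real" where \<theta>': "\<And>x y. \<theta>' (x + y) = \<theta>' x + \<theta>' y"
    "\<And>a. a \<in> \<psi> ` (X \<union> E) \<Longrightarrow> \<theta>' a \<in> \<int>" "\<And>a. a \<in> \<psi> ` (X \<union> E) \<Longrightarrow> 0 < a \<Longrightarrow> 0 < \<theta>' a"
    using integer_grading[of "\<psi> ` (X \<union> E)"] Xc(1) Ef by blast
  interpret \<theta>': real_character G "\<lambda>g. \<theta>' (\<psi> g)"
    by unfold_locales (simp add: char_mult \<theta>'(1))
  have int: "\<theta>' (\<psi> g) \<in> \<int>" if "g \<in> carrier G" for g
  proof -
    have "g \<in> generate G X" using that Xc by simp
    then show ?thesis
    proof induction
      case (inv h)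
      then show ?case using \<theta>'.char_inv[of h] \<theta>'(2)[of "\<psi> h"] Xc(2) by auto
    next
      case (eng h1 h2)
      then show ?case using \<theta>'.char_mult Xc(3) by simp
    qed (use \<theta>'(2) \<theta>'.char_one in auto)
  qed
  define \<theta> where "\<theta> = (\<lambda>g. \<lfloor>\<theta>' (\<psi> g)\<rfloor>)"
  have \<theta>: "real_of_int (\<theta> g) = \<theta>' (\<psi> g)" if "g \<in> carrier G" for g using int[OF that] by (simp add: \<theta>_def)
  have F: "group G" "fully_residually_free TYPE('b) G" using lim by (auto simp: limit_group_def)
  obtain x y where xy: "x \<in> carrier G" "y \<in> carrier G" "x \<otimes> y \<noteq> y \<otimes> x"
    using nc group_comm_groupI by metis
  show False
  proof (rule no_ample_actions[where G = G and ys = ys and L = L and t = t and \<theta> = \<theta>])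
    show "moves_ok G ys L" using L ys by (fastforce simp: moves_ok_def)
    show "\<theta> (g \<otimes> h) = \<theta> g + \<theta> h" if "g \<in> carrier G" "h \<in> carrier G" for g h
    proof -
      have "real_of_int (\<theta> (g \<otimes> h)) = real_of_int (\<theta> g + \<theta> h)" using that \<theta> \<theta>'.char_mult by simp
      then show ?thesis by linarith
    qed
    show "0 < \<theta> g" if "x \<in> set ys" "(c, g, z) \<in> set (L x)" for x c g z
    proof -
      have g: "g \<in> carrier G" "0 < \<psi> g" "g \<in> E" using L[of x] inE that ys by auto
      then have "0 < \<theta>' (\<psi> g)" using \<theta>'(3) by blast
      then show ?thesis using \<theta>[OF g(1)] by linarith
    qed
    fix B :: "'a set" assume B: "finite B" "B \<subseteq> carrier G"
    define C where "C = insert \<one> (insert (x \<otimes> y) (insert (y \<otimes> x) B))"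
    have "finite C \<and> C \<subseteq> carrier G" using B xy by (auto simp: C_def)
    moreover have "finite C \<and> C \<subseteq> carrier G \<longrightarrow> (\<exists>(S :: 'b set) f. f \<in> hom G (free_group S) \<and> inj_on f C)"
      using F(2) unfolding fully_residually_free_def by (rule spec)
    ultimately have "\<exists>(S :: 'b set) f. f \<in> hom G (free_group S) \<and> inj_on f C" by (rule rev_mp)
    then obtain S :: "'b set" and f where f: "f \<in> hom G (free_group S)" "inj_on f C"
      by (elim exE conjE) (rule that)
    show "\<exists>(\<Omega> :: ('b word \<Rightarrow> 'b word) set) act. right_action G \<Omega> act \<and> \<Omega> \<noteq> {} \<and>
      (\<forall>g\<in>B. \<forall>q\<in>\<Omega>. act q g = q \<longrightarrow> g = \<one>) \<and> ample G \<Omega> act"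
    proof (rule ample_action_exists[OF F(1) f(1) B])
      show "inj_on f (insert \<one> B)" by (rule inj_on_subset[OF f(2)]) (auto simp: C_def)
      show "f (x \<otimes> y) \<noteq> f (y \<otimes> x)" using inj_onD[OF f(2), of "x \<otimes> y" "y \<otimes> x"] xy(3) unfolding C_def by blast
    qed (rule xy)+
  next
    fix \<Omega> :: "('b word \<Rightarrow> 'b word) set" and act d x q
    assume "right_action G \<Omega> act" "cocycle G \<Omega> act d" "\<And>q. q \<in> \<Omega> \<Longrightarrow> d t q = 0" "x \<in> set ys" "q \<in> \<Omega>"
    then show "d x q = (\<Sum>(c, g, z)\<leftarrow>L x. c * d z (act q g))" using good[of x] ys unfolding good_def by blast
  qed (use F ys gen t Yc in auto)
qed

section \<open>Moving in the nonnegative half\<close>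

context real_character
begin

abbreviation reach where "reach X \<equiv> (nonneg_steps G X \<chi>)\<^sup>*"

lemma one_nonneg: "\<one> \<in> nonneg_part G \<chi>"
  by (simp add: nonneg_part_def)

lemma nonneg_steps_rtrancl_sym: "(g, h) \<in> reach X \<Longrightarrow> (h, g) \<in> reach X"
  using sym_rtrancl[OF nonneg_steps_sym] by (rule symD)

lemma nonneg_reach: "(g, h) \<in> reach X \<Longrightarrow> g \<in> nonneg_part G \<chi> \<Longrightarrow> h \<in> nonneg_part G \<chi>"
  by (induction rule: rtrancl_induct) (auto simp: nonneg_steps_def)

lemma letter_step:
  assumes "X \<subseteq> carrier G" "g \<in> nonneg_part G \<chi>" "x \<in> carrier G" "x \<in> X \<or> inv x \<in> X" "0 \<le> \<chi> (g \<otimes> x)"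
  shows "(g, g \<otimes> x) \<in> reach X"
proof -
  have g: "g \<in> carrier G" using assms by (simp add: nonneg_part_def)
  then have "g = (g \<otimes> x) \<otimes> inv x" using assms by (simp add: m_assoc)
  then have "(g, g \<otimes> x) \<in> nonneg_steps G X \<chi>"
    using assms g unfolding nonneg_steps_def by (auto simp: nonneg_part_def)
  then show ?thesis by blast
qed

lemma char_pow: "g \<in> carrier G \<Longrightarrow> \<chi> (g [^] (k :: nat)) = k * \<chi> g"
  by (induction k) (auto simp: char_mult algebra_simps)

lemma power_path:
  assumes "g \<in> nonneg_part G \<chi>" "x \<in> carrier G" "0 \<le> \<chi> x"
    and step: "\<And>h. h \<in> nonneg_part G \<chi> \<Longrightarrow> (h, h \<otimes> x) \<in> reach X"
  shows "(g, g \<otimes> x [^] (k :: nat)) \<in> reach X"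
proof (induction k)
  case 0
  then show ?case using assms by (simp add: nonneg_part_def)
next
  case (Suc k)
  have "g \<otimes> x [^] k \<in> nonneg_part G \<chi>" by (rule nonneg_reach[OF Suc assms(1)])
  from rtrancl_trans[OF Suc step[OF this]] show ?case
    using assms by (simp add: m_assoc nonneg_part_def)
qed

lemma left_translate:
  assumes "(u, v) \<in> reach X" "g \<in> nonneg_part G \<chi>" "X \<subseteq> carrier G"
  shows "(g \<otimes> u, g \<otimes> v) \<in> reach X"
  using assms(1)
proof (induction rule: rtrancl_induct)
  case (step v w)
  have "(g \<otimes> v, g \<otimes> w) \<in> nonneg_steps G X \<chi>"
    using step.hyps(2) assms(2,3) by (auto simp: nonneg_steps_def nonneg_part_def char_mult m_assoc subset_iff)
  then show ?case using step.IH by (rule rtrancl_into_rtrancl[rotated])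
qed simp

text \<open>Along a fixed word for \<open>e\<close> the character drops by a bounded amount; from
  height \<open>b\<close> the word can be followed inside the nonnegative half.\<close>

lemma right_multiply_bound:
  assumes X: "X \<subseteq> carrier G" "generate G X = carrier G" and e: "e \<in> carrier G"
  shows "\<exists>b\<ge>0. \<forall>g\<in>carrier G. b \<le> \<chi> g \<longrightarrow> (g, g \<otimes> e) \<in> reach X"
proof -
  have letter: "\<exists>b\<ge>0. \<forall>g\<in>carrier G. b \<le> \<chi> g \<longrightarrow> (g, g \<otimes> x) \<in> reach X"
    if x: "x \<in> carrier G" "x \<in> X \<or> inv x \<in> X" for x
    by (rule exI[of _ "\<bar>\<chi> x\<bar>"]) (use x X in \<open>auto intro!: letter_step simp: nonneg_part_def char_mult\<close>)
  have "e \<in> generate G X" using e X by simp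
  then show ?thesis
  proof induction
    case one
    then show ?case by (intro exI[of _ 0]) auto
  next
    case (incl x)
    then show ?case using letter X by blast
  next
    case (inv x)
    then have "inv x \<in> carrier G" "inv (inv x) \<in> X" using X by auto
    then show ?case using letter by blast
  next
    case (eng h1 h2)
    have h: "h1 \<in> carrier G" "h2 \<in> carrier G" using eng X by auto
    obtain b1 where b1: "b1 \<ge> 0" "\<And>g. g \<in> carrier G \<Longrightarrow> b1 \<le> \<chi> g \<Longrightarrow> (g, g \<otimes> h1) \<in> reach X" using eng by blast
    obtain b2 where b2: "b2 \<ge> 0" "\<And>g. g \<in> carrier G \<Longrightarrow> b2 \<le> \<chi> g \<Longrightarrow> (g, g \<otimes> h2) \<in> reach X" using eng by blast
    have "(g, g \<otimes> (h1 \<otimes> h2)) \<in> reach X" if g: "g \<in> carrier G" "max b1 (b2 - \<chi> h1) \<le> \<chi> g" for g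
    proof -
      have "(g, g \<otimes> h1) \<in> reach X" using b1(2) g by simp
      moreover have "(g \<otimes> h1, g \<otimes> h1 \<otimes> h2) \<in> reach X" using b2(2)[of "g \<otimes> h1"] g h by (simp add: char_mult)
      ultimately show ?thesis using g h by (simp add: m_assoc)
    qed
    then show ?case using b1(1) by (intro exI[of _ "max b1 (b2 - \<chi> h1)"]) auto
  qed
qed

lemma exists_height:
  assumes "0 < \<chi> t" "t \<in> carrier G"
  obtains k :: nat where "b \<le> \<chi> (t [^] k)"
proof -
  obtain k :: nat where "b / \<chi> t < k" using reals_Archimedean2 by blast
  then show ?thesis using that[of k] assms by (simp add: char_pow pos_divide_less_eq)
qed

text \<open>A path for \<open>Z\<close> is translated by a high power \<open>T\<close> of a positive
  letter, until each of its steps can be replaced by a path for \<open>X\<close>. The target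
  \<open>e\<close> satisfies T e = h T, so the translated path ends at h T, from which descending
  along the letter leads to \<open>h\<close>.\<close>

lemma nonneg_connected_change:
  assumes X: "X \<subseteq> carrier G" "generate G X = carrier G" and Z: "finite Z" "Z \<subseteq> carrier G"
    and nz: "g0 \<in> carrier G" "\<chi> g0 \<noteq> 0" and con: "nonneg_connected G Z \<chi>"
  shows "nonneg_connected G X \<chi>"
proof -
  obtain t where t: "t \<in> carrier G" "t \<in> X \<or> inv t \<in> X" "0 < \<chi> t"
    using positive_letter[OF X nz] .
  have t_path: "(g, g \<otimes> t [^] k) \<in> reach X" if "g \<in> nonneg_part G \<chi>" for g and k :: nat
    by (rule power_path) (use that t X in \<open>auto intro!: letter_step simp: nonneg_part_def char_mult\<close>)
  have "\<exists>b\<ge>0. \<forall>z\<in>Z. \<forall>g\<in>carrier G. b \<le> \<chi> g \<longrightarrow> (g, g \<otimes> z) \<in> reach X"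
    using Z
  proof (induction Z)
    case (insert z Z)
    obtain b where b: "b \<ge> 0" "\<forall>z\<in>Z. \<forall>g\<in>carrier G. b \<le> \<chi> g \<longrightarrow> (g, g \<otimes> z) \<in> reach X"
      using insert by auto
    obtain b' where b': "b' \<ge> 0" "\<forall>g\<in>carrier G. b' \<le> \<chi> g \<longrightarrow> (g, g \<otimes> z) \<in> reach X"
      using right_multiply_bound[OF X, of z] insert.prems by auto
    show ?case using b b' by (intro exI[of _ "max b b'"]) auto
  qed auto
  then obtain b where b: "b \<ge> 0" "\<And>z g. z \<in> Z \<Longrightarrow> g \<in> carrier G \<Longrightarrow> b \<le> \<chi> g \<Longrightarrow> (g, g \<otimes> z) \<in> reach X"
    by blast
  obtain k :: nat where k: "b \<le> \<chi> (t [^] k)" using exists_height[OF t(3,1)] .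
  define T where "T = t [^] k"
  have T: "T \<in> carrier G" "b \<le> \<chi> T" using t k by (auto simp: T_def)
  have lift: "(T \<otimes> u, T \<otimes> v) \<in> reach X" if "(u, v) \<in> reach Z" for u v
    using that
  proof (induction rule: rtrancl_induct)
    case (step v w)
    have vw: "v \<in> carrier G" "w \<in> carrier G" "0 \<le> \<chi> v" "0 \<le> \<chi> w"
      using step.hyps(2) by (auto simp: nonneg_steps_def nonneg_part_def)
    then have bb: "b \<le> \<chi> (T \<otimes> v)" "b \<le> \<chi> (T \<otimes> w)" using T by (auto simp: char_mult)
    obtain z where z: "z \<in> Z" "w = v \<otimes> z \<or> v = w \<otimes> z" using step.hyps(2) by (auto simp: nonneg_steps_def)
    have zc: "z \<in> carrier G" using z Z by blast
    have "(T \<otimes> v, T \<otimes> w) \<in> reach X"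
      using z(2)
    proof
      assume "w = v \<otimes> z"
      then show ?thesis using b(2)[OF z(1) _ bb(1)] T vw zc by (simp add: m_assoc)
    next
      assume "v = w \<otimes> z"
      then show ?thesis using nonneg_steps_rtrancl_sym[OF b(2)[OF z(1) _ bb(2)]] T vw zc by (simp add: m_assoc)
    qed
    then show ?case using step.IH by (rule rtrancl_trans[rotated])
  qed simp
  show ?thesis unfolding nonneg_connected_def
  proof
    fix h assume h: "h \<in> nonneg_part G \<chi>"
    then have hc: "h \<in> carrier G" "0 \<le> \<chi> h" by (auto simp: nonneg_part_def)
    define e where "e = inv T \<otimes> h \<otimes> T"
    have "e \<in> nonneg_part G \<chi>" using hc T by (simp add: e_def nonneg_part_def char_mult char_inv)
    then have "(\<one>, e) \<in> reach Z" using con by (simp add: nonneg_connected_def)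
    from lift[OF this] have "(T, h \<otimes> T) \<in> reach X"
      using hc T by (simp add: e_def m_assoc[symmetric])
    moreover have "(\<one>, T) \<in> reach X" using t_path[OF one_nonneg, of k] t by (simp add: T_def)
    moreover have "(h \<otimes> T, h) \<in> reach X" using nonneg_steps_rtrancl_sym[OF t_path[OF h, of k]] by (simp add: T_def)
    ultimately show "(\<one>, h) \<in> reach X" by (meson rtrancl_trans)
  qed
qed

text \<open>Climb along powers of \<open>a\<close>, multiply by \<open>n\<close> at a height where
  this is safe, and descend along the same powers translated by \<open>n\<close>; commutation
  identifies the top of the climb with the top of the descent.\<close>

lemma commuting_reach:
  assumes X: "X \<subseteq> carrier G" "generate G X = carrier G" and n: "n \<in> carrier G" "\<chi> n = 0"
    and a: "a \<in> carrier G" "0 < \<chi> a" "a \<otimes> n = n \<otimes> a" "(\<one>, a) \<in> reach X"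
  shows "(\<one>, n) \<in> reach X"
proof -
  obtain b where b: "\<And>g. g \<in> carrier G \<Longrightarrow> b \<le> \<chi> g \<Longrightarrow> (g, g \<otimes> n) \<in> reach X"
    using right_multiply_bound[OF X n(1)] by blast
  obtain k :: nat where k: "b \<le> \<chi> (a [^] k)" using exists_height[OF a(2,1)] .
  have path: "(g, g \<otimes> a [^] k) \<in> reach X" if g: "g \<in> nonneg_part G \<chi>" for g
  proof (rule power_path[OF g a(1)])
    fix h assume h: "h \<in> nonneg_part G \<chi>"
    then show "(h, h \<otimes> a) \<in> reach X" using left_translate[OF a(4) h X(1)] by (simp add: nonneg_part_def)
  qed (use a in simp)
  have "(\<one>, a [^] k) \<in> reach X" using path[OF one_nonneg] a(1) by simp
  moreover have "(a [^] k, a [^] k \<otimes> n) \<in> reach X" using b[OF _ k] a(1) by simp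
  moreover have "a [^] k \<otimes> n = n \<otimes> a [^] k" using a n by (induction k) (auto simp: m_assoc, metis m_assoc nat_pow_closed)
  moreover have "(n \<otimes> a [^] k, n) \<in> reach X"
    by (rule nonneg_steps_rtrancl_sym, rule path) (use n in \<open>simp add: nonneg_part_def\<close>)
  ultimately show ?thesis by (metis rtrancl_trans)
qed

end

text \<open>Paths map to paths, and every element of the nonnegative half of the image lifts to the
  nonnegative half.\<close>

lemma nonneg_connected_image:
  assumes K: "group K" and G: "group G" and f: "f \<in> hom K G" and surj: "f ` carrier K = carrier G"
    and \<chi>: "\<And>h. h \<in> carrier K \<Longrightarrow> \<chi> h = \<psi> (f h)" and X: "X \<subseteq> carrier K" and con: "nonneg_connected K X \<chi>"
  shows "nonneg_connected G (f ` X) \<psi>"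
  unfolding nonneg_connected_def
proof
  interpret f: group_hom K G f using K G f by (simp add: group_hom_def group_hom_axioms_def)
  fix g assume g: "g \<in> nonneg_part G \<psi>"
  then have "g \<in> f ` carrier K" using surj by (simp add: nonneg_part_def)
  then obtain h where h: "h \<in> carrier K" "g = f h" by blast
  then have "0 \<le> \<chi> h" using g \<chi> by (simp add: nonneg_part_def)
  then have "(\<one>\<^bsub>K\<^esub>, h) \<in> (nonneg_steps K X \<chi>)\<^sup>*" using con h by (simp add: nonneg_connected_def nonneg_part_def)
  then have "(f \<one>\<^bsub>K\<^esub>, f h) \<in> (nonneg_steps G (f ` X) \<psi>)\<^sup>*"
  proof (induction rule: rtrancl_induct)
    case (step u v)
    have "(f u, f v) \<in> nonneg_steps G (f ` X) \<psi>"
      using step.hyps(2) X \<chi> unfolding nonneg_steps_def nonneg_part_def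
      by (auto simp: subset_iff)
    then show ?case using step.IH by (rule rtrancl_into_rtrancl[rotated])
  qed simp
  then show "(\<one>\<^bsub>G\<^esub>, g) \<in> (nonneg_steps G (f ` X) \<psi>)\<^sup>*" using h by simp
qed

section \<open>Homomorphisms out of the weak commutativity group\<close>

definition word_eval :: "('c, 'n) monoid_scheme \<Rightarrow> ('b \<Rightarrow> 'c) \<Rightarrow> 'b word \<Rightarrow> 'c" where
  "word_eval K \<phi> w = foldr (\<lambda>a k. (if fst a then \<phi> (snd a) else inv\<^bsub>K\<^esub> \<phi> (snd a)) \<otimes>\<^bsub>K\<^esub> k) w \<one>\<^bsub>K\<^esub>"

lemma word_eval_simps [simp]:
  "word_eval K \<phi> [] = \<one>\<^bsub>K\<^esub>"
  "word_eval K \<phi> (a # w) = (if fst a then \<phi> (snd a) else inv\<^bsub>K\<^esub> \<phi> (snd a)) \<otimes>\<^bsub>K\<^esub> word_eval K \<phi> w"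
  by (simp_all add: word_eval_def)

context group
begin

lemma inv_cancel [simp]:
  "x \<in> carrier G \<Longrightarrow> y \<in> carrier G \<Longrightarrow> inv x \<otimes> (x \<otimes> y) = y"
  "x \<in> carrier G \<Longrightarrow> y \<in> carrier G \<Longrightarrow> x \<otimes> (inv x \<otimes> y) = y"
  by (simp_all add: m_assoc[symmetric])

lemma commute_inv:
  assumes "x \<in> carrier G" "y \<in> carrier G" "x \<otimes> y = y \<otimes> x"
  shows "x \<otimes> inv y = inv y \<otimes> x" "inv x \<otimes> inv y = inv y \<otimes> inv x"
proof -
  have "inv y \<otimes> (x \<otimes> y) \<otimes> inv y = inv y \<otimes> (y \<otimes> x) \<otimes> inv y" by (simp only: assms(3))
  then show "x \<otimes> inv y = inv y \<otimes> x" using assms(1,2) by (simp add: m_assoc)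
  have "inv (y \<otimes> x) = inv (x \<otimes> y)" by (simp only: assms(3))
  then show "inv x \<otimes> inv y = inv y \<otimes> inv x" using assms(1,2) by (simp only: inv_mult_group)
qed

lemma word_eval_closed:
  "(\<And>s. s \<in> S \<Longrightarrow> \<phi> s \<in> carrier G) \<Longrightarrow> snd ` set w \<subseteq> S \<Longrightarrow> word_eval G \<phi> w \<in> carrier G"
  by (induction w) auto

lemma word_eval_hom:
  assumes \<phi>: "\<And>s. s \<in> S \<Longrightarrow> \<phi> s \<in> carrier G"
  shows "word_eval G \<phi> \<in> hom (free_group S) G"
proof (rule homI)
  fix u v assume u: "u \<in> carrier (free_group S)" and v: "v \<in> carrier (free_group S)"
  have uS: "snd ` set u \<subseteq> S" and vS: "snd ` set v \<subseteq> S" using u v by (auto simp: free_group_carrier)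
  have cons: "word_eval G \<phi> (reduced_cons a w) = (if fst a then \<phi> (snd a) else inv \<phi> (snd a)) \<otimes> word_eval G \<phi> w"
    if "snd a \<in> S" "snd ` set w \<subseteq> S" for a w
  proof (cases "\<exists>x. w = flip a # x")
    case True
    then obtain x where x: "w = flip a # x" by blast
    then have "word_eval G \<phi> x \<in> carrier G" using word_eval_closed[of S \<phi> x] \<phi> that by auto
    then show ?thesis using x \<phi>[OF that(1)] by (simp add: flip_def)
  next
    case False
    then have "reduced_cons a w = a # w" by (cases w) auto
    then show ?thesis by simp
  qed
  have "word_eval G \<phi> (foldr reduced_cons u v) = word_eval G \<phi> u \<otimes> word_eval G \<phi> v"
    using uS
  proof (induction u)
    case Nil
    then show ?case using word_eval_closed[of S \<phi> v] \<phi> vS by simp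
  next
    case (Cons a u)
    have aS: "snd a \<in> S" and uS': "snd ` set u \<subseteq> S" using Cons.prems by auto
    have "snd ` set (foldr reduced_cons u v) \<subseteq> S" using set_foldr_reduced_cons[of u v] uS' vS by blast
    from cons[OF aS this] Cons.IH[OF uS'] show ?case
      using word_eval_closed[of S \<phi> v] word_eval_closed[of S \<phi> u] \<phi> vS uS' aS by (simp add: m_assoc)
  qed
  then show "word_eval G \<phi> (u \<otimes>\<^bsub>free_group S\<^esub> v) = word_eval G \<phi> u \<otimes> word_eval G \<phi> v" by simp
next
  fix u assume "u \<in> carrier (free_group S)"
  then show "word_eval G \<phi> u \<in> carrier G" using word_eval_closed[of S \<phi> u] \<phi> by (auto simp: free_group_carrier)
qed

end

lemma weak_commutativity_hom:
  assumes G: "group G" and K: "group K" and f1: "f1 \<in> hom G K" and f2: "f2 \<in> hom G K"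
    and comm: "\<And>g. g \<in> carrier G \<Longrightarrow> f1 g \<otimes>\<^bsub>K\<^esub> f2 g = f2 g \<otimes>\<^bsub>K\<^esub> f1 g"
  obtains \<Phi> where "\<Phi> \<in> hom (\<XX> G) K" "\<And>g. g \<in> carrier G \<Longrightarrow> \<Phi> (wc_left G g) = f1 g"
    "\<And>g. g \<in> carrier G \<Longrightarrow> \<Phi> (wc_right G g) = f2 g"
proof -
  let ?F = "free_group (wc_gens G)"
  let ?N = "normal_closure ?F (wc_relators G)"
  interpret G: group G by (rule G)
  interpret K: group K by (rule K)
  interpret F: group ?F by (rule group_free_group)
  interpret f1: group_hom G K f1 using f1 by unfold_locales
  interpret f2: group_hom G K f2 using f2 by unfold_locales
  define h where "h = word_eval K (case_sum f1 f2)"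
  interpret h: group_hom ?F K h
    unfolding h_def by unfold_locales (rule K.word_eval_hom, auto simp: wc_gens_def)
  have gc: "gen (Inl g) \<in> carrier ?F" "gen (Inr g) \<in> carrier ?F" if "g \<in> carrier G" for g
    using that by (auto intro!: gen_in_free_group simp: wc_gens_def)
  have hg: "h (gen (Inl g)) = f1 g" "h (gen (Inr g)) = f2 g" if "g \<in> carrier G" for g
    using that by (auto simp: h_def gen_def)
  have "wc_relators G \<subseteq> kernel ?F K h"
  proof
    fix w assume w: "w \<in> wc_relators G"
    then have wc: "w \<in> carrier ?F" using wc_relators_subset[OF G] by blast
    consider (l) g g' where "g \<in> carrier G" "g' \<in> carrier G"
        "w = gen (Inl g) \<otimes>\<^bsub>?F\<^esub> gen (Inl g') \<otimes>\<^bsub>?F\<^esub> inv\<^bsub>?F\<^esub> gen (Inl (g \<otimes>\<^bsub>G\<^esub> g'))"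
      | (r) g g' where "g \<in> carrier G" "g' \<in> carrier G"
        "w = gen (Inr g) \<otimes>\<^bsub>?F\<^esub> gen (Inr g') \<otimes>\<^bsub>?F\<^esub> inv\<^bsub>?F\<^esub> gen (Inr (g \<otimes>\<^bsub>G\<^esub> g'))"
      | (c) g where "g \<in> carrier G"
        "w = gen (Inl g) \<otimes>\<^bsub>?F\<^esub> gen (Inr g) \<otimes>\<^bsub>?F\<^esub> inv\<^bsub>?F\<^esub> gen (Inl g) \<otimes>\<^bsub>?F\<^esub> inv\<^bsub>?F\<^esub> gen (Inr g)"
      using w unfolding wc_relators_def table_relators_def Let_def by blast
    then have "h w = \<one>\<^bsub>K\<^esub>"
    proof cases
      case l
      then show ?thesis using gc hg by (simp del: free_group_simps add: K.m_assoc[symmetric])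
    next
      case r
      then show ?thesis using gc hg by (simp del: free_group_simps add: K.m_assoc[symmetric])
    next
      case c
      have "h w = f1 g \<otimes>\<^bsub>K\<^esub> f2 g \<otimes>\<^bsub>K\<^esub> inv\<^bsub>K\<^esub> f1 g \<otimes>\<^bsub>K\<^esub> inv\<^bsub>K\<^esub> f2 g"
        using c gc hg by (simp del: free_group_simps)
      also have "\<dots> = \<one>\<^bsub>K\<^esub>" unfolding comm[OF c(1)] using c(1) by (simp add: K.m_assoc)
      finally show ?thesis .
    qed
    then show "w \<in> kernel ?F K h" using wc by (simp add: kernel_def)
  qed
  then have "?N \<subseteq> kernel ?F K h"
    unfolding normal_closure_def using h.normal_kernel by blast
  moreover have "?N \<lhd> ?F" by (intro normal_closure_normal group_free_group wc_relators_subset G)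
  ultimately obtain \<Phi> where \<Phi>: "\<Phi> \<in> hom (?F Mod ?N) K" "\<And>x. x \<in> carrier ?F \<Longrightarrow> \<Phi> (?N #>\<^bsub>?F\<^esub> x) = h x"
    using h.FactGroup_universal_kernel by blast
  show ?thesis
  proof (rule that[of \<Phi>])
    show "\<Phi> \<in> hom (\<XX> G) K" using \<Phi>(1) by (simp add: weak_commutativity_group_def presented_group_def)
  qed (use \<Phi>(2) gc hg in \<open>auto simp: wc_left_def wc_right_def presented_gen_def\<close>)
qed

section \<open>The two copies in the weak commutativity group\<close>

locale weak_commutativity = group G for G (structure)
begin

abbreviation K where "K \<equiv> \<XX> G"
abbreviation K_mult (infixl \<open>\<cdot>\<close> 70) where "x \<cdot> y \<equiv> x \<otimes>\<^bsub>K\<^esub> y"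
abbreviation K_inv (\<open>inv\<^sub>K _\<close> [81] 80) where "inv\<^sub>K x \<equiv> inv\<^bsub>K\<^esub> x"
abbreviation l where "l \<equiv> wc_left G"
abbreviation r where "r \<equiv> wc_right G"

sublocale K: group K by (rule group_weak_commutativity_group) (rule is_group)
sublocale l: group_hom G K l by unfold_locales (rule wc_left_right(1)[OF is_group])
sublocale r: group_hom G K r by unfold_locales (rule wc_left_right(2)[OF is_group])

lemma lr: "g \<in> carrier G \<Longrightarrow> l g \<cdot> r g = r g \<cdot> l g"
  by (rule wc_left_right(3)[OF is_group])

lemma lr_inv:
  assumes "g \<in> carrier G"
  shows "l g \<cdot> inv\<^sub>K r g = inv\<^sub>K r g \<cdot> l g"
    "inv\<^sub>K l g \<cdot> inv\<^sub>K r g = inv\<^sub>K r g \<cdot> inv\<^sub>K l g"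
  using K.commute_inv[OF _ _ lr[OF assms]] assms by simp_all

text \<open>Commutators of the two copies; dividing by them turns the group into the direct product
  of two copies of \<open>G\<close>. The elements \<open>diff c\<close> below generate the kernel of
  the map to \<open>G\<close> that identifies the copies.\<close>

definition cross :: "'a \<Rightarrow> 'a \<Rightarrow> ('a + 'a) word set" where
  "cross a b = inv\<^sub>K l a \<cdot> r b \<cdot> l a \<cdot> inv\<^sub>K r b"

definition diff :: "'a \<Rightarrow> ('a + 'a) word set" where
  "diff c = l c \<cdot> inv\<^sub>K r c"

lemma cross_closed: "a \<in> carrier G \<Longrightarrow> b \<in> carrier G \<Longrightarrow> cross a b \<in> carrier K"
  by (simp add: cross_def)

lemma diff_closed: "c \<in> carrier G \<Longrightarrow> diff c \<in> carrier K"
  by (simp add: diff_def)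

text \<open>Expanding the relation that \<open>ab\<close> commutes with its copy.\<close>

lemma cross_swap:
  assumes a: "a \<in> carrier G" and b: "b \<in> carrier G"
  shows "cross a b = inv\<^sub>K r a \<cdot> l b \<cdot> r a \<cdot> inv\<^sub>K l b"
proof -
  let ?A = "l a" and ?A' = "r a" and ?B = "l b" and ?B' = "r b"
  have c: "?A \<in> carrier K" "?A' \<in> carrier K" "?B \<in> carrier K" "?B' \<in> carrier K" using a b by auto
  have rel: "?A \<cdot> ?B \<cdot> (?A' \<cdot> ?B') = ?A' \<cdot> ?B' \<cdot> (?A \<cdot> ?B)"
    using lr[of "a \<otimes> b"] a b by simp
  have "inv\<^sub>K ?A' \<cdot> ?B \<cdot> ?A' \<cdot> inv\<^sub>K ?B =
      inv\<^sub>K ?A' \<cdot> inv\<^sub>K ?A \<cdot> (?A \<cdot> ?B \<cdot> (?A' \<cdot> ?B')) \<cdot> (inv\<^sub>K ?B' \<cdot> inv\<^sub>K ?B)"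
    using c by (simp add: K.m_assoc)
  also have "\<dots> = inv\<^sub>K ?A \<cdot> inv\<^sub>K ?A' \<cdot> (?A' \<cdot> ?B' \<cdot> (?A \<cdot> ?B)) \<cdot> (inv\<^sub>K ?B \<cdot> inv\<^sub>K ?B')"
    by (simp only: rel lr_inv(2)[OF a] lr_inv(2)[OF b])
  also have "\<dots> = cross a b"
    using c by (simp add: K.m_assoc cross_def)
  finally show ?thesis by simp
qed

text \<open>\<open>cross (a \<otimes> c) b\<close> is expanded twice, from the definition and from
  \<open>cross_swap\<close>. One result contains the conjugate of \<open>cross a b\<close> by
  \<open>l c\<close>, the other that by \<open>r c\<close>, and they agree otherwise; so the two
  conjugates coincide.\<close>

lemma cross_diff:
  assumes a: "a \<in> carrier G" and b: "b \<in> carrier G" and c: "c \<in> carrier G"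
  shows "cross a b \<cdot> diff c = diff c \<cdot> cross a b"
proof -
  let ?q = "cross a b" and ?C = "l c" and ?C' = "r c"
  have k: "?q \<in> carrier K" "cross c b \<in> carrier K" "?C \<in> carrier K" "?C' \<in> carrier K"
    using a b c by (auto simp: cross_closed)
  have "inv\<^sub>K ?C \<cdot> ?q \<cdot> ?C \<cdot> cross c b = cross (a \<otimes> c) b"
    using a b c by (simp add: cross_def K.m_assoc K.inv_mult_group)
  also have "\<dots> = inv\<^sub>K ?C' \<cdot> ?q \<cdot> ?C' \<cdot> cross c b"
    using a b c by (simp add: cross_swap K.m_assoc K.inv_mult_group)
  finally have "inv\<^sub>K ?C \<cdot> ?q \<cdot> ?C = inv\<^sub>K ?C' \<cdot> ?q \<cdot> ?C'"
    using k by simp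
  then have "?C \<cdot> (inv\<^sub>K ?C \<cdot> ?q \<cdot> ?C) \<cdot> inv\<^sub>K ?C' =
      ?C \<cdot> (inv\<^sub>K ?C' \<cdot> ?q \<cdot> ?C') \<cdot> inv\<^sub>K ?C'" by simp
  then show ?thesis using k by (simp add: K.m_assoc diff_def)
qed

definition centralizer_diff :: "('a + 'a) word set set" where
  "centralizer_diff = {n \<in> carrier K. \<forall>c\<in>carrier G. n \<cdot> diff c = diff c \<cdot> n}"

lemma subgroup_centralizer: "subgroup centralizer_diff K"
proof (rule K.subgroupI)
  show "centralizer_diff \<noteq> {}" using diff_closed by (auto simp: centralizer_diff_def intro!: exI[of _ "\<one>\<^bsub>K\<^esub>"])
next
  fix x assume x: "x \<in> centralizer_diff"
  have "diff c \<cdot> inv\<^sub>K x = inv\<^sub>K x \<cdot> diff c" if "c \<in> carrier G" for c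
    using K.commute_inv(1)[of "diff c" x] x that diff_closed by (auto simp: centralizer_diff_def)
  then show "inv\<^sub>K x \<in> centralizer_diff" using x by (auto simp: centralizer_diff_def)
next
  fix x y assume xy: "x \<in> centralizer_diff" "y \<in> centralizer_diff"
  have "x \<cdot> y \<cdot> diff c = diff c \<cdot> (x \<cdot> y)" if c: "c \<in> carrier G" for c
  proof -
    have k: "x \<in> carrier K" "y \<in> carrier K" "diff c \<in> carrier K" using xy c diff_closed by (auto simp: centralizer_diff_def)
    have "x \<cdot> y \<cdot> diff c = x \<cdot> (diff c \<cdot> y)" using xy k c by (simp add: K.m_assoc centralizer_diff_def)
    also have "\<dots> = (x \<cdot> diff c) \<cdot> y" using k by (simp add: K.m_assoc)
    also have "\<dots> = diff c \<cdot> x \<cdot> y" using xy k c by (simp add: centralizer_diff_def)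
    finally show ?thesis using k by (simp add: K.m_assoc)
  qed
  then show "x \<cdot> y \<in> centralizer_diff" using xy by (auto simp: centralizer_diff_def)
qed (auto simp: centralizer_diff_def)

text \<open>Conjugates of \<open>diff c\<close> are products of such elements, so whatever commutes
  with all of these commutes with the conjugates; this makes the centralizer normal.\<close>

lemma diff_conj:
  assumes g: "g \<in> carrier G" and c: "c \<in> carrier G"
  shows "inv\<^sub>K l g \<cdot> diff c \<cdot> l g = diff (inv g \<otimes> c) \<cdot> diff g"
    "inv\<^sub>K r g \<cdot> diff c \<cdot> r g = diff g \<cdot> diff (inv g \<otimes> c)"
  using g c lr_inv(1)[OF g] by (simp_all add: diff_def K.m_assoc K.inv_mult_group)

lemma conj_centralizer:
  assumes n: "n \<in> centralizer_diff" and x: "x \<in> carrier K"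
    and d: "\<And>c. c \<in> carrier G \<Longrightarrow> n \<cdot> (inv\<^sub>K x \<cdot> diff c \<cdot> x) = (inv\<^sub>K x \<cdot> diff c \<cdot> x) \<cdot> n"
  shows "x \<cdot> n \<cdot> inv\<^sub>K x \<in> centralizer_diff"
proof -
  have nc: "n \<in> carrier K" using n by (simp add: centralizer_diff_def)
  have "x \<cdot> n \<cdot> inv\<^sub>K x \<cdot> diff c = diff c \<cdot> (x \<cdot> n \<cdot> inv\<^sub>K x)" if c: "c \<in> carrier G" for c
  proof -
    have dc: "diff c \<in> carrier K" by (rule diff_closed[OF c])
    have "x \<cdot> (n \<cdot> (inv\<^sub>K x \<cdot> diff c \<cdot> x)) \<cdot> inv\<^sub>K x =
        x \<cdot> ((inv\<^sub>K x \<cdot> diff c \<cdot> x) \<cdot> n) \<cdot> inv\<^sub>K x" by (simp only: d[OF c])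
    then show ?thesis using x nc dc by (simp add: K.m_assoc)
  qed
  then show ?thesis using x nc by (simp add: centralizer_diff_def)
qed

text \<open>\<open>U\<close> consists of the elements conjugating the centralizer into itself in
  both directions, which makes it closed under inverses; since the copies generate, checking
  \<open>l g\<close> and \<open>r g\<close> suffices.\<close>

lemma normal_centralizer: "centralizer_diff \<lhd> K"
proof -
  define U where "U = {x \<in> carrier K. \<forall>n\<in>centralizer_diff. x \<cdot> n \<cdot> inv\<^sub>K x \<in> centralizer_diff \<and>
    inv\<^sub>K x \<cdot> n \<cdot> x \<in> centralizer_diff}"
  have Ec: "n \<in> carrier K" if "n \<in> centralizer_diff" for n using that by (simp add: centralizer_diff_def)
  have dd: "n \<cdot> (diff a \<cdot> diff b) = diff a \<cdot> diff b \<cdot> n"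
    if n: "n \<in> centralizer_diff" and ab: "a \<in> carrier G" "b \<in> carrier G" for n a b
  proof -
    have k: "n \<in> carrier K" "diff a \<in> carrier K" "diff b \<in> carrier K" using Ec n ab diff_closed by auto
    have "n \<cdot> (diff a \<cdot> diff b) = (n \<cdot> diff a) \<cdot> diff b" using k by (simp add: K.m_assoc)
    also have "\<dots> = diff a \<cdot> (n \<cdot> diff b)" using n ab k by (simp add: centralizer_diff_def K.m_assoc)
    also have "\<dots> = diff a \<cdot> (diff b \<cdot> n)" using n ab by (simp add: centralizer_diff_def)
    finally show ?thesis using k by (simp add: K.m_assoc)
  qed
  have conj: "l g \<cdot> n \<cdot> inv\<^sub>K l g \<in> centralizer_diff" "r g \<cdot> n \<cdot> inv\<^sub>K r g \<in> centralizer_diff"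
    if n: "n \<in> centralizer_diff" and g: "g \<in> carrier G" for n g
    by (rule conj_centralizer[OF n]; use n g diff_conj dd in simp)+
  have U: "subgroup U K"
  proof (rule K.subgroupI)
    show "U \<noteq> {}" using Ec by (auto simp: U_def intro!: exI[of _ "\<one>\<^bsub>K\<^esub>"])
  next
    fix x y assume xy: "x \<in> U" "y \<in> U"
    then have k: "x \<in> carrier K" "y \<in> carrier K" by (auto simp: U_def)
    have "x \<cdot> y \<cdot> n \<cdot> inv\<^sub>K (x \<cdot> y) \<in> centralizer_diff" 
      "inv\<^sub>K (x \<cdot> y) \<cdot> n \<cdot> (x \<cdot> y) \<in> centralizer_diff" if n: "n \<in> centralizer_diff" for n
    proof -
      have "x \<cdot> (y \<cdot> n \<cdot> inv\<^sub>K y) \<cdot> inv\<^sub>K x \<in> centralizer_diff" using xy n by (simp add: U_def)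
      then show "x \<cdot> y \<cdot> n \<cdot> inv\<^sub>K (x \<cdot> y) \<in> centralizer_diff"
        using k Ec[OF n] by (simp add: K.m_assoc K.inv_mult_group)
      have "inv\<^sub>K y \<cdot> (inv\<^sub>K x \<cdot> n \<cdot> x) \<cdot> y \<in> centralizer_diff" using xy n by (simp add: U_def)
      then show "inv\<^sub>K (x \<cdot> y) \<cdot> n \<cdot> (x \<cdot> y) \<in> centralizer_diff"
        using k Ec[OF n] by (simp add: K.m_assoc K.inv_mult_group)
    qed
    then show "x \<cdot> y \<in> U" using k by (simp add: U_def)
  qed (auto simp: U_def)
  have "carrier K \<subseteq> U"
  proof (rule wc_generated[OF is_group U])
    fix g assume g: "g \<in> carrier G"
    have ig: "inv\<^sub>K l g = l (inv g)" "inv\<^sub>K r g = r (inv g)" using g by simp_all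
    have "inv\<^sub>K l g \<cdot> n \<cdot> l g \<in> centralizer_diff" "inv\<^sub>K r g \<cdot> n \<cdot> r g \<in> centralizer_diff"
      if "n \<in> centralizer_diff" for n
      using conj[OF that, of "inv g"] g by simp_all
    then show "l g \<in> U \<and> r g \<in> U" using conj g by (simp add: U_def)
  qed
  then show ?thesis using subgroup_centralizer by (auto simp: K.normal_inv_iff U_def)
qed

end

section \<open>Connectedness of the nonnegative half for characters of the weak commutativity
  group\<close>

context weak_commutativity
begin

lemma character_left: "real_character K \<chi> \<Longrightarrow> real_character G (\<lambda>g. \<chi> (l g))"
  by unfold_locales (simp add: real_character.char_mult)

lemma character_right: "real_character K \<chi> \<Longrightarrow> real_character G (\<lambda>g. \<chi> (r g))"
  by unfold_locales (simp add: real_character.char_mult)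

lemma character_diff: "real_character K \<chi> \<Longrightarrow> real_character G (\<lambda>g. \<chi> (l g) - \<chi> (r g))"
  by unfold_locales (simp add: real_character.char_mult)

lemma nonneg_connected_copies:
  assumes \<chi>: "real_character K \<chi>" and Y: "finite_generating_set G Y"
    and a0: "a0 \<in> carrier G" "\<chi> (l a0) \<noteq> 0" and b0: "b0 \<in> carrier G" "\<chi> (r b0) \<noteq> 0"
    and c0: "c0 \<in> carrier G" "\<chi> (l c0) \<noteq> \<chi> (r c0)"
  shows "nonneg_connected K (l ` Y \<union> r ` Y) \<chi>"
proof -
  interpret \<chi>: real_character K \<chi> by (rule \<chi>)
  interpret \<chi>l: real_character G "\<lambda>g. \<chi> (l g)" by (rule character_left[OF \<chi>])
  interpret \<chi>r: real_character G "\<lambda>g. \<chi> (r g)" by (rule character_right[OF \<chi>])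
  interpret \<chi>d: real_character G "\<lambda>g. \<chi> (l g) - \<chi> (r g)" by (rule character_diff[OF \<chi>])
  let ?Z = "l ` Y \<union> r ` Y"
  let ?R = "(nonneg_steps K ?Z \<chi>)\<^sup>*"
  have Yc: "Y \<subseteq> carrier G" "generate G Y = carrier G" using Y by (auto simp: finite_generating_set_def)
  have Z: "?Z \<subseteq> carrier K" "generate K ?Z = carrier K"
    using finite_generating_set_wc[OF is_group Y] by (auto simp: finite_generating_set_def)
  obtain s where s: "s \<in> carrier G" "s \<in> Y \<or> inv s \<in> Y" "0 < \<chi> (l s)"
    using \<chi>l.positive_letter[OF Yc a0] .
  obtain p where p: "p \<in> carrier G" "p \<in> Y \<or> inv p \<in> Y" "0 < \<chi> (r p)"
    using \<chi>r.positive_letter[OF Yc b0] .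
  have "\<chi> (l c0) - \<chi> (r c0) \<noteq> 0" using c0(2) by simp
  then obtain c where c: "c \<in> carrier G" "c \<in> Y \<or> inv c \<in> Y" "0 < \<chi> (l c) - \<chi> (r c)"
    using \<chi>d.positive_letter[OF Yc c0(1)] by blast
  have letter: "l g \<in> ?Z \<or> inv\<^sub>K l g \<in> ?Z" "r g \<in> ?Z \<or> inv\<^sub>K r g \<in> ?Z"
    if "g \<in> carrier G" "g \<in> Y \<or> inv g \<in> Y" for g
    unfolding l.hom_inv[OF that(1), symmetric] r.hom_inv[OF that(1), symmetric] using that(2) by blast+
  have step: "(h, h \<cdot> z) \<in> ?R"
    if "h \<in> nonneg_part K \<chi>" "z \<in> carrier K" "z \<in> ?Z \<or> inv\<^sub>K z \<in> ?Z" "0 \<le> \<chi> (h \<cdot> z)" for h z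
    by (rule \<chi>.letter_step[OF Z(1) that])
  have up: "(h, h \<cdot> z [^]\<^bsub>K\<^esub> k) \<in> ?R"
    if "h \<in> nonneg_part K \<chi>" "z \<in> carrier K" "z \<in> ?Z \<or> inv\<^sub>K z \<in> ?Z" "0 \<le> \<chi> z" for h z and k :: nat
    by (rule \<chi>.power_path[OF that(1,2,4)]) (use that in \<open>auto intro!: step simp: \<chi>.char_mult nonneg_part_def\<close>)
  \<comment> \<open>The two factors of \<open>diff c\<close> commute, so one on which the character
    is nonnegative can be taken first.\<close>
  have diff_reach: "(\<one>\<^bsub>K\<^esub>, diff c) \<in> ?R"
  proof (cases "0 \<le> \<chi> (l c)")
    case True
    have "(\<one>\<^bsub>K\<^esub>, \<one>\<^bsub>K\<^esub> \<cdot> l c) \<in> ?R"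
      by (rule step) (use \<chi>.one_nonneg letter c True in auto)
    moreover have "(l c, l c \<cdot> inv\<^sub>K r c) \<in> ?R"
      by (rule step) (use letter(2)[OF c(1,2)] c True in \<open>auto simp: nonneg_part_def \<chi>.char_mult \<chi>.char_inv\<close>)
    ultimately show ?thesis using c by (simp add: diff_def)
  next
    case False
    have "(\<one>\<^bsub>K\<^esub>, \<one>\<^bsub>K\<^esub> \<cdot> inv\<^sub>K r c) \<in> ?R"
      by (rule step) (use \<chi>.one_nonneg letter(2)[OF c(1,2)] c False in \<open>auto simp: \<chi>.char_inv\<close>)
    moreover have "(inv\<^sub>K r c, inv\<^sub>K r c \<cdot> l c) \<in> ?R"
      by (rule step) (use letter(1)[OF c(1,2)] c False in \<open>auto simp: nonneg_part_def \<chi>.char_mult \<chi>.char_inv\<close>)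
    ultimately show ?thesis using c lr_inv(1)[of c] by (simp add: diff_def)
  qed
  define N where "N = {n \<in> centralizer_diff. \<chi> n = 0}"
  have Nc: "n \<in> carrier K" "\<chi> n = 0" if "n \<in> N" for n using that by (auto simp: N_def centralizer_diff_def)
  have N_reach: "(\<one>\<^bsub>K\<^esub>, n) \<in> ?R" if n: "n \<in> N" for n
  proof (rule \<chi>.commuting_reach[OF Z Nc[OF n] diff_closed[OF c(1)] _ _ diff_reach])
    show "0 < \<chi> (diff c)" using c by (simp add: diff_def \<chi>.char_mult \<chi>.char_inv)
    show "diff c \<cdot> n = n \<cdot> diff c" using n c by (simp add: N_def centralizer_diff_def)
  qed
  have N: "N \<lhd> K"
    unfolding K.normal_inv_iff
  proof
    show "subgroup N K"
    proof (rule K.subgroupI)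
      show "N \<noteq> {}" using subgroup.one_closed[OF subgroup_centralizer] by (auto simp: N_def)
    next
      show "N \<subseteq> carrier K" using Nc(1) by blast
    next
      fix x assume x: "x \<in> N"
      then have "inv\<^sub>K x \<in> centralizer_diff"
        using subgroup.m_inv_closed[OF subgroup_centralizer] by (simp add: N_def)
      then show "inv\<^sub>K x \<in> N" using Nc[OF x] by (simp add: N_def \<chi>.char_inv)
    next
      fix x y assume x: "x \<in> N" and y: "y \<in> N"
      then have "x \<cdot> y \<in> centralizer_diff"
        using subgroup.m_closed[OF subgroup_centralizer] by (simp add: N_def)
      then show "x \<cdot> y \<in> N" using Nc[OF x] Nc[OF y] by (simp add: N_def \<chi>.char_mult)
    qed
    show "\<forall>x\<in>carrier K. \<forall>h\<in>N. x \<cdot> h \<cdot> inv\<^sub>K x \<in> N"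
    proof (intro ballI)
      fix x h assume x: "x \<in> carrier K" and h: "h \<in> N"
      then have "x \<cdot> h \<cdot> inv\<^sub>K x \<in> centralizer_diff"
        using normal_centralizer unfolding K.normal_inv_iff N_def by blast
      then show "x \<cdot> h \<cdot> inv\<^sub>K x \<in> N"
        using x Nc[OF h] by (simp add: N_def \<chi>.char_mult \<chi>.char_inv)
    qed
  qed
  interpret N: normal N K by (rule N)
  define Q where "Q = K Mod N"
  define \<pi> where "\<pi> = (\<lambda>x. N #>\<^bsub>K\<^esub> x)"
  interpret Q: group Q unfolding Q_def by (rule N.factorgroup_is_group)
  have "\<pi> \<in> hom K Q" unfolding Q_def \<pi>_def by (rule N.r_coset_hom_Mod)
  then interpret \<pi>: group_hom K Q \<pi> by unfold_locales
  have \<pi>_eq: "\<exists>n\<in>N. x = n \<cdot> y" if "x \<in> carrier K" "y \<in> carrier K" "\<pi> x = \<pi> y" for x y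
  proof -
    have "x \<in> N #>\<^bsub>K\<^esub> y" using K.rcos_self[OF that(1) N.subgroup_axioms] that(3) by (simp add: \<pi>_def)
    then show ?thesis by (auto simp: r_coset_def)
  qed
  have \<pi>_N: "\<pi> n = \<one>\<^bsub>Q\<^esub>" if "n \<in> N" for n
    using that K.coset_join2[OF Nc(1)[OF that] N.subgroup_axioms] by (simp add: \<pi>_def Q_def FactGroup_def)
  have comm: "\<pi> (l a) \<otimes>\<^bsub>Q\<^esub> \<pi> (r b) = \<pi> (r b) \<otimes>\<^bsub>Q\<^esub> \<pi> (l a)" if ab: "a \<in> carrier G" "b \<in> carrier G" for a b
  proof -
    have "cross a b \<in> centralizer_diff"
      unfolding centralizer_diff_def using cross_closed[OF ab] cross_diff[OF ab] by blast
    moreover have "\<chi> (cross a b) = 0" using ab by (simp add: cross_def \<chi>.char_mult \<chi>.char_inv)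
    ultimately have "cross a b \<in> N" by (simp add: N_def)
    then have "\<pi> (l a \<cdot> cross a b \<cdot> r b) = \<pi> (l a) \<otimes>\<^bsub>Q\<^esub> \<pi> (r b)"
      using ab cross_closed[OF ab] \<pi>_N by simp
    moreover have "l a \<cdot> cross a b \<cdot> r b = r b \<cdot> l a"
      using ab by (simp add: cross_def K.m_assoc)
    ultimately show ?thesis using ab by simp
  qed
  \<comment> \<open>Modulo \<open>N\<close> the copies commute, so the products of an element of
    each form a subgroup and exhaust the quotient.\<close>
  define U where "U = {h \<in> carrier K. \<exists>a\<in>carrier G. \<exists>b\<in>carrier G. \<pi> h = \<pi> (l a) \<otimes>\<^bsub>Q\<^esub> \<pi> (r b)}"
  have UI: "h \<in> U" if "h \<in> carrier K" "a \<in> carrier G" "b \<in> carrier G" "\<pi> h = \<pi> (l a) \<otimes>\<^bsub>Q\<^esub> \<pi> (r b)" for h a b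
    using that unfolding U_def by blast
  have U: "subgroup U K"
  proof (rule K.subgroupI)
    have "\<one>\<^bsub>K\<^esub> \<in> U" by (rule UI[of _ \<one> \<one>]) auto
    then show "U \<noteq> {}" by blast
  next
    fix h assume "h \<in> U"
    then obtain a b where h: "h \<in> carrier K" "a \<in> carrier G" "b \<in> carrier G" "\<pi> h = \<pi> (l a) \<otimes>\<^bsub>Q\<^esub> \<pi> (r b)" by (auto simp: U_def)
    have "\<pi> (inv\<^sub>K h) = inv\<^bsub>Q\<^esub> (\<pi> (r b) \<otimes>\<^bsub>Q\<^esub> \<pi> (l a))" using h comm[OF h(2,3)] by simp
    also have "\<dots> = \<pi> (l (inv a)) \<otimes>\<^bsub>Q\<^esub> \<pi> (r (inv b))" using h by (simp add: Q.inv_mult_group)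
    finally show "inv\<^sub>K h \<in> U" using h by (intro UI[of _ "inv a" "inv b"]) auto
  next
    fix h k assume "h \<in> U" "k \<in> U"
    then obtain a b a' b' where h: "h \<in> carrier K" "a \<in> carrier G" "b \<in> carrier G" "\<pi> h = \<pi> (l a) \<otimes>\<^bsub>Q\<^esub> \<pi> (r b)"
      and k: "k \<in> carrier K" "a' \<in> carrier G" "b' \<in> carrier G" "\<pi> k = \<pi> (l a') \<otimes>\<^bsub>Q\<^esub> \<pi> (r b')" by (auto simp: U_def)
    have "\<pi> (h \<cdot> k) = \<pi> (l a) \<otimes>\<^bsub>Q\<^esub> (\<pi> (r b) \<otimes>\<^bsub>Q\<^esub> \<pi> (l a')) \<otimes>\<^bsub>Q\<^esub> \<pi> (r b')" using h k by (simp add: Q.m_assoc)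
    also have "\<dots> = \<pi> (l a) \<otimes>\<^bsub>Q\<^esub> (\<pi> (l a') \<otimes>\<^bsub>Q\<^esub> \<pi> (r b)) \<otimes>\<^bsub>Q\<^esub> \<pi> (r b')" by (simp only: comm[OF k(2) h(3)])
    also have "\<dots> = \<pi> (l (a \<otimes> a')) \<otimes>\<^bsub>Q\<^esub> \<pi> (r (b \<otimes> b'))" using h k by (simp add: Q.m_assoc)
    finally show "h \<cdot> k \<in> U" using h k by (intro UI[of _ "a \<otimes> a'" "b \<otimes> b'"]) auto
  qed (auto simp: U_def)
  have "carrier K \<subseteq> U"
  proof (rule wc_generated[OF is_group U])
    fix g assume g: "g \<in> carrier G"
    have "\<pi> (l g) = \<pi> (l g) \<otimes>\<^bsub>Q\<^esub> \<pi> (r \<one>)" "\<pi> (r g) = \<pi> (l \<one>) \<otimes>\<^bsub>Q\<^esub> \<pi> (r g)" using g by simp_all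
    then show "l g \<in> U \<and> r g \<in> U"
      using UI[of "l g" g \<one>] UI[of "r g" \<one> g] g by simp
  qed
  show ?thesis unfolding nonneg_connected_def
  proof
    fix h assume h: "h \<in> nonneg_part K \<chi>"
    then have hc: "h \<in> carrier K" "0 \<le> \<chi> h" by (auto simp: nonneg_part_def)
    then have "h \<in> U" using \<open>carrier K \<subseteq> U\<close> by blast
    then obtain a b where ab: "a \<in> carrier G" "b \<in> carrier G" "\<pi> h = \<pi> (l a) \<otimes>\<^bsub>Q\<^esub> \<pi> (r b)"
      by (auto simp: U_def)
    have "\<pi> h = \<pi> (l a \<cdot> r b)" using ab by simp
    then obtain n0 where n0: "n0 \<in> N" "h = n0 \<cdot> (l a \<cdot> r b)" using \<pi>_eq[of h "l a \<cdot> r b"] hc ab by auto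
    have \<chi>h: "\<chi> h = \<chi> (l a) + \<chi> (r b)" using n0 Nc[OF n0(1)] ab by (simp add: \<chi>.char_mult)
    obtain b1 where b1: "\<And>g. g \<in> carrier K \<Longrightarrow> b1 \<le> \<chi> g \<Longrightarrow> (g, g \<cdot> l a) \<in> ?R"
      using \<chi>.right_multiply_bound[OF Z, of "l a"] ab by auto
    have rp: "r p \<in> carrier K" and ls: "l s \<in> carrier K" using p s by auto
    \<comment> \<open>The right copy supplies the height for multiplying by \<open>l a\<close>;
      afterwards the left copy supplies the height for replacing \<open>r u\<close> by
      \<open>r b\<close>.\<close>
    obtain k :: nat where k: "b1 \<le> \<chi> (r p [^]\<^bsub>K\<^esub> k)" using \<chi>.exists_height[OF p(3) rp] .
    define u where "u = p [^] k"
    have u: "u \<in> carrier G" "r u = r p [^]\<^bsub>K\<^esub> k" using p by (auto simp: u_def r.hom_nat_pow)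
    have "(\<one>\<^bsub>K\<^esub>, \<one>\<^bsub>K\<^esub> \<cdot> r p [^]\<^bsub>K\<^esub> k) \<in> ?R"
      by (rule up[OF \<chi>.one_nonneg rp letter(2)[OF p(1,2)]]) (use p in simp)
    then have w1: "(\<one>\<^bsub>K\<^esub>, r u) \<in> ?R" using rp by (simp add: u)
    have w2: "(r u, r u \<cdot> l a) \<in> ?R" by (rule b1) (use k rp in \<open>simp_all add: u\<close>)
    have "(\<one>\<^bsub>K\<^esub>, r u \<cdot> l a) \<in> ?R" by (rule rtrancl_trans[OF w1 w2])
    then have n2: "r u \<cdot> l a \<in> nonneg_part K \<chi>" by (rule \<chi>.nonneg_reach[OF _ \<chi>.one_nonneg])
    define e where "e = inv\<^sub>K r u \<cdot> r b"
    have ec: "e \<in> carrier K" using u(1) ab by (simp add: e_def)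
    obtain b2 where b2: "\<And>g. g \<in> carrier K \<Longrightarrow> b2 \<le> \<chi> g \<Longrightarrow> (g, g \<cdot> e) \<in> ?R"
      using \<chi>.right_multiply_bound[OF Z ec] by auto
    obtain m :: nat where m: "b2 - \<chi> (r u \<cdot> l a) \<le> \<chi> (l s [^]\<^bsub>K\<^esub> m)" using \<chi>.exists_height[OF s(3) ls] .
    define v where "v = s [^] m"
    have v: "v \<in> carrier G" "l v = l s [^]\<^bsub>K\<^esub> m" using s by (auto simp: v_def l.hom_nat_pow)
    have w3: "(r u \<cdot> l a, r u \<cdot> l a \<cdot> l v) \<in> ?R"
      unfolding v(2) by (rule up[OF n2 ls letter(1)[OF s(1,2)]]) (use s in simp)
    have w4: "(r u \<cdot> l a \<cdot> l v, r u \<cdot> l a \<cdot> l v \<cdot> e) \<in> ?R"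
      by (rule b2) (use m[folded v(2)] u(1) v(1) ab in \<open>auto simp: \<chi>.char_mult\<close>)
    \<comment> \<open>Modulo \<open>N\<close> the copies commute, so \<open>r u\<close> cancels
      against its inverse in \<open>e\<close> and \<open>l v\<close> against its inverse at the end.
      What remains is the product of \<open>l a\<close> and \<open>r b\<close>, so \<open>w\<close>
      and \<open>h\<close> differ by an element of \<open>N\<close>.\<close>
    define w where "w = r u \<cdot> l a \<cdot> l v \<cdot> e \<cdot> inv\<^sub>K l v"
    have wc: "w \<in> carrier K" using u(1) v(1) ab ec by (simp add: w_def)
    have "\<chi> w = \<chi> h" using u(1) v(1) ab ec \<chi>h by (simp add: w_def e_def \<chi>.char_mult \<chi>.char_inv)
    then have wn: "w \<in> nonneg_part K \<chi>" using wc hc by (simp add: nonneg_part_def)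
    have "(w, w \<cdot> l v) \<in> ?R"
      unfolding v(2) by (rule up[OF wn ls letter(1)[OF s(1,2)]]) (use s in simp)
    moreover have "w \<cdot> l v = r u \<cdot> l a \<cdot> l v \<cdot> e" using u(1) v(1) ab ec by (simp add: w_def K.m_assoc)
    ultimately have w5: "(r u \<cdot> l a \<cdot> l v \<cdot> e, w) \<in> ?R" using \<chi>.nonneg_steps_rtrancl_sym by simp
    have w: "(\<one>\<^bsub>K\<^esub>, w) \<in> ?R"
      by (rule rtrancl_trans[OF w1 rtrancl_trans[OF w2 rtrancl_trans[OF w3 rtrancl_trans[OF w4 w5]]]])
    have "\<pi> w = \<pi> (r u) \<otimes>\<^bsub>Q\<^esub> \<pi> (l (a \<otimes> v)) \<otimes>\<^bsub>Q\<^esub> inv\<^bsub>Q\<^esub> \<pi> (r u) \<otimes>\<^bsub>Q\<^esub> \<pi> (r b) \<otimes>\<^bsub>Q\<^esub> inv\<^bsub>Q\<^esub> \<pi> (l v)"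
      using u(1) v(1) ab ec by (simp add: w_def e_def Q.m_assoc)
    also have "\<dots> = \<pi> (l (a \<otimes> v)) \<otimes>\<^bsub>Q\<^esub> \<pi> (r u) \<otimes>\<^bsub>Q\<^esub> inv\<^bsub>Q\<^esub> \<pi> (r u) \<otimes>\<^bsub>Q\<^esub> \<pi> (r b) \<otimes>\<^bsub>Q\<^esub> inv\<^bsub>Q\<^esub> \<pi> (l v)"
      using comm[of "a \<otimes> v" u] u(1) v(1) ab by simp
    also have "\<dots> = \<pi> (l a) \<otimes>\<^bsub>Q\<^esub> (\<pi> (l v) \<otimes>\<^bsub>Q\<^esub> \<pi> (r b)) \<otimes>\<^bsub>Q\<^esub> inv\<^bsub>Q\<^esub> \<pi> (l v)"
      using u(1) v(1) ab by (simp add: Q.m_assoc)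
    also have "\<dots> = \<pi> (l a) \<otimes>\<^bsub>Q\<^esub> (\<pi> (r b) \<otimes>\<^bsub>Q\<^esub> \<pi> (l v)) \<otimes>\<^bsub>Q\<^esub> inv\<^bsub>Q\<^esub> \<pi> (l v)"
      using comm[OF v(1) ab(2)] by simp
    also have "\<dots> = \<pi> h" using v(1) ab by (simp add: Q.m_assoc)
    finally obtain n where n: "n \<in> N" "h = n \<cdot> w" using \<pi>_eq[OF hc(1) wc] by metis
    \<comment> \<open>As \<open>n\<close> has height 0, translating by \<open>n\<close> keeps the
      path from the identity to \<open>w\<close> in the nonnegative half; it then leads from
      \<open>n\<close> to \<open>h\<close>.\<close>
    have "n \<in> nonneg_part K \<chi>" using Nc[OF n(1)] by (simp add: nonneg_part_def)
    from \<chi>.left_translate[OF w this Z(1)] have "(n, h) \<in> ?R" using Nc[OF n(1)] n(2) by simp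
    then show "(\<one>\<^bsub>K\<^esub>, h) \<in> ?R" using N_reach[OF n(1)] by (rule rtrancl_trans[rotated])
  qed
qed

text \<open>Wherever this is applied, \<open>f1\<close> and \<open>f2\<close> are identity or
  trivial maps and \<open>\<Phi>\<close> is a retraction onto \<open>G\<close>. The equation between
  \<open>\<chi>\<close> and \<open>\<psi>\<close> after \<open>\<Phi>\<close> holds on both copies
  and hence everywhere, so a connected nonnegative half would pass to \<open>G\<close>.\<close>

lemma factored_not_connected:
  assumes lim: "limit_group TYPE('c) G" and nc: "\<not> comm_group G"
    and X: "finite_generating_set K X" and \<chi>: "real_character K \<chi>" and nz: "h0 \<in> carrier K" "\<chi> h0 \<noteq> 0"
    and \<psi>: "real_character G \<psi>" and f: "f1 \<in> hom G G" "f2 \<in> hom G G"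
    and comm: "\<And>g. g \<in> carrier G \<Longrightarrow> f1 g \<otimes> f2 g = f2 g \<otimes> f1 g"
    and surj: "f1 ` carrier G = carrier G \<or> f2 ` carrier G = carrier G"
    and eq: "\<And>g. g \<in> carrier G \<Longrightarrow> \<chi> (l g) = \<psi> (f1 g)" "\<And>g. g \<in> carrier G \<Longrightarrow> \<chi> (r g) = \<psi> (f2 g)"
  shows "\<not> nonneg_connected K X \<chi>"
proof
  assume con: "nonneg_connected K X \<chi>"
  interpret \<chi>: real_character K \<chi> by (rule \<chi>)
  interpret \<psi>: real_character G \<psi> by (rule \<psi>)
  obtain \<Phi> where \<Phi>: "\<Phi> \<in> hom K G" "\<And>g. g \<in> carrier G \<Longrightarrow> \<Phi> (l g) = f1 g" "\<And>g. g \<in> carrier G \<Longrightarrow> \<Phi> (r g) = f2 g"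
    using weak_commutativity_hom[OF is_group is_group f comm] by blast
  interpret \<Phi>: group_hom K G \<Phi> by unfold_locales (rule \<Phi>(1))
  have "subgroup {h \<in> carrier K. \<chi> h = \<psi> (\<Phi> h)} K"
    by (rule K.subgroupI) (auto simp: \<chi>.char_mult \<psi>.char_mult \<chi>.char_inv \<psi>.char_inv intro!: exI[of _ "\<one>\<^bsub>K\<^esub>"])
  then have "carrier K \<subseteq> {h \<in> carrier K. \<chi> h = \<psi> (\<Phi> h)}"
    by (rule wc_generated[OF is_group]) (use \<Phi> eq in auto)
  then have \<chi>\<psi>: "\<chi> h = \<psi> (\<Phi> h)" if "h \<in> carrier K" for h using that by blast
  have "carrier G \<subseteq> \<Phi> ` carrier K"
  proof
    fix g assume "g \<in> carrier G"
    then obtain g' where "g' \<in> carrier G" "g = f1 g' \<or> g = f2 g'" using surj by blast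
    then show "g \<in> \<Phi> ` carrier K" using \<Phi>(2,3) l.hom_closed r.hom_closed by (metis imageI)
  qed
  then have onto: "\<Phi> ` carrier K = carrier G" using \<Phi>.hom_closed by blast
  have Xc: "X \<subseteq> carrier K" using X by (simp add: finite_generating_set_def)
  have "finite_generating_set G (\<Phi> ` X)"
    using X \<Phi>.generate_img[OF Xc] onto \<Phi>.hom_closed by (auto simp: finite_generating_set_def)
  moreover have "nonneg_connected G (\<Phi> ` X) \<psi>"
    by (rule nonneg_connected_image[OF K.is_group is_group \<Phi>(1) onto \<chi>\<psi> Xc con])
  moreover have "\<Phi> h0 \<in> carrier G" "\<psi> (\<Phi> h0) \<noteq> 0" using nz \<chi>\<psi> by auto
  ultimately show False using limit_group_not_connected[OF lim nc _ \<psi>] by blast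
qed

lemma nonneg_connected_iff:
  assumes lim: "limit_group TYPE('c) G" and nc: "\<not> comm_group G"
    and X: "finite_generating_set K X" and \<chi>: "\<chi> \<in> characters K"
  shows "nonneg_connected K X \<chi> \<longleftrightarrow>
    char1 G \<chi> \<noteq> zero_hom G \<and> char2 G \<chi> \<noteq> zero_hom G \<and> char1 G \<chi> \<noteq> char2 G \<chi>"
proof -
  have "real_character K \<chi>"
    using \<chi> by unfold_locales (auto simp: characters_def real_homs_def real_group_def hom_def)
  then interpret \<chi>: real_character K \<chi> .
  have "\<exists>h\<in>carrier K. \<chi> h \<noteq> 0"
  proof (rule ccontr)
    assume "\<not> ?thesis"
    then have "\<chi> = zero_hom K"
      using \<chi> by (auto simp: characters_def real_homs_def zero_hom_def extensional_def fun_eq_iff)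
    then show False using \<chi> by (simp add: characters_def)
  qed
  then obtain h0 where h0: "h0 \<in> carrier K" "\<chi> h0 \<noteq> 0" by blast
  note factored = factored_not_connected[OF lim nc X \<chi>.real_character_axioms h0]
  have id: "(\<lambda>g. g) \<in> hom G G" and triv: "(\<lambda>g. \<one>) \<in> hom G G" by (auto simp: hom_def)
  have c1: "char1 G \<chi> = zero_hom G \<longleftrightarrow> (\<forall>g\<in>carrier G. \<chi> (l g) = 0)"
    and c2: "char2 G \<chi> = zero_hom G \<longleftrightarrow> (\<forall>g\<in>carrier G. \<chi> (r g) = 0)"
    and c12: "char1 G \<chi> = char2 G \<chi> \<longleftrightarrow> (\<forall>g\<in>carrier G. \<chi> (l g) = \<chi> (r g))"
    by (auto simp: char1_def char2_def zero_hom_def restrict_def fun_eq_iff)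
  show ?thesis
  proof
    assume con: "nonneg_connected K X \<chi>"
    have "char1 G \<chi> \<noteq> zero_hom G"
    proof
      assume "char1 G \<chi> = zero_hom G"
      then have "\<chi> (l g) = 0" if "g \<in> carrier G" for g using c1 that by blast
      then show False
        using factored[OF character_right[OF \<chi>.real_character_axioms] triv id] con by simp
    qed
    moreover have "char2 G \<chi> \<noteq> zero_hom G"
    proof
      assume "char2 G \<chi> = zero_hom G"
      then have "\<chi> (r g) = 0" if "g \<in> carrier G" for g using c2 that by blast
      then show False
        using factored[OF character_left[OF \<chi>.real_character_axioms] id triv] con by simp
    qed
    moreover have "char1 G \<chi> \<noteq> char2 G \<chi>"
    proof
      assume "char1 G \<chi> = char2 G \<chi>"
      then have "\<chi> (r g) = \<chi> (l g)" if "g \<in> carrier G" for g using c12 that by simp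
      then show False
        using factored[OF character_left[OF \<chi>.real_character_axioms] id id] con by simp
    qed
    ultimately show "char1 G \<chi> \<noteq> zero_hom G \<and> char2 G \<chi> \<noteq> zero_hom G \<and> char1 G \<chi> \<noteq> char2 G \<chi>" by blast
  next
    assume "char1 G \<chi> \<noteq> zero_hom G \<and> char2 G \<chi> \<noteq> zero_hom G \<and> char1 G \<chi> \<noteq> char2 G \<chi>"
    then obtain a b c where abc: "a \<in> carrier G" "\<chi> (l a) \<noteq> 0" "b \<in> carrier G" "\<chi> (r b) \<noteq> 0"
      "c \<in> carrier G" "\<chi> (l c) \<noteq> \<chi> (r c)"
      unfolding c1 c2 c12 by blast
    obtain Y where Y: "finite_generating_set G Y" using lim by (auto simp: limit_group_def)
    have Z: "finite_generating_set K (l ` Y \<union> r ` Y)" by (rule finite_generating_set_wc[OF is_group Y])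
    show "nonneg_connected K X \<chi>"
      by (rule \<chi>.nonneg_connected_change[OF _ _ _ _ h0 nonneg_connected_copies[OF \<chi>.real_character_axioms Y abc]])
        (use X Z in \<open>auto simp: finite_generating_set_def\<close>)
  qed
qed

end

theorem corollaryC:
  fixes G :: "('a, 'm) monoid_scheme" and X :: "('a + 'a) word set set"
  assumes "limit_group TYPE('b) G"
    and "\<not> comm_group G"
    and "finite_generating_set (\<XX> G) X"
  shows "Sigma1 (\<XX> G) X =
    {char_class (\<XX> G) \<chi> | \<chi>. \<chi> \<in> characters (\<XX> G) \<and>
       char1 G \<chi> \<noteq> zero_hom G \<and> char2 G \<chi> \<noteq> zero_hom G \<and> char1 G \<chi> \<noteq> char2 G \<chi>}"
proof -
  have "group G" using assms(1) unfolding limit_group_def by blast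
  then interpret weak_commutativity G by (rule weak_commutativity.intro)
  have "Digraph_Component.connected (cayley_graph (\<XX> G) X \<restriction> nonneg_part (\<XX> G) \<chi>) \<longleftrightarrow>
      char1 G \<chi> \<noteq> zero_hom G \<and> char2 G \<chi> \<noteq> zero_hom G \<and> char1 G \<chi> \<noteq> char2 G \<chi>"
    if \<chi>: "\<chi> \<in> characters (\<XX> G)" for \<chi>
  proof -
    have "real_character (\<XX> G) \<chi>"
      using \<chi> by unfold_locales (auto simp: characters_def real_homs_def real_group_def hom_def)
    moreover have "X \<subseteq> carrier (\<XX> G)" using assms(3) by (simp add: finite_generating_set_def)
    ultimately show ?thesis
      using real_character.connected_iff nonneg_connected_iff[OF assms \<chi>] by blast
  qed
  \<comment> \<open>Both sides collect the classes of characters subject to a condition on the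
    representative, so comparing the conditions character by character suffices.\<close>
  then show ?thesis unfolding Sigma1_def by (intro Collect_cong ex_cong1) blast
qed

end
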